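(* Suppose that the market model $(S_t,\mathcal F_t,\mathsf P)$ satisfies NFLVR, let $\mathsf Q=\rho.\mathsf P$ be an equivalent local martingale measure for it, and let $\rho_t:=\mathsf E^{\mathsf P}(\rho\mid\mathcal F_t)$. Let $T$ be an $(\mathcal F_t)$-stopping time. Then the process $\big(\rho_{t\wedge\sigma\wedge T}/N^{\mathsf P}_{t\wedge\sigma\wedge T}\big)_{t\ge0}$ is a uniformly integrable $(\mathsf P,\mathcal G_t)$-martingale if and only if $$\mathsf E^{\mathsf P}\big(D^{\mathsf P}_\infty\mathbf 1_{\{T_0^{N^{\mathsf P}}\le T\}}\big)=0 .$$
   Context: Let $(\Omega,\mathcal F,(\mathcal F_t)_{t\ge0},\mathsf P)$ be a filtered probability space satisfying the natural conditions: $(\mathcal F_t)$ is right-continuous and $\mathcal F_0$ contains all $\sigma$-negligible sets, where $A\subset\Omega$ is $\sigma$-negligible if there are $B_n\in\mathcal F_n$ with $\mathsf P(B_n)=0$ ($n\ge 0$) and $A\subset\bigcup_n B_n$; moreover $\mathcal F=\mathcal F_\infty:=\bigvee_{t\ge0}\mathcal F_t$. Let $\sigma:\Omega\to[0,\infty]$ be an $\mathcal F$-measurable random time and $\mathcal G_t:=\bigcap_{s>t}(\mathcal F_s\vee\sigma(\mathbf 1_{\{\sigma>r\}};r\le s))$ the progressively enlarged filtration. Standing assumptions: (A) $\mathsf P(\sigma=\tau)=0$ for every $(\mathcal F_t)$-stopping time $\tau$ (including $\tau\equiv\infty$); (C) all $(\mathcal F_t)$-martingales are continuous. Let $Z^{\mathsf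 P}_t:=\mathsf P(\sigma>t\mid\mathcal F_t)$ (continuous), with Itô-Watanabe decomposition $Z^{\mathsf P}=N^{\mathsf P}D^{\mathsf P}$: the unique factorisation in which $N^{\mathsf P}$ is a continuous non-negative local $(\mathsf P,\mathcal F_t)$-martingale with $N^{\mathsf P}_0=1$, $D^{\mathsf P}$ is a continuous decreasing $(\mathcal F_t)$-adapted process, and both are constant on $\{Z^{\mathsf P}=0\}$. $D^{\mathsf P}_\infty:=\lim_{t\to\infty}D^{\mathsf P}_t$ and $T_0^{N^{\mathsf P}}:=\inf\{t>0:N^{\mathsf P}_t=0\}$ (with $\inf\emptyset=\infty$). The market consists of a bond with zero interest rate and a stock $(S_t)$, a continuous $(\mathcal F_t)$-semimartingale. An $a$-admissible strategy ($a\in\mathbb R_+$) is an $(\mathcal F_t)$-predictable $S$-integrable process $\theta$ such that $V(0,\theta)_t:=\int_0^t\theta_s\,dS_s\ge -a$ a.s. for all $t\geq 0$ and $\lim_{t\to\infty}V(0,\theta)_t=:V(0,\theta)_\infty$ exists a.s.; admissible means $a$-admissible for some $a\in\mathbb R_+$. NFLVR means that there do not exist $\varepsilon>0$, admissible strategies $(\theta^n)$ and an increasing sequence $(\delta_n)$ of positive numbers converging to one such that $\mathsf P(V(0,\theta^n)_\infty>-1+\delta_n)=1$ and $\mathsf P(V(0,\theta^n)_\infty>\varepsilon)\ge\varepsilon$ for all $n$. An equivalent local martingale measure is a measure $L_\infty.\mathsf P$ (density $L_\infty$), where $L$ is a strictly positive uniformly integrable $(\mathsf P,\mathcal F_t)$-martingale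 with $L_0=1$, $L_\infty>0$ a.s., such that $(L_tS_t)$ is a local $(\mathsf P,\mathcal F_t)$-martingale; under NFLVR such a measure exists. *)

theory Defs
  imports "HOL-Probability.Probability"
begin

section \<open>Filtered probability spaces and processes\<close>

text \<open>
  A filtration is indexed by \<open>[0,\<infinity>]\<close>, i.e. by \<^typ>\<open>ennreal\<close>, with \<open>F \<top>\<close> in the role of
  \<open>\<F>\<^sub>\<infinity>\<close>; this makes the library's \<^const>\<open>stopping_time\<close> the notion of a stopping time with values
  in \<open>[0,\<infinity>]\<close>. Processes are functions \<^typ>\<open>real \<Rightarrow> 'a \<Rightarrow> real\<close> of which only the times \<open>t \<ge> 0\<close>
  matter. Convention: regularity of paths (continuous, cadlag, finite variation) is required for
  every outcome, while identities and inequalities between processes are required up to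
  indistinguishability.
\<close>

locale natural_filtered_prob_space = prob_space P + filtration "space P" F
  for P :: "'a measure" and F :: "ennreal \<Rightarrow> 'a measure" +
  assumes sets_F_top: "sets (F \<top>) = sets P"
    and sets_F_generated: "sets P = sigma_sets (space P) (\<Union>t\<in>{..<\<top>}. sets (F t))"
    and right_continuous: "\<And>t. t < \<top> \<Longrightarrow> sets (F t) = (\<Inter>s\<in>{t<..}. sets (F s))"
    and negligible:
      "\<And>A B. A \<subseteq> space P \<Longrightarrow>
        (\<And>n::nat. B n \<in> sets (F (of_nat n)) \<and> emeasure P (B n) = 0) \<Longrightarrow>
        A \<subseteq> (\<Union>n. B n) \<Longrightarrow> A \<in> sets (F 0)"

definition adapted :: "(ennreal \<Rightarrow> 'a measure) \<Rightarrow> (real \<Rightarrow> 'a \<Rightarrow> real) \<Rightarrow> bool" where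
  "adapted F X \<longleftrightarrow> (\<forall>t\<ge>0. X t \<in> borel_measurable (F (ennreal t)))"

definition continuous_paths :: "'a measure \<Rightarrow> (real \<Rightarrow> 'a \<Rightarrow> real) \<Rightarrow> bool" where
  "continuous_paths P X \<longleftrightarrow> (\<forall>\<omega>\<in>space P. continuous_on {0..} (\<lambda>t. X t \<omega>))"

definition cadlag_paths :: "'a measure \<Rightarrow> (real \<Rightarrow> 'a \<Rightarrow> real) \<Rightarrow> bool" where
  "cadlag_paths P X \<longleftrightarrow> (\<forall>\<omega>\<in>space P.
     (\<forall>t\<ge>0. continuous (at_right t) (\<lambda>s. X s \<omega>)) \<and>
     (\<forall>t>0. \<exists>l. ((\<lambda>s. X s \<omega>) \<longlongrightarrow> l) (at_left t)))"

definition martingale :: "'a measure \<Rightarrow> (ennreal \<Rightarrow> 'a measure) \<Rightarrow> (real \<Rightarrow> 'a \<Rightarrow> real) \<Rightarrow> bool" where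
  "martingale P F X \<longleftrightarrow> adapted F X \<and> (\<forall>t\<ge>0. integrable P (X t)) \<and>
     (\<forall>s t. 0 \<le> s \<longrightarrow> s \<le> t \<longrightarrow> (AE \<omega> in P. real_cond_exp P (F (ennreal s)) (X t) \<omega> = X s \<omega>))"

definition uniformly_integrable_process :: "'a measure \<Rightarrow> (real \<Rightarrow> 'a \<Rightarrow> real) \<Rightarrow> bool" where
  "uniformly_integrable_process P X \<longleftrightarrow> (\<forall>t\<ge>0. integrable P (X t)) \<and>
     (\<forall>e>0. \<exists>K. \<forall>t\<ge>0. (LINT \<omega>|P. \<bar>X t \<omega>\<bar> * indicat_real {\<omega>. \<bar>X t \<omega>\<bar> > K} \<omega>) \<le> e)"

definition ui_martingale :: "'a measure \<Rightarrow> (ennreal \<Rightarrow> 'a measure) \<Rightarrow> (real \<Rightarrow> 'a \<Rightarrow> real) \<Rightarrow> bool" where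
  "ui_martingale P F X \<longleftrightarrow> martingale P F X \<and> uniformly_integrable_process P X"

definition stopped :: "(real \<Rightarrow> 'a \<Rightarrow> real) \<Rightarrow> ('a \<Rightarrow> ennreal) \<Rightarrow> real \<Rightarrow> 'a \<Rightarrow> real" where
  "stopped X \<tau> t \<omega> = X (enn2real (min (ennreal t) (\<tau> \<omega>))) \<omega>"

text \<open>Subtracting \<open>X\<^sub>0\<close> allows for a non-integrable initial value.\<close>

definition local_martingale :: "'a measure \<Rightarrow> (ennreal \<Rightarrow> 'a measure) \<Rightarrow> (real \<Rightarrow> 'a \<Rightarrow> real) \<Rightarrow> bool" where
  "local_martingale P F X \<longleftrightarrow> adapted F X \<and> cadlag_paths P X \<and>
     (\<exists>\<tau> :: nat \<Rightarrow> 'a \<Rightarrow> ennreal. (\<forall>n. stopping_time F (\<tau> n)) \<and>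
       (AE \<omega> in P. incseq (\<lambda>n. \<tau> n \<omega>) \<and> (\<lambda>n. \<tau> n \<omega>) \<longlonglongrightarrow> \<top>) \<and>
       (\<forall>n. martingale P F (\<lambda>t \<omega>. stopped X (\<tau> n) t \<omega> - X 0 \<omega>)))"

definition cont_local_martingale :: "'a measure \<Rightarrow> (ennreal \<Rightarrow> 'a measure) \<Rightarrow> (real \<Rightarrow> 'a \<Rightarrow> real) \<Rightarrow> bool" where
  "cont_local_martingale P F X \<longleftrightarrow> local_martingale P F X \<and> continuous_paths P X"

section \<open>Lebesgue-Stieltjes integrals along paths of finite variation\<close>

definition variation_sums :: "(real \<Rightarrow> real) \<Rightarrow> real \<Rightarrow> real set" where
  "variation_sums f t =
     {(\<Sum>i<n. \<bar>f (p (Suc i)) - f (p i)\<bar>) | n p. incseq p \<and> 0 \<le> p 0 \<and> p n \<le> t}"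

definition locally_bounded_variation :: "(real \<Rightarrow> real) \<Rightarrow> bool" where
  "locally_bounded_variation f \<longleftrightarrow> (\<forall>t\<ge>0. bdd_above (variation_sums f t))"

definition variation :: "(real \<Rightarrow> real) \<Rightarrow> real \<Rightarrow> real" where
  "variation f t = Sup (variation_sums f t)"

text \<open>
  The paths \<open>f\<close> used below are continuous and locally of bounded variation. The measure \<open>|df|\<close> is the
  interval measure of the variation function, and \<open>df\<close> is the difference of the interval measures of
  the two increasing functions \<open>(variation f + f) / 2\<close> and \<open>(variation f - f) / 2\<close>. All functions are
  frozen at time \<open>0\<close> on the negative axis.
\<close>

definition ls_integrable :: "(real \<Rightarrow> real) \<Rightarrow> (real \<Rightarrow> real) \<Rightarrow> real \<Rightarrow> bool" where
  "ls_integrable h f t \<longleftrightarrow>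
     set_integrable (interval_measure (\<lambda>s. variation f (max 0 s))) {0<..t} h"

definition ls_integral :: "(real \<Rightarrow> real) \<Rightarrow> (real \<Rightarrow> real) \<Rightarrow> real \<Rightarrow> real" where
  "ls_integral h f t =
     (LINT s:{0<..t}|interval_measure (\<lambda>s. (variation f (max 0 s) + f (max 0 s)) / 2). h s) -
     (LINT s:{0<..t}|interval_measure (\<lambda>s. (variation f (max 0 s) - f (max 0 s)) / 2). h s)"

section \<open>Stochastic integration with respect to continuous semimartingales\<close>

definition cont_fv_process :: "'a measure \<Rightarrow> (ennreal \<Rightarrow> 'a measure) \<Rightarrow> (real \<Rightarrow> 'a \<Rightarrow> real) \<Rightarrow> bool" where
  "cont_fv_process P F A \<longleftrightarrow> adapted F A \<and> continuous_paths P A \<and>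
     (\<forall>\<omega>\<in>space P. locally_bounded_variation (\<lambda>t. A t \<omega>))"

definition null_at_zero :: "'a measure \<Rightarrow> (real \<Rightarrow> 'a \<Rightarrow> real) \<Rightarrow> bool" where
  "null_at_zero P X \<longleftrightarrow> (AE \<omega> in P. X 0 \<omega> = 0)"

text \<open>\<open>is_covariation P F M N C\<close>: \<open>C\<close> is a version of the bracket \<open>\<langle>M, N\<rangle>\<close>.\<close>

definition is_covariation ::
  "'a measure \<Rightarrow> (ennreal \<Rightarrow> 'a measure) \<Rightarrow> (real \<Rightarrow> 'a \<Rightarrow> real) \<Rightarrow> (real \<Rightarrow> 'a \<Rightarrow> real) \<Rightarrow>
   (real \<Rightarrow> 'a \<Rightarrow> real) \<Rightarrow> bool" where
  "is_covariation P F M N C \<longleftrightarrow> cont_fv_process P F C \<and> null_at_zero P C \<and>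
     local_martingale P F (\<lambda>t \<omega>. M t \<omega> * N t \<omega> - C t \<omega>)"

definition semimartingale_decomposition ::
  "'a measure \<Rightarrow> (ennreal \<Rightarrow> 'a measure) \<Rightarrow> (real \<Rightarrow> 'a \<Rightarrow> real) \<Rightarrow> (real \<Rightarrow> 'a \<Rightarrow> real) \<Rightarrow>
   (real \<Rightarrow> 'a \<Rightarrow> real) \<Rightarrow> bool" where
  "semimartingale_decomposition P F S M A \<longleftrightarrow>
     cont_local_martingale P F M \<and> null_at_zero P M \<and>
     cont_fv_process P F A \<and> null_at_zero P A \<and>
     (AE \<omega> in P. \<forall>t\<ge>0. S t \<omega> = S 0 \<omega> + M t \<omega> + A t \<omega>)"

definition continuous_semimartingale ::
  "'a measure \<Rightarrow> (ennreal \<Rightarrow> 'a measure) \<Rightarrow> (real \<Rightarrow> 'a \<Rightarrow> real) \<Rightarrow> bool" where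
  "continuous_semimartingale P F S \<longleftrightarrow> adapted F S \<and> continuous_paths P S \<and>
     (\<exists>M A. semimartingale_decomposition P F S M A)"

definition predictable_sigma :: "'a measure \<Rightarrow> (ennreal \<Rightarrow> 'a measure) \<Rightarrow> (real \<times> 'a) measure" where
  "predictable_sigma P F = sigma ({0..} \<times> space P)
     ({{0} \<times> A | A. A \<in> sets (F 0)} \<union>
      {{s<..t} \<times> A | s t A. 0 \<le> s \<and> s < t \<and> A \<in> sets (F (ennreal s))})"

definition predictable :: "'a measure \<Rightarrow> (ennreal \<Rightarrow> 'a measure) \<Rightarrow> (real \<Rightarrow> 'a \<Rightarrow> real) \<Rightarrow> bool" where
  "predictable P F \<theta> \<longleftrightarrow> (\<lambda>(t, \<omega>). \<theta> t \<omega>) \<in> borel_measurable (predictable_sigma P F)"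

text \<open>
  \<open>\<theta>\<close> is integrable with respect to \<open>S = S\<^sub>0 + M + A\<close> if \<open>\<integral>\<^sub>0\<^sup>t \<theta>\<^sup>2 d\<langle>M, M\<rangle>\<close> and \<open>\<integral>\<^sub>0\<^sup>t |\<theta>| |dA|\<close> are
  almost surely finite for all \<open>t\<close>.
\<close>

definition S_integrable ::
  "'a measure \<Rightarrow> (ennreal \<Rightarrow> 'a measure) \<Rightarrow> (real \<Rightarrow> 'a \<Rightarrow> real) \<Rightarrow> (real \<Rightarrow> 'a \<Rightarrow> real) \<Rightarrow> bool" where
  "S_integrable P F S \<theta> \<longleftrightarrow>
     (\<exists>M A C. semimartingale_decomposition P F S M A \<and> is_covariation P F M M C \<and>
       (AE \<omega> in P. \<forall>t\<ge>0. ls_integrable (\<lambda>s. (\<theta> s \<omega>)\<^sup>2) (\<lambda>s. C s \<omega>) t \<and>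
                         ls_integrable (\<lambda>s. \<theta> s \<omega>) (\<lambda>s. A s \<omega>) t))"

text \<open>
  The integral \<open>Y = \<integral> \<theta> dM\<close> is the continuous local martingale null at \<open>0\<close> which satisfies
  \<open>\<langle>Y, N\<rangle> = \<integral> \<theta> d\<langle>M, N\<rangle>\<close> for all continuous local martingales \<open>N\<close> (Kunita-Watanabe).
\<close>

definition is_martingale_integral ::
  "'a measure \<Rightarrow> (ennreal \<Rightarrow> 'a measure) \<Rightarrow> (real \<Rightarrow> 'a \<Rightarrow> real) \<Rightarrow> (real \<Rightarrow> 'a \<Rightarrow> real) \<Rightarrow>
   (real \<Rightarrow> 'a \<Rightarrow> real) \<Rightarrow> bool" where
  "is_martingale_integral P F M \<theta> Y \<longleftrightarrow> cont_local_martingale P F Y \<and> null_at_zero P Y \<and>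
     (\<forall>N. cont_local_martingale P F N \<longrightarrow>
       (\<exists>C C'. is_covariation P F M N C \<and> is_covariation P F Y N C' \<and>
         (AE \<omega> in P. \<forall>t\<ge>0. ls_integrable (\<lambda>s. \<theta> s \<omega>) (\<lambda>s. C s \<omega>) t \<and>
            C' t \<omega> = ls_integral (\<lambda>s. \<theta> s \<omega>) (\<lambda>s. C s \<omega>) t)))"

definition is_stoch_integral ::
  "'a measure \<Rightarrow> (ennreal \<Rightarrow> 'a measure) \<Rightarrow> (real \<Rightarrow> 'a \<Rightarrow> real) \<Rightarrow> (real \<Rightarrow> 'a \<Rightarrow> real) \<Rightarrow>
   (real \<Rightarrow> 'a \<Rightarrow> real) \<Rightarrow> bool" where
  "is_stoch_integral P F S \<theta> V \<longleftrightarrow> adapted F V \<and> continuous_paths P V \<and>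
     (\<exists>M A Y. semimartingale_decomposition P F S M A \<and> is_martingale_integral P F M \<theta> Y \<and>
       (AE \<omega> in P. \<forall>t\<ge>0. ls_integrable (\<lambda>s. \<theta> s \<omega>) (\<lambda>s. A s \<omega>) t \<and>
          V t \<omega> = Y t \<omega> + ls_integral (\<lambda>s. \<theta> s \<omega>) (\<lambda>s. A s \<omega>) t))"

text \<open>The integral process is unique up to indistinguishability; a version is chosen.\<close>

definition stoch_integral ::
  "'a measure \<Rightarrow> (ennreal \<Rightarrow> 'a measure) \<Rightarrow> (real \<Rightarrow> 'a \<Rightarrow> real) \<Rightarrow> (real \<Rightarrow> 'a \<Rightarrow> real) \<Rightarrow>
   real \<Rightarrow> 'a \<Rightarrow> real" where
  "stoch_integral P F S \<theta> = (SOME V. is_stoch_integral P F S \<theta> V)"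

section \<open>The market\<close>

definition a_admissible ::
  "'a measure \<Rightarrow> (ennreal \<Rightarrow> 'a measure) \<Rightarrow> (real \<Rightarrow> 'a \<Rightarrow> real) \<Rightarrow> real \<Rightarrow>
   (real \<Rightarrow> 'a \<Rightarrow> real) \<Rightarrow> bool" where
  "a_admissible P F S a \<theta> \<longleftrightarrow> predictable P F \<theta> \<and> S_integrable P F S \<theta> \<and>
     (\<forall>t\<ge>0. AE \<omega> in P. stoch_integral P F S \<theta> t \<omega> \<ge> - a) \<and>
     (AE \<omega> in P. \<exists>l. ((\<lambda>t. stoch_integral P F S \<theta> t \<omega>) \<longlongrightarrow> l) at_top)"

definition admissible ::
  "'a measure \<Rightarrow> (ennreal \<Rightarrow> 'a measure) \<Rightarrow> (real \<Rightarrow> 'a \<Rightarrow> real) \<Rightarrow> (real \<Rightarrow> 'a \<Rightarrow> real) \<Rightarrow> bool" where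
  "admissible P F S \<theta> \<longleftrightarrow> (\<exists>a\<ge>0. a_admissible P F S a \<theta>)"

definition terminal_wealth ::
  "'a measure \<Rightarrow> (ennreal \<Rightarrow> 'a measure) \<Rightarrow> (real \<Rightarrow> 'a \<Rightarrow> real) \<Rightarrow> (real \<Rightarrow> 'a \<Rightarrow> real) \<Rightarrow> 'a \<Rightarrow> real" where
  "terminal_wealth P F S \<theta> \<omega> = Lim at_top (\<lambda>t. stoch_integral P F S \<theta> t \<omega>)"

definition NFLVR ::
  "'a measure \<Rightarrow> (ennreal \<Rightarrow> 'a measure) \<Rightarrow> (real \<Rightarrow> 'a \<Rightarrow> real) \<Rightarrow> bool" where
  "NFLVR P F S \<longleftrightarrow>
     \<not> (\<exists>e>0. \<exists>(\<theta> :: nat \<Rightarrow> real \<Rightarrow> 'a \<Rightarrow> real) (\<delta> :: nat \<Rightarrow> real).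
          (\<forall>n. admissible P F S (\<theta> n)) \<and> incseq \<delta> \<and> (\<forall>n. \<delta> n > 0) \<and> \<delta> \<longlonglongrightarrow> 1 \<and>
          (\<forall>n. (AE \<omega> in P. terminal_wealth P F S (\<theta> n) \<omega> > - 1 + \<delta> n) \<and>
               measure P {\<omega> \<in> space P. terminal_wealth P F S (\<theta> n) \<omega> > e} \<ge> e))"

definition equiv_local_martingale_measure ::
  "'a measure \<Rightarrow> (ennreal \<Rightarrow> 'a measure) \<Rightarrow> (real \<Rightarrow> 'a \<Rightarrow> real) \<Rightarrow> 'a measure \<Rightarrow> bool" where
  "equiv_local_martingale_measure P F S Q \<longleftrightarrow>
     (\<exists>L Linf. ui_martingale P F L \<and> cadlag_paths P L \<and>
        (AE \<omega> in P. \<forall>t\<ge>0. L t \<omega> > 0) \<and> (AE \<omega> in P. L 0 \<omega> = 1) \<and>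
        Linf \<in> borel_measurable P \<and> (AE \<omega> in P. ((\<lambda>t. L t \<omega>) \<longlongrightarrow> Linf \<omega>) at_top) \<and>
        (AE \<omega> in P. Linf \<omega> > 0) \<and>
        local_martingale P F (\<lambda>t \<omega>. L t \<omega> * S t \<omega>) \<and>
        Q = density P (\<lambda>\<omega>. ennreal (Linf \<omega>)))"

section \<open>The random time\<close>

text \<open>
  Including \<open>s = \<top>\<close> changes nothing for \<open>t < \<top>\<close> and only keeps the intersection non-empty for
  \<open>t = \<top>\<close>.
\<close>

definition progressive_enlargement ::
  "'a measure \<Rightarrow> (ennreal \<Rightarrow> 'a measure) \<Rightarrow> ('a \<Rightarrow> ennreal) \<Rightarrow> ennreal \<Rightarrow> 'a measure" where
  "progressive_enlargement P F \<sigma> t = sigma (space P)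
     (\<Inter>s\<in>insert \<top> {t<..}.
        sigma_sets (space P) (sets (F s) \<union> {{\<omega> \<in> space P. \<sigma> \<omega> > r} | r. r \<le> s}))"

definition avoids_stopping_times ::
  "'a measure \<Rightarrow> (ennreal \<Rightarrow> 'a measure) \<Rightarrow> ('a \<Rightarrow> ennreal) \<Rightarrow> bool" where
  "avoids_stopping_times P F \<sigma> \<longleftrightarrow>
     (\<forall>\<tau>. stopping_time F \<tau> \<longrightarrow> measure P {\<omega> \<in> space P. \<sigma> \<omega> = \<tau> \<omega>} = 0)"

definition all_martingales_continuous :: "'a measure \<Rightarrow> (ennreal \<Rightarrow> 'a measure) \<Rightarrow> bool" where
  "all_martingales_continuous P F \<longleftrightarrow>
     (\<forall>X. martingale P F X \<and> cadlag_paths P X \<longrightarrow>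
        (AE \<omega> in P. continuous_on {0..} (\<lambda>t. X t \<omega>)))"

definition is_azema_supermartingale ::
  "'a measure \<Rightarrow> (ennreal \<Rightarrow> 'a measure) \<Rightarrow> ('a \<Rightarrow> ennreal) \<Rightarrow> (real \<Rightarrow> 'a \<Rightarrow> real) \<Rightarrow> bool" where
  "is_azema_supermartingale P F \<sigma> Z \<longleftrightarrow> adapted F Z \<and> continuous_paths P Z \<and>
     (\<forall>t\<ge>0. AE \<omega> in P. Z t \<omega> =
        real_cond_exp P (F (ennreal t)) (indicat_real {\<omega> \<in> space P. \<sigma> \<omega> > ennreal t}) \<omega>)"

definition ito_watanabe_decomposition ::
  "'a measure \<Rightarrow> (ennreal \<Rightarrow> 'a measure) \<Rightarrow> (real \<Rightarrow> 'a \<Rightarrow> real) \<Rightarrow> (real \<Rightarrow> 'a \<Rightarrow> real) \<Rightarrow>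
   (real \<Rightarrow> 'a \<Rightarrow> real) \<Rightarrow> bool" where
  "ito_watanabe_decomposition P F Z N D \<longleftrightarrow>
     (AE \<omega> in P. \<forall>t\<ge>0. Z t \<omega> = N t \<omega> * D t \<omega>) \<and>
     cont_local_martingale P F N \<and> (AE \<omega> in P. \<forall>t\<ge>0. N t \<omega> \<ge> 0) \<and> (AE \<omega> in P. N 0 \<omega> = 1) \<and>
     adapted F D \<and> continuous_paths P D \<and> (AE \<omega> in P. antimono_on {0..} (\<lambda>t. D t \<omega>)) \<and>
     (AE \<omega> in P. \<forall>s\<ge>0. \<forall>t\<ge>0. Z s \<omega> = 0 \<longrightarrow> Z t \<omega> = 0 \<longrightarrow> N s \<omega> = N t \<omega> \<and> D s \<omega> = D t \<omega>)"

definition limit_at_infinity :: "(real \<Rightarrow> 'a \<Rightarrow> real) \<Rightarrow> 'a \<Rightarrow> real" where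
  "limit_at_infinity X \<omega> = Lim at_top (\<lambda>t. X t \<omega>)"

definition first_zero :: "(real \<Rightarrow> 'a \<Rightarrow> real) \<Rightarrow> 'a \<Rightarrow> ennreal" where
  "first_zero X \<omega> = Inf {ennreal t | t. t > 0 \<and> X t \<omega> = 0}"

end

theory Submission
  imports Defs
begin

text \<open>
  Let \<open>R\<close> be the density process, \<open>H = R / N\<close> and \<open>T0\<close> the first zero of \<open>N\<close>. Let \<open>\<tau>\<close> be a bounded
  stopping time up to which \<open>N\<close> is a martingale and \<open>N\<close>, \<open>1 / N\<close> and \<open>R\<close> are bounded. Then
  \<open>E (H (\<sigma> \<and> \<tau>) ; B, s < \<sigma>) = E (\<rho> D s ; B)\<close> for \<open>B \<in> F s\<close> with \<open>B \<subseteq> {s < \<tau>}\<close>. To see this without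
  stochastic integration, sample \<open>H\<close> along a grid and replace the indicators \<open>\<sigma> > t\<close> by \<open>Z = N D\<close>. Up to
  martingale increments, which have mean zero, what is left are the products of the increments of \<open>D\<close>
  with \<open>R v - R u / N u * N v\<close>, and they vanish with the mesh since \<open>D\<close> is monotone.

  Let \<open>\<tau>\<close> increase to \<open>T0 \<and> T\<close>. Almost surely \<open>\<sigma> < T0\<close>, and \<open>D\<close> is constant after \<open>T0\<close>. With
  \<open>X = H (\<sigma> \<and> T)\<close> this gives
  \<open>E (X ; B, s < \<sigma> \<and> T) = E (\<rho> (D s - D \<infinity> 1{T0 \<le> T}) ; B, s < T0 \<and> T)\<close>. For \<open>s = 0\<close> the mean of \<open>X\<close> falls
  short of the mean of \<open>\<rho>\<close> by \<open>E (\<rho> D \<infinity> ; T0 \<le> T)\<close>, which uniform integrability forces to be zero.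
  Conversely, if this term is zero, then \<open>X\<close> closes the stopped process as a martingale, because each
  event of the enlarged filtration at time \<open>s\<close> agrees on \<open>{s < \<sigma>}\<close> with an event of \<open>F s\<close>.
\<close>

section \<open>Right-continuous processes at random times\<close>

text \<open>The obstacle is a loss of mass. Near the first zero of \<open>N\<close> the quotient
  \<open>H\<close> is unbounded, so the localised identity cannot be passed to the limit by
  domination: on the paths where the localising time \<open>kappa k\<close> comes before \<sigma>
  and \<open>T\<close>, the stopped value is \<open>H\<close> at \<open>kappa k\<close>, and its
  mean there equals that of \<rho> times \<open>D\<close> at \<open>kappa k\<close> over the paths
  where \<open>kappa k\<close> precedes \<open>T\<close>. This part need not vanish; it tends to the
  term with \<open>Dinf\<close>. Once it is subtracted, what remains increases with
  \<open>k\<close>, and monotone convergence applies. In the grid argument the decisive cancellation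
  is \<open>H u * N u = R u\<close>: as \<open>H u * D u\<close> is known at time \<open>u\<close>,
  the martingale property of \<open>N\<close> lets \<open>N v\<close> be replaced by
  \<open>N u\<close>, and that of \<open>R\<close> then brings in \<rho>. All sampling goes through
  one theorem about a process \<open>W t\<close> that is the conditional expectation of
  \<open>Y t\<close>, with \<open>Y\<close> allowed to depend on \<open>t\<close>, because
  \<open>Z\<close> is only a supermartingale. Continuity of all martingales enters through
  \<open>R\<close>: together with that of \<open>N\<close> it makes \<open>H\<close> uniformly
  continuous on compact time intervals before \<open>T0\<close>.\<close>

lemma tendsto_right_continuous:
  fixes f :: "real \<Rightarrow> real"
  assumes "continuous (at_right u) f" "v \<longlonglongrightarrow> u" "\<And>n. u \<le> v n"
  shows "(\<lambda>n. f (v n)) \<longlonglongrightarrow> f u"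
proof -
  have "continuous (at u within {u..}) f"
    using assms(1) by (simp add: at_within_Ici_at_right)
  then show ?thesis
    using assms(2,3) unfolding continuous_within_sequentially comp_def by auto
qed

lemma LIMSEQ_from_above:
  fixes u :: real
  assumes "\<And>n. u \<le> v n" "\<And>n. v n \<le> u + 1 / real (Suc n)"
  shows "v \<longlonglongrightarrow> u"
proof (rule tendsto_sandwich[where f="\<lambda>_. u" and h="\<lambda>n. u + 1 / real (Suc n)"])
  show "(\<lambda>n. u + 1 / real (Suc n)) \<longlonglongrightarrow> u"
    using LIMSEQ_inverse_real_of_nat_add[of u] by (simp add: inverse_eq_divide)
qed (use assms in \<open>auto intro!: always_eventually\<close>)

text \<open>Rounding goes upwards because the paths are only right-continuous. The values form a
  countable set, which reduces questions at a random time to fixed times; \<open>nat\<close> sends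
  negative arguments to 0.\<close>

definition round_up :: "nat \<Rightarrow> real \<Rightarrow> real" where
  "round_up m t = real (nat \<lceil>t * real (Suc m)\<rceil>) / real (Suc m)"

lemma round_up_ge: "t \<le> round_up m t"
  using real_nat_ceiling_ge[of "t * real (Suc m)"] by (simp add: round_up_def pos_le_divide_eq)

lemma round_up_le:
  assumes "0 \<le> t"
  shows "round_up m t \<le> t + 1 / real (Suc m)"
proof -
  have "real (nat \<lceil>t * real (Suc m)\<rceil>) \<le> t * real (Suc m) + 1"
    using assms by (simp add: of_nat_nat)
  then show ?thesis unfolding round_up_def by (simp add: divide_simps)
qed

lemma tendsto_round_up:
  assumes "continuous (at_right t) f" "0 \<le> t"
  shows "(\<lambda>m. f (round_up m t) :: real) \<longlonglongrightarrow> f t"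
  by (rule tendsto_right_continuous[OF assms(1) LIMSEQ_from_above[OF round_up_ge round_up_le[OF assms(2)]] round_up_ge])

text \<open>Only the variables \<open>X r\<close> with r \<le> t may be used, so that
  \<open>M\<close> can be the sigma-algebra of time \<open>t\<close>. Rounding up can overshoot
  \<open>t\<close>, hence the cap \<open>min t\<close>.\<close>

lemma measurable_at_bounded_random_time:
  fixes X :: "real \<Rightarrow> 'a \<Rightarrow> real"
  assumes U [measurable]: "U \<in> borel_measurable M"
    and U_range: "\<And>w. w \<in> space M \<Longrightarrow> 0 \<le> U w \<and> U w \<le> t"
    and X: "\<And>r. 0 \<le> r \<Longrightarrow> r \<le> t \<Longrightarrow> X r \<in> borel_measurable M"
    and rc: "\<And>w r. w \<in> space M \<Longrightarrow> 0 \<le> r \<Longrightarrow> continuous (at_right r) (\<lambda>s. X s w)"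
  shows "(\<lambda>w. X (U w) w) \<in> borel_measurable M"
proof (cases "space M = {}")
  case True
  then show ?thesis by (simp add: measurable_def)
next
  case False
  then have t: "0 \<le> t" using U_range by fastforce
  show ?thesis
  proof (rule borel_measurable_LIMSEQ_real)
    fix m
    show "(\<lambda>w. X (min t (round_up m (U w))) w) \<in> borel_measurable M"
      unfolding round_up_def
      by (rule measurable_compose_countable
          [where f="\<lambda>i. X (min t (real i / real (Suc m)))" and g="\<lambda>w. nat \<lceil>U w * real (Suc m)\<rceil>"])
        (use t in \<open>auto intro!: X\<close>)
  next
    fix w assume w: "w \<in> space M"
    have ge: "U w \<le> min t (round_up m (U w))" for m
      using U_range[OF w] round_up_ge by simp
    have "min t (round_up m (U w)) \<le> U w + 1 / real (Suc m)" for m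
      using U_range[OF w] by (intro min.coboundedI2 round_up_le) simp
    with ge have "(\<lambda>m. min t (round_up m (U w))) \<longlonglongrightarrow> U w" by (rule LIMSEQ_from_above)
    then show "(\<lambda>m. X (min t (round_up m (U w))) w) \<longlonglongrightarrow> X (U w) w"
      using rc[OF w] U_range[OF w] ge by (intro tendsto_right_continuous[where f="\<lambda>s. X s w"]) auto
  qed
qed

lemma measurable_at_random_time:
  fixes X :: "real \<Rightarrow> 'a \<Rightarrow> real"
  assumes U [measurable]: "U \<in> borel_measurable M"
    and U_range: "\<And>w. w \<in> space M \<Longrightarrow> 0 \<le> U w"
    and X: "\<And>r. 0 \<le> r \<Longrightarrow> X r \<in> borel_measurable M"
    and rc: "\<And>w r. w \<in> space M \<Longrightarrow> 0 \<le> r \<Longrightarrow> continuous (at_right r) (\<lambda>s. X s w)"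
  shows "(\<lambda>w. X (U w) w) \<in> borel_measurable M"
proof (rule borel_measurable_LIMSEQ_real)
  show "(\<lambda>w. X (min (U w) (real n)) w) \<in> borel_measurable M" for n
    by (rule measurable_at_bounded_random_time[where t="real n"]) (use U_range X rc in auto)
  fix w assume "w \<in> space M"
  obtain n where n: "U w \<le> real n" using real_arch_simple by blast
  have "eventually (\<lambda>m. X (min (U w) (real m)) w = X (U w) w) sequentially"
    using eventually_ge_at_top[of n]
  proof eventually_elim
    case (elim m)
    with n have "U w \<le> real m" by linarith
    then show ?case by (simp add: min_def)
  qed
  then show "(\<lambda>m. X (min (U w) (real m)) w) \<longlonglongrightarrow> X (U w) w"
    by (rule tendsto_eventually)
qed

section \<open>Uniform integrability\<close>

text \<open>Abstracts what a conditional expectation \<open>g\<close> of \<psi> satisfies with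
  equality, its superlevel sets being events of the smaller sigma-algebra. A single \<psi> for a
  whole family is a form of uniform integrability.\<close>

definition tail_dominated :: "'a measure \<Rightarrow> ('a \<Rightarrow> real) \<Rightarrow> ('a \<Rightarrow> real) \<Rightarrow> bool" where
  "tail_dominated M \<psi> g \<longleftrightarrow> (\<forall>K\<ge>0. (LINT x|M. g x * indicat_real {x\<in>space M. g x > K} x)
     \<le> (LINT x|M. \<psi> x * indicat_real {x\<in>space M. g x > K} x))"

text \<open>On the event g > K, split \<psi> at a level n: the part above n is small because \<psi>
  is integrable, the rest is at most n times the probability of the event, which Markov's inequality
  bounds by the mean of \<psi> over K. None of this depends on \<open>g\<close>, so
  \<open>K0\<close> is uniform over the dominated family.\<close>

lemma (in prob_space) uniformly_dominated_tail:
  assumes psi: "integrable M \<psi>" "AE x in M. 0 \<le> \<psi> x" and "e > 0"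
  obtains K0 where "K0 > 0"
    "\<And>g K. integrable M g \<Longrightarrow> AE x in M. 0 \<le> g x \<Longrightarrow> K \<ge> K0 \<Longrightarrow> tail_dominated M \<psi> g \<Longrightarrow>
       (LINT x|M. g x * indicat_real {x\<in>space M. g x > K} x) \<le> e"
proof -
  have [measurable]: "\<psi> \<in> borel_measurable M" using psi by auto
  have "(\<lambda>n. LINT x|M. \<psi> x * indicat_real {x\<in>space M. \<psi> x > real n} x) \<longlonglongrightarrow> (LINT x|M. 0)"
  proof (rule integral_dominated_convergence[where w="\<lambda>x. norm (\<psi> x)"])
    show "AE x in M. (\<lambda>n. \<psi> x * indicat_real {x\<in>space M. \<psi> x > real n} x) \<longlonglongrightarrow> 0"
    proof (rule AE_I2)
      fix x
      obtain n where n: "\<psi> x \<le> real n" using real_arch_simple by blast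
      have "eventually (\<lambda>m. \<psi> x * indicat_real {x\<in>space M. \<psi> x > real m} x = 0) sequentially"
        using eventually_ge_at_top[of n]
        by eventually_elim (use n in \<open>auto simp: indicator_def\<close>)
      then show "(\<lambda>n. \<psi> x * indicat_real {x\<in>space M. \<psi> x > real n} x) \<longlonglongrightarrow> 0"
        by (rule tendsto_eventually)
    qed
  qed (use psi in \<open>auto intro!: AE_I2 simp: indicator_def\<close>)
  then have "eventually (\<lambda>n. (LINT x|M. \<psi> x * indicat_real {x\<in>space M. \<psi> x > real n} x) < e/2) sequentially"
    using \<open>e > 0\<close> by (intro order_tendstoD(2)) auto
  then obtain n where n: "(LINT x|M. \<psi> x * indicat_real {x\<in>space M. \<psi> x > real n} x) < e/2"
    using eventually_happens'[OF sequentially_bot] by blast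
  define E where "E = (LINT x|M. \<psi> x)"
  have E: "E \<ge> 0" unfolding E_def using psi by (intro integral_nonneg_AE) auto
  \<comment> \<open>Chosen so that n * E / K is at most e / 2 for all K \<ge> K0; the added ones
    keep it positive when n or E is 0.\<close>
  define K0 where "K0 = 2 * (real n + 1) * (E + 1) / e"
  have K0: "K0 > 0" using E \<open>e > 0\<close> unfolding K0_def by (auto intro!: divide_pos_pos mult_pos_pos)
  show thesis
  proof (rule that[OF K0])
    fix g K assume g: "integrable M g" "AE x in M. 0 \<le> g x" and K: "K \<ge> K0"
      and dom: "tail_dominated M \<psi> g"
    have [measurable]: "g \<in> borel_measurable M" using g by auto
    let ?A = "{x\<in>space M. g x > K}"
    have int: "integrable M (\<lambda>x. h x * indicat_real S x)" if "integrable M h" "S \<in> sets M" for h S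
      using integrable_mult_indicator[OF that(2,1)] by (simp add: mult.commute)
    have "K * measure M ?A = (LINT x|M. K * indicat_real ?A x)" by simp
    also have "\<dots> \<le> (LINT x|M. g x * indicat_real ?A x)"
      by (intro integral_mono int g) (auto simp: indicator_def)
    also have "\<dots> \<le> (LINT x|M. \<psi> x * indicat_real ?A x)" using dom K K0 by (simp add: tail_dominated_def)
    also have "\<dots> \<le> E" unfolding E_def
      by (intro integral_mono_AE int psi) (use psi in \<open>auto simp: indicator_def\<close>)
    finally have P: "measure M ?A \<le> E / K" using K K0 by (simp add: field_simps)
    have "(LINT x|M. g x * indicat_real ?A x) \<le> (LINT x|M. \<psi> x * indicat_real ?A x)" using dom K K0 by (simp add: tail_dominated_def)
    also have "\<dots> \<le> (LINT x|M. \<psi> x * indicat_real {x\<in>space M. \<psi> x > real n} x + real n * indicat_real ?A x)"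
      by (intro integral_mono_AE int psi Bochner_Integration.integrable_add)
        (use psi in \<open>auto simp: indicator_def\<close>)
    also have "\<dots> = (LINT x|M. \<psi> x * indicat_real {x\<in>space M. \<psi> x > real n} x) + real n * measure M ?A"
    proof (subst Bochner_Integration.integral_add)
      have "integrable M (indicat_real ?A)"
        by (intro integrable_real_indicator) (auto simp: less_top[symmetric])
      then show "integrable M (\<lambda>x. real n * indicat_real ?A x)" by simp
    qed (auto intro!: int psi)
    also have "\<dots> \<le> e/2 + real n * (E / K)"
      using n P by (intro add_mono mult_left_mono) auto
    also have "real n * (E / K) \<le> e / 2"
    proof -
      have "K > 0" using K K0 by linarith
      have "2 * real n * E \<le> 2 * (real n + 1) * (E + 1)" using E by (simp add: algebra_simps)
      also have "\<dots> = K0 * e" unfolding K0_def using \<open>e>0\<close> by simp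
      also have "\<dots> \<le> K * e" using K \<open>e>0\<close> by simp
      finally show ?thesis using \<open>K > 0\<close> by (simp add: field_simps)
    qed
    finally show "(LINT x|M. g x * indicat_real ?A x) \<le> e" by simp
  qed
qed

text \<open>A Vitali-type theorem in which dominated tails replace a dominating function. Truncation
  at a common level K costs little for every \<open>g n\<close> and for \<open>h\<close>, and the
  truncated variables converge boundedly.\<close>

lemma (in prob_space) uniformly_dominated_limit:
  assumes psi: "integrable M \<psi>" "AE x in M. 0 \<le> \<psi> x"
    and g: "\<And>n. integrable M (g n)" "\<And>n. AE x in M. 0 \<le> g n x"
    and tail: "\<And>n. tail_dominated M \<psi> (g n)"
    and lim: "AE x in M. (\<lambda>n. g n x) \<longlonglongrightarrow> h x" and h [measurable]: "h \<in> borel_measurable M"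
    and f [measurable]: "f \<in> borel_measurable M" and fC: "AE x in M. \<bar>f x\<bar> \<le> C"
  shows "integrable M h" "(\<lambda>n. LINT x|M. f x * g n x) \<longlonglongrightarrow> (LINT x|M. f x * h x)"
proof -
  have [measurable]: "g n \<in> borel_measurable M" for n using g by auto
  have [measurable]: "\<psi> \<in> borel_measurable M" using psi by auto
  have h0: "AE x in M. 0 \<le> h x"
  proof -
    have "AE x in M. \<forall>n. 0 \<le> g n x" using g by (simp add: AE_all_countable)
    with lim show ?thesis by eventually_elim (auto intro: LIMSEQ_le_const)
  qed
  have Eg: "(LINT x|M. g n x) \<le> (LINT x|M. \<psi> x)" for n
  proof -
    \<comment> \<open>The tail inequality at level 0 compares the means.\<close>
    have "(LINT x|M. g n x) = (LINT x|M. g n x * indicat_real {x\<in>space M. g n x > 0} x)"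
      by (rule integral_cong_AE) (use g(2)[of n] in \<open>auto simp: indicator_def\<close>)
    also have "\<dots> \<le> (LINT x|M. \<psi> x * indicat_real {x\<in>space M. g n x > 0} x)"
      using tail by (simp add: tail_dominated_def)
    also have "\<dots> \<le> (LINT x|M. \<psi> x)"
      using integrable_mult_indicator[of "{x\<in>space M. g n x > 0}" M \<psi>] psi
      by (intro integral_mono_AE) (auto simp: mult.commute indicator_def)
    finally show ?thesis .
  qed
  have "(\<integral>\<^sup>+ x. ennreal (h x) \<partial>M) = (\<integral>\<^sup>+ x. liminf (\<lambda>n. ennreal (g n x)) \<partial>M)"
  proof (rule nn_integral_cong_AE)
    show "AE x in M. ennreal (h x) = liminf (\<lambda>n. ennreal (g n x))"
      using lim by eventually_elim (auto intro!: lim_imp_Liminf[symmetric] tendsto_ennrealI)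
  qed
  also have "\<dots> \<le> liminf (\<lambda>n. \<integral>\<^sup>+ x. ennreal (g n x) \<partial>M)"
    by (rule nn_integral_liminf) simp
  also have "\<dots> = liminf (\<lambda>n. ennreal (LINT x|M. g n x))"
    using g by (simp add: nn_integral_eq_integral)
  also have "\<dots> \<le> ennreal (LINT x|M. \<psi> x)"
    using Eg by (intro Liminf_le always_eventually allI ennreal_leI) auto
  finally have "(\<integral>\<^sup>+ x. ennreal (h x) \<partial>M) < \<infinity>"
    using le_less_trans[OF _ ennreal_less_top] by auto
  then show ih: "integrable M h"
    using h0 by (intro integrableI_nonneg) auto
  have C: "C \<ge> 0"
  proof -
    have "AE x in M. 0 \<le> C" using fC by eventually_elim linarith
    then show ?thesis by simp
  qed
  have ifx: "integrable M (\<lambda>x. f x * u x)" if "integrable M u" for u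
  proof (rule Bochner_Integration.integrable_bound[where f="\<lambda>x. C * u x"])
    show "integrable M (\<lambda>x. C * u x)" using that by simp
    show "(\<lambda>x. f x * u x) \<in> borel_measurable M" using that by measurable
    show "AE x in M. norm (f x * u x) \<le> norm (C * u x)"
      using fC by eventually_elim (auto simp: abs_mult intro!: mult_right_mono)
  qed
  show "(\<lambda>n. LINT x|M. f x * g n x) \<longlonglongrightarrow> (LINT x|M. f x * h x)"
  proof (rule LIMSEQ_I)
    fix e :: real assume "e > 0"
    \<comment> \<open>Each of the two truncations costs at most C * e' \<le> e / 4, and the
      truncated integrals differ by less than e / 4; three quarters of e suffice.\<close>
    define e' where "e' = e / (4 * (C + 1))"
    have e': "e' > 0" "C * e' \<le> e / 4" using \<open>e > 0\<close> C unfolding e'_def by (auto simp: field_simps)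
    obtain K0 where K0: "K0 > 0" and K0': "\<And>g K. integrable M g \<Longrightarrow> AE x in M. 0 \<le> g x \<Longrightarrow> K \<ge> K0 \<Longrightarrow>
        tail_dominated M \<psi> g \<Longrightarrow> (LINT x|M. g x * indicat_real {x\<in>space M. g x > K} x) \<le> e'"
      using uniformly_dominated_tail[OF psi e'(1)] by blast
    \<comment> \<open>The limit is truncated as well; for it the same lemma is used with
      \<open>h\<close> dominating itself.\<close>
    obtain K1 where K1: "K1 > 0" and K1': "\<And>g K. integrable M g \<Longrightarrow> AE x in M. 0 \<le> g x \<Longrightarrow> K \<ge> K1 \<Longrightarrow>
        tail_dominated M h g \<Longrightarrow> (LINT x|M. g x * indicat_real {x\<in>space M. g x > K} x) \<le> e'"
      using uniformly_dominated_tail[OF ih h0 e'(1)] by blast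
    define K where "K = max K0 K1"
    have tr: "\<bar>(LINT x|M. f x * u x) - (LINT x|M. f x * min (u x) K)\<bar> \<le> e / 4"
      if u: "integrable M u" "AE x in M. 0 \<le> u x" and ue: "(LINT x|M. u x * indicat_real {x\<in>space M. u x > K} x) \<le> e'" for u
    proof -
      have [measurable]: "u \<in> borel_measurable M" using u by auto
      have im: "integrable M (\<lambda>x. min (u x) K)" using u by auto
      have iu: "integrable M (\<lambda>x. u x * indicat_real {x\<in>space M. u x > K} x)"
        using integrable_mult_indicator[of "{x\<in>space M. u x > K}" M u] u by (simp add: mult.commute)
      have "\<bar>(LINT x|M. f x * u x) - (LINT x|M. f x * min (u x) K)\<bar> = \<bar>LINT x|M. f x * u x - f x * min (u x) K\<bar>"
        by (subst Bochner_Integration.integral_diff) (use ifx u im in auto)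
      also have "\<dots> \<le> (LINT x|M. \<bar>f x * u x - f x * min (u x) K\<bar>)" by (rule integral_abs_bound)
      also have "\<dots> \<le> (LINT x|M. C * (u x * indicat_real {x\<in>space M. u x > K} x))"
      proof (rule integral_mono_AE)
        show "AE x in M. \<bar>f x * u x - f x * min (u x) K\<bar> \<le> C * (u x * indicat_real {x\<in>space M. u x > K} x)"
          using fC u(2) AE_space
        proof eventually_elim
          case (elim x)
          have "\<bar>f x * u x - f x * min (u x) K\<bar> = \<bar>f x\<bar> * \<bar>u x - min (u x) K\<bar>"
            by (metis abs_mult right_diff_distrib)
          also have "\<dots> \<le> C * (u x * indicat_real {x\<in>space M. u x > K} x)"
            using elim K0 K1 C by (intro mult_mono) (auto simp: indicator_def K_def)
          finally show ?case .
        qed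
      qed (use ifx u im iu in auto)
      also have "\<dots> = C * (LINT x|M. u x * indicat_real {x\<in>space M. u x > K} x)" by simp
      also have "\<dots> \<le> C * e'" using ue C by (rule mult_left_mono)
      finally show ?thesis using e' by linarith
    qed
    have "(\<lambda>n. LINT x|M. f x * min (g n x) K) \<longlonglongrightarrow> (LINT x|M. f x * min (h x) K)"
    proof (rule integral_dominated_convergence[where w="\<lambda>x. C * K"])
      show "AE x in M. (\<lambda>n. f x * min (g n x) K) \<longlonglongrightarrow> f x * min (h x) K"
        using lim by eventually_elim (auto intro!: tendsto_intros)
      show "AE x in M. norm (f x * min (g n x) K) \<le> C * K" for n
        using g(2)[of n] fC
        by eventually_elim (use K0 K1 in \<open>auto simp: abs_mult K_def intro!: mult_mono\<close>)
    qed auto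
    then obtain n0 where n0: "\<And>n. n \<ge> n0 \<Longrightarrow> \<bar>(LINT x|M. f x * min (g n x) K) - (LINT x|M. f x * min (h x) K)\<bar> < e / 4"
      using LIMSEQ_D[of _ _ "e/4"] \<open>e > 0\<close> unfolding real_norm_def by fastforce
    show "\<exists>n0. \<forall>n\<ge>n0. norm ((LINT x|M. f x * g n x) - (LINT x|M. f x * h x)) < e"
    proof (intro exI[of _ n0] allI impI)
      fix n assume "n \<ge> n0"
      have 1: "\<bar>(LINT x|M. f x * g n x) - (LINT x|M. f x * min (g n x) K)\<bar> \<le> e / 4"
        by (intro tr g K0' tail) (auto simp: K_def)
      have 2: "\<bar>(LINT x|M. f x * h x) - (LINT x|M. f x * min (h x) K)\<bar> \<le> e / 4"
        by (intro tr ih h0 K1') (auto simp: K_def tail_dominated_def)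
      show "norm ((LINT x|M. f x * g n x) - (LINT x|M. f x * h x)) < e"
        using 1 2 n0[OF \<open>n \<ge> n0\<close>] \<open>e > 0\<close> unfolding real_norm_def by linarith
    qed
  qed
qed

section \<open>Optional sampling\<close>

text \<open>Real time, because the sampling argument rounds and compares times arithmetically. Times
  with values in [0, \<infinity>] are truncated before they are used here.\<close>

locale real_filtered_prob_space = prob_space P + filtration "space P" G
  for P :: "'a measure" and G :: "real \<Rightarrow> 'a measure" +
  assumes sets_G_subset: "sets (G t) \<subseteq> sets P"
begin

lemma subalgebra_G: "subalgebra P (G t)"
  using sets_G_subset space_F by (simp add: subalgebra_def)

lemma sigma_finite_subalgebra_G: "sigma_finite_subalgebra P (G t)"
  by (intro finite_measure_subalgebra_is_sigma_finite finite_measure_subalgebra.intro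
      finite_measure_subalgebra_axioms.intro subalgebra_G) unfold_locales

lemma measurable_G: "f \<in> borel_measurable (G t) \<Longrightarrow> f \<in> borel_measurable P"
  by (rule measurable_from_subalg[OF subalgebra_G])

lemma measurable_G_mono: "s \<le> t \<Longrightarrow> f \<in> borel_measurable (G s) \<Longrightarrow> f \<in> borel_measurable (G t)"
  by (rule measurable_from_subalg[rotated]) (use sets_F_mono space_F in \<open>auto simp: subalgebra_def\<close>)

lemma stopping_time_measurable: "stopping_time G \<tau> \<Longrightarrow> \<tau> \<in> borel_measurable P"
  by (rule measurable_stopping_time[OF _ sets_G_subset]) (auto simp: space_F)

text \<open>Brings a variable known at \<tau> to a fixed time, where conditional expectations are
  available; the restriction to \<tau> \<le> t is exactly what the definition of
  \<open>pre_sigma\<close> controls.\<close>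

lemma measurable_pre_sigma_restrict:
  assumes \<tau>: "stopping_time G \<tau>" and f: "f \<in> borel_measurable (pre_sigma \<tau>)"
  shows "(\<lambda>w. indicat_real {w\<in>space P. \<tau> w \<le> t} w * f w) \<in> borel_measurable (G t)"
proof -
  let ?A = "{w\<in>space P. \<tau> w \<le> t}"
  have A: "?A \<in> sets (G t)"
    using stopping_timeD[OF \<tau>, of t] by (simp add: pred_def space_F)
  have A': "?A \<inter> space (G t) \<in> sets (G t)"
    using A by (rule sets.Int) (rule sets.top)
  have "f \<in> borel_measurable (restrict_space (G t) ?A)"
  proof (rule measurableI)
    fix B :: "real set" assume "B \<in> sets borel"
    then have "f -` B \<inter> space P \<in> sets (pre_sigma \<tau>)"
      using measurable_sets[OF f] by (simp add: space_pre_sigma)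
    from sets_pre_sigmaD[OF \<tau> this, of t]
    have "{w \<in> f -` B \<inter> space P. \<tau> w \<le> t} \<in> sets (G t)" .
    moreover have "f -` B \<inter> space (restrict_space (G t) ?A) = {w \<in> f -` B \<inter> space P. \<tau> w \<le> t}"
      by (auto simp: space_restrict_space space_F)
    ultimately show "f -` B \<inter> space (restrict_space (G t) ?A) \<in> sets (restrict_space (G t) ?A)"
      using A' by (subst sets_restrict_space_iff) auto
  qed auto
  then show ?thesis
    by (subst (asm) borel_measurable_restrict_space_iff[OF A']) simp
qed

lemma sets_pre_sigma_after:
  assumes \<tau>: "stopping_time G \<tau>" and A: "A \<in> sets (G s)" and le: "\<And>w. w \<in> A \<Longrightarrow> s \<le> \<tau> w"
  shows "A \<in> sets (pre_sigma \<tau>)"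
proof (rule sets_pre_sigmaI[OF \<tau>])
  fix t
  have sub: "A \<subseteq> space P" using sets.sets_into_space[OF A] by (simp add: space_F)
  show "{w \<in> A. \<tau> w \<le> t} \<in> sets (G t)"
  proof (cases "s \<le> t")
    case True
    then have "A \<in> sets (G t)" using A sets_F_mono[OF True] by auto
    moreover have "{w \<in> space P. \<tau> w \<le> t} \<in> sets (G t)"
      using stopping_timeD[OF \<tau>, of t] by (simp add: pred_def space_F)
    ultimately have "A \<inter> {w \<in> space P. \<tau> w \<le> t} \<in> sets (G t)" by (rule sets.Int)
    also have "A \<inter> {w \<in> space P. \<tau> w \<le> t} = {w \<in> A. \<tau> w \<le> t}" using sub by auto
    finally show ?thesis .
  next
    case False
    then have "{w \<in> A. \<tau> w \<le> t} = {}" using le by force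
    then show ?thesis by (simp only: sets.empty_sets)
  qed
qed

lemma sets_before_stopping_time:
  assumes \<tau>: "stopping_time G \<tau>" and A: "A \<in> sets (G s)"
  shows "{w \<in> A. s < \<tau> w} \<in> sets (G s)"
proof -
  have sub: "A \<subseteq> space P" using sets.sets_into_space[OF A] by (simp add: space_F)
  have "{w \<in> space P. s < \<tau> w} \<in> sets (G s)"
    using stopping_timeD2[OF \<tau>, of s] by (simp add: pred_def space_F)
  then have "A \<inter> {w \<in> space P. s < \<tau> w} \<in> sets (G s)" using A by (intro sets.Int)
  also have "A \<inter> {w \<in> space P. s < \<tau> w} = {w \<in> A. s < \<tau> w}" using sub by auto
  finally show ?thesis .
qed

text \<open>\<open>W\<close> is the projection of \<open>Y\<close>, and \<open>Y\<close> may vary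
  with time: it is constant in time for \<open>R\<close> and for the stopped \<open>N\<close>, while
  for \<open>Z\<close> it is the indicator that \<sigma> exceeds \<open>t\<close>. The rounded time
  has finitely many values since \<tau> \<le> c, and on each of them the defining property of the
  conditional expectation applies. The limit in \<open>m\<close> uses right-continuity;
  \<open>Y\<close> is dominated by \<open>Yb\<close>, and for \<open>W\<close> the tails are
  dominated by \<open>Yb\<close>.\<close>

lemma optional_sampling:
  fixes W Y :: "real \<Rightarrow> 'a \<Rightarrow> real"
  assumes \<tau>: "stopping_time G \<tau>" and \<tau>_range: "\<And>w. w \<in> space P \<Longrightarrow> 0 \<le> \<tau> w \<and> \<tau> w \<le> c"
    and W: "\<And>t. 0 \<le> t \<Longrightarrow> W t \<in> borel_measurable (G t)"
    and W_rc: "\<And>w t. w \<in> space P \<Longrightarrow> 0 \<le> t \<Longrightarrow> continuous (at_right t) (\<lambda>s. W s w)"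
    and W_nonneg: "AE w in P. \<forall>t\<ge>0. 0 \<le> W t w"
    and Y: "\<And>t. 0 \<le> t \<Longrightarrow> Y t \<in> borel_measurable P"
    and Y_rc: "\<And>w t. w \<in> space P \<Longrightarrow> 0 \<le> t \<Longrightarrow> continuous (at_right t) (\<lambda>s. Y s w)"
    and Y_bound: "AE w in P. \<forall>t\<ge>0. 0 \<le> Y t w \<and> Y t w \<le> Yb w" and Yb: "integrable P Yb"
    and WY: "\<And>t. 0 \<le> t \<Longrightarrow> AE w in P. W t w = real_cond_exp P (G t) (Y t) w"
    and f: "f \<in> borel_measurable (pre_sigma \<tau>)" and fC: "AE w in P. \<bar>f w\<bar> \<le> C"
  shows "integrable P (\<lambda>w. W (\<tau> w) w)"
    and "(LINT w|P. f w * W (\<tau> w) w) = (LINT w|P. f w * Y (\<tau> w) w)"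
proof -
  note [measurable] = stopping_time_measurable[OF \<tau>]
  have WP: "W t \<in> borel_measurable P" if "0 \<le> t" for t using W[OF that] by (rule measurable_G)
  have Yb0: "AE w in P. 0 \<le> Yb w" using Y_bound by eventually_elim (meson order.trans order_refl)
  define j where "j m w = nat \<lceil>\<tau> w * real (Suc m)\<rceil>" for m w
  have [measurable]: "j m \<in> P \<rightarrow>\<^sub>M count_space UNIV" for m unfolding j_def by measurable
  have j_le: "j m w \<le> i \<longleftrightarrow> \<tau> w \<le> real i / real (Suc m)" for m w i
    unfolding j_def nat_ceiling_le_eq by (subst pos_le_divide_eq) auto
  define r where "r m i = real i / real (Suc m)" for m i :: nat
  have r0: "0 \<le> r m i" for m i by (simp add: r_def)
  define V where "V m w = r m (j m w)" for m w
  have V_eq: "V m w = round_up m (\<tau> w)" for m w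
    by (simp add: V_def r_def j_def round_up_def)
  have V_ge: "\<tau> w \<le> V m w" for m w unfolding V_eq by (rule round_up_ge)
  have V0: "0 \<le> V m w" for m w by (simp add: V_def r0)
  define g where "g m w = W (V m w) w" for m w
  define y where "y m w = Y (V m w) w" for m w
  have g_meas [measurable]: "g m \<in> borel_measurable P" for m
    unfolding g_def V_def
    by (rule measurable_compose_countable[where f="\<lambda>i. W (r m i)"]) (auto intro!: WP r0)
  have y_meas [measurable]: "y m \<in> borel_measurable P" for m
    unfolding y_def V_def
    by (rule measurable_compose_countable[where f="\<lambda>i. Y (r m i)"]) (auto intro!: Y r0)
  define J where "J m = nat \<lceil>c * real (Suc m)\<rceil>" for m
  have jJ: "j m w \<le> J m" if "w \<in> space P" for m w
    using \<tau>_range[OF that] unfolding j_def J_def by (intro nat_mono ceiling_mono mult_right_mono) auto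
  have bounded_times: "integrable P (\<lambda>w. a w * b w)"
    if "a \<in> borel_measurable P" "AE w in P. \<bar>a w\<bar> \<le> A" "b \<in> borel_measurable P" "AE w in P. 0 \<le> b w \<and> b w \<le> Yb w" for a b :: "'a \<Rightarrow> real" and A
  proof (rule Bochner_Integration.integrable_bound[where f="\<lambda>w. A * Yb w"])
    show "AE w in P. norm (a w * b w) \<le> norm (A * Yb w)"
      using that(2,4)
      by eventually_elim (auto simp: abs_mult intro!: mult_mono)
  qed (use that Yb in auto)
  \<comment> \<open>The factor \<phi> serves two purposes: as the indicator of a half-line it yields
    the tail estimate for \<open>g m\<close>, as the constant 1 the sampling identity for
    \<open>f\<close>.\<close>
  have disc: "integrable P (\<lambda>w. h w * \<phi> (g m w) * g m w) \<and>
      (LINT w|P. h w * \<phi> (g m w) * g m w) = (LINT w|P. h w * \<phi> (g m w) * y m w)"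
    if h: "h \<in> borel_measurable (pre_sigma \<tau>)" "AE w in P. \<bar>h w\<bar> \<le> A"
      and \<phi> [measurable]: "\<phi> \<in> borel_measurable borel" and \<phi>1: "\<And>x. \<bar>\<phi> x\<bar> \<le> 1" for h \<phi> A m
  proof -
    \<comment> \<open>On the event \<open>j m w = i\<close> the first indicator is 1; it is there to
      make the product with \<open>h\<close> measurable at time \<open>r m i\<close>.\<close>
    define H where "H i w = indicat_real {w\<in>space P. \<tau> w \<le> r m i} w * h w * indicat_real {w. j m w = i} w * \<phi> (W (r m i) w)" for i w
    have Hm: "H i \<in> borel_measurable (G (r m i))" for i
    proof -
      have [measurable]: "(\<lambda>w. indicat_real {w\<in>space P. \<tau> w \<le> r m i} w * h w) \<in> borel_measurable (G (r m i))"
        by (rule measurable_pre_sigma_restrict[OF \<tau> h(1)])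
      have [measurable]: "W (r m i) \<in> borel_measurable (G (r m i))" by (rule W[OF r0])
      have "Measurable.pred (G (r m i)) (\<lambda>w. \<tau> w \<le> r m k)" if "k \<le> i" for k
        using that by (intro stopping_time_le_const[OF \<tau>]) (simp add: r_def divide_right_mono)
      then have "Measurable.pred (G (r m i)) (\<lambda>w. \<tau> w \<le> r m i \<and> (\<forall>k\<in>{..<i}. \<not> \<tau> w \<le> r m k))"
        by (intro pred_intros_logic pred_intros_countable_bounded) auto
      moreover have "j m w = i \<longleftrightarrow> \<tau> w \<le> r m i \<and> (\<forall>k\<in>{..<i}. \<not> \<tau> w \<le> r m k)" for w
        unfolding r_def j_le[symmetric] by (auto simp: not_le intro: antisym leI)
      ultimately have [measurable]: "Measurable.pred (G (r m i)) (\<lambda>w. j m w = i)"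
        by simp
      show ?thesis unfolding H_def by measurable
    qed
    have HmP: "H i \<in> borel_measurable P" for i by (rule measurable_G[OF Hm])
    have Hb: "AE w in P. \<bar>H i w\<bar> \<le> A" for i
      using h(2)
    proof eventually_elim
      case (elim w)
      have "\<bar>H i w\<bar> \<le> 1 * \<bar>h w\<bar> * 1 * 1"
        unfolding H_def abs_mult by (intro mult_mono \<phi>1) (auto simp: indicator_def)
      with elim show ?case by simp
    qed
    have HY: "integrable P (\<lambda>w. H i w * Y (r m i) w)" for i
      by (rule bounded_times[OF HmP Hb Y[OF r0]]) (use Y_bound r0 in auto)
    have HW: "integrable P (\<lambda>w. H i w * W (r m i) w)"
      "(LINT w|P. H i w * W (r m i) w) = (LINT w|P. H i w * Y (r m i) w)" for i
    proof -
      interpret S: sigma_finite_subalgebra P "G (r m i)" by (rule sigma_finite_subalgebra_G)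
      have ae: "AE w in P. H i w * real_cond_exp P (G (r m i)) (Y (r m i)) w = H i w * W (r m i) w"
        using WY[OF r0[of m i]] by eventually_elim simp
      have [measurable]: "H i \<in> borel_measurable P" "W (r m i) \<in> borel_measurable P" using HmP WP r0 by auto
      note * = S.real_cond_exp_intg[OF HY Hm Y[OF r0]]
      show "integrable P (\<lambda>w. H i w * W (r m i) w)"
        by (rule integrable_cong_AE_imp[OF *(1)]) (use ae in auto)
      show "(LINT w|P. H i w * W (r m i) w) = (LINT w|P. H i w * Y (r m i) w)"
        using *(2) integral_cong_AE[OF _ _ ae] by simp
    qed
    have sum_eq: "(\<Sum>i\<le>J m. H i w * X (r m i) w) = h w * \<phi> (g m w) * X (V m w) w" if "w \<in> space P" for X w
    proof -
      have "(\<Sum>i\<le>J m. H i w * X (r m i) w) = (\<Sum>i\<in>{j m w}. H i w * X (r m i) w)"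
        by (rule sum.mono_neutral_right) (use jJ[OF that] in \<open>auto simp: H_def\<close>)
      also have "\<dots> = h w * \<phi> (g m w) * X (V m w) w"
        using V_ge[of w m] that by (simp add: H_def g_def V_def)
      finally show ?thesis .
    qed
    have "integrable P (\<lambda>w. \<Sum>i\<le>J m. H i w * W (r m i) w)" by (intro Bochner_Integration.integrable_sum HW)
    then have 1: "integrable P (\<lambda>w. h w * \<phi> (g m w) * g m w)"
      by (subst (asm) Bochner_Integration.integrable_cong[OF refl sum_eq]) (auto simp: g_def)
    have "(LINT w|P. h w * \<phi> (g m w) * g m w) = (LINT w|P. (\<Sum>i\<le>J m. H i w * W (r m i) w))"
      by (rule Bochner_Integration.integral_cong) (auto simp: sum_eq g_def)
    also have "\<dots> = (\<Sum>i\<le>J m. LINT w|P. H i w * Y (r m i) w)"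
      by (simp add: Bochner_Integration.integral_sum HW)
    also have "\<dots> = (LINT w|P. (\<Sum>i\<le>J m. H i w * Y (r m i) w))"
      by (simp add: Bochner_Integration.integral_sum HY)
    also have "\<dots> = (LINT w|P. h w * \<phi> (g m w) * y m w)"
      by (rule Bochner_Integration.integral_cong) (auto simp: sum_eq y_def)
    finally show ?thesis using 1 by simp
  qed
  have fP: "f \<in> borel_measurable P"
  proof (rule measurable_G)
    have "(\<lambda>w. indicat_real {w\<in>space P. \<tau> w \<le> c} w * f w) \<in> borel_measurable (G c)"
      by (rule measurable_pre_sigma_restrict[OF \<tau> f])
    then show "f \<in> borel_measurable (G c)"
      by (rule measurable_cong[THEN iffD1, rotated]) (use \<tau>_range in \<open>auto simp: space_F\<close>)
  qed
  have gi: "integrable P (g m)" for m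
  proof -
    have "integrable P (\<lambda>w. 1 * 1 * g m w)"
      by (rule conjunct1[OF disc[of "\<lambda>_. 1" 1 "\<lambda>_. 1"]]) simp_all
    then show ?thesis by simp
  qed
  have g0: "AE w in P. 0 \<le> g m w" for m using W_nonneg by eventually_elim (simp add: g_def V0)
  have y_bound: "AE w in P. 0 \<le> y m w \<and> y m w \<le> Yb w" for m
    using Y_bound by eventually_elim (simp add: y_def V0)
  have Wt: "(\<lambda>w. W (\<tau> w) w) \<in> borel_measurable P"
    by (rule measurable_at_random_time) (use \<tau>_range WP W_rc in auto)
  have g_lim: "AE w in P. (\<lambda>m. g m w) \<longlonglongrightarrow> W (\<tau> w) w"
    unfolding g_def V_eq
    by (intro AE_I2 tendsto_round_up[where f="\<lambda>s. W s w" for w] W_rc) (use \<tau>_range in auto)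
  have "(LINT w|P. g m w * indicat_real {w\<in>space P. g m w > K} w)
      \<le> (LINT w|P. Yb w * indicat_real {w\<in>space P. g m w > K} w)" for m K
  proof -
    have *: "1 * indicat_real {x. K < x} (g m w) * z = z * indicat_real {w\<in>space P. g m w > K} w" if "w \<in> space P" for w z
      using that by (simp add: indicator_def)
    have "(LINT w|P. g m w * indicat_real {w\<in>space P. g m w > K} w) = (LINT w|P. 1 * indicat_real {x. K < x} (g m w) * g m w)"
      by (rule Bochner_Integration.integral_cong) (simp_all only: *)
    also have "\<dots> = (LINT w|P. 1 * indicat_real {x. K < x} (g m w) * y m w)"
      by (rule conjunct2[OF disc[of "\<lambda>_. 1" 1 "indicat_real {x. K < x}"]])
        (simp_all add: indicator_def)
    also have "\<dots> = (LINT w|P. y m w * indicat_real {w\<in>space P. g m w > K} w)"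
      by (rule Bochner_Integration.integral_cong) (simp_all only: *)
    also have "\<dots> \<le> (LINT w|P. Yb w * indicat_real {w\<in>space P. g m w > K} w)"
    proof (rule integral_mono_AE)
      have "integrable P (\<lambda>w. indicat_real {w\<in>space P. g m w > K} w * y m w)"
        by (rule bounded_times[of _ 1]) (use y_bound in auto)
      then show "integrable P (\<lambda>w. y m w * indicat_real {w\<in>space P. g m w > K} w)"
        by (simp add: mult.commute)
      have "integrable P (\<lambda>w. indicat_real {w\<in>space P. g m w > K} w * Yb w)"
        by (rule bounded_times[of _ 1]) (use Yb Yb0 in auto)
      then show "integrable P (\<lambda>w. Yb w * indicat_real {w\<in>space P. g m w > K} w)"
        by (simp add: mult.commute)
      show "AE w in P. y m w * indicat_real {w\<in>space P. g m w > K} w \<le> Yb w * indicat_real {w\<in>space P. g m w > K} w"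
        using y_bound by eventually_elim (auto simp: indicator_def)
    qed
    finally show ?thesis .
  qed
  then have tail: "tail_dominated P Yb (g m)" for m by (simp add: tail_dominated_def)
  note lim = uniformly_dominated_limit[OF Yb Yb0 gi g0 tail g_lim Wt fP fC]
  show "integrable P (\<lambda>w. W (\<tau> w) w)" by (rule lim(1))
  have "(\<lambda>m. LINT w|P. f w * y m w) \<longlonglongrightarrow> (LINT w|P. f w * Y (\<tau> w) w)"
  proof (rule integral_dominated_convergence[where w="\<lambda>w. C * Yb w"])
    show "AE w in P. (\<lambda>m. f w * y m w) \<longlonglongrightarrow> f w * Y (\<tau> w) w"
      unfolding y_def V_eq
      by (intro AE_I2 tendsto_mult tendsto_const tendsto_round_up[where f="\<lambda>s. Y s w" for w] Y_rc)
        (use \<tau>_range in auto)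
    show "AE w in P. norm (f w * y m w) \<le> C * Yb w" for m
      using fC y_bound[of m] by eventually_elim (auto simp: abs_mult intro!: mult_mono)
    have "(\<lambda>w. Y (\<tau> w) w) \<in> borel_measurable P"
      by (rule measurable_at_random_time) (use \<tau>_range Y Y_rc in auto)
    then show "(\<lambda>w. f w * Y (\<tau> w) w) \<in> borel_measurable P" using fP by auto
    show "(\<lambda>w. f w * y m w) \<in> borel_measurable P" for m using fP by auto
  qed (use Yb in auto)
  moreover have "(LINT w|P. f w * y m w) = (LINT w|P. f w * g m w)" for m
    using conjunct2[OF disc[OF f fC, of "\<lambda>_. 1" m]] by simp
  ultimately show "(LINT w|P. f w * W (\<tau> w) w) = (LINT w|P. f w * Y (\<tau> w) w)"
    using lim(2) by (intro LIMSEQ_unique) auto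
qed

end

section \<open>Limits along grids\<close>

text \<open>The decrements are nonnegative and telescope, so \<open>w\<close> contributes its total
  drop. Asking for the bound on \<open>a i\<close> only where \<open>w\<close> moves allows
  \<open>w\<close> to be an indicator that jumps once.\<close>

lemma abs_sum_decrements_le:
  fixes a w :: "nat \<Rightarrow> real"
  assumes "\<And>i. i < n \<Longrightarrow> w (Suc i) \<le> w i" "\<And>i. i < n \<Longrightarrow> w (Suc i) \<noteq> w i \<Longrightarrow> \<bar>a i\<bar> \<le> e"
  shows "\<bar>\<Sum>i<n. a i * (w i - w (Suc i))\<bar> \<le> e * (w 0 - w n)"
proof -
  have "\<bar>\<Sum>i<n. a i * (w i - w (Suc i))\<bar> \<le> (\<Sum>i<n. \<bar>a i * (w i - w (Suc i))\<bar>)" by (rule sum_abs)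
  also have "\<dots> \<le> (\<Sum>i<n. e * (w i - w (Suc i)))"
  proof (rule sum_mono)
    fix i assume "i \<in> {..<n}"
    then show "\<bar>a i * (w i - w (Suc i))\<bar> \<le> e * (w i - w (Suc i))"
      using assms[of i] by (cases "w (Suc i) = w i") (auto simp: abs_mult intro!: mult_right_mono)
  qed
  also have "\<dots> = e * (w 0 - w n)"
    by (simp add: sum_distrib_left[symmetric] sum_lessThan_telescope')
  finally show ?thesis .
qed

text \<open>Equidistant points from \<open>s\<close> to the deterministic \<open>c\<close>, frozen
  at \<open>T\<close>. In the application \<open>T\<close> is the value of a stopping time; the
  unfrozen points are deterministic, so every grid point is a stopping time.\<close>

definition grid :: "real \<Rightarrow> real \<Rightarrow> real \<Rightarrow> nat \<Rightarrow> nat \<Rightarrow> real" where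
  "grid T s c m i = min T (s + (c - s) * real i / real (Suc m))"

lemma grid_0: "s \<le> T \<Longrightarrow> grid T s c m 0 = s"
  by (simp add: grid_def)

lemma grid_end: "T \<le> c \<Longrightarrow> grid T s c m (Suc m) = T"
  by (simp add: grid_def)

lemma grid_le: "grid T s c m i \<le> T"
  by (simp add: grid_def)

lemma grid_ge: "s \<le> T \<Longrightarrow> s \<le> c \<Longrightarrow> s \<le> grid T s c m i"
  by (simp add: grid_def)

lemma grid_mono: "s \<le> c \<Longrightarrow> i \<le> j \<Longrightarrow> grid T s c m i \<le> grid T s c m j"
  unfolding grid_def by (intro min.mono add_left_mono divide_right_mono mult_left_mono) auto

lemma grid_step:
  assumes "s \<le> c"
  shows "grid T s c m (Suc i) - grid T s c m i \<le> (c - s) / real (Suc m)"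
proof -
  have "s + (c - s) * real (Suc i) / real (Suc m) = s + (c - s) * real i / real (Suc m) + (c - s) / real (Suc m)"
    by (simp only: of_nat_Suc[of i] distrib_left add_divide_distrib mult_1_right ac_simps)
  moreover have "0 \<le> (c - s) / real (Suc m)" using assms by simp
  ultimately show ?thesis unfolding grid_def min_def by (simp split: if_splits)
qed

lemma eventually_grid_step_less:
  assumes "d > 0"
  shows "eventually (\<lambda>m. (c - s) / real (Suc m) < d) sequentially"
proof -
  have "(\<lambda>m. (c - s) * inverse (real (Suc m))) \<longlonglongrightarrow> (c - s) * 0"
    by (intro tendsto_intros LIMSEQ_inverse_real_of_nat)
  then have "eventually (\<lambda>m. (c - s) * inverse (real (Suc m)) < d) sequentially"
    using assms by (intro order_tendstoD(2)) auto
  then show ?thesis by (simp add: divide_inverse)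
qed

text \<open>With h = r / n each coefficient is, up to sign, the increment of h times
  \<open>n\<close> at the right end point. Uniform continuity of h makes it small uniformly in the
  index, and the drops of \<open>d\<close> add up to at most 1.\<close>

lemma tendsto_grid_remainder:
  fixes n r d :: "real \<Rightarrow> real"
  assumes s: "0 \<le> s" "s \<le> T" "T \<le> c"
    and cont: "continuous_on {0..T} r" "continuous_on {0..T} n"
    and n: "\<And>u. 0 \<le> u \<Longrightarrow> u \<le> T \<Longrightarrow> 0 < n u \<and> n u \<le> K"
    and d: "\<And>u v. 0 \<le> u \<Longrightarrow> u \<le> v \<Longrightarrow> d v \<le> d u" "\<And>u. 0 \<le> u \<Longrightarrow> 0 \<le> d u \<and> d u \<le> 1"
  shows "(\<lambda>m. \<Sum>i<Suc m. (r (grid T s c m i) / n (grid T s c m i) * n (grid T s c m (Suc i)) - r (grid T s c m (Suc i)))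
      * (d (grid T s c m i) - d (grid T s c m (Suc i)))) \<longlonglongrightarrow> 0"
proof (rule LIMSEQ_I)
  fix e :: real assume "e > 0"
  define h where "h u = r u / n u" for u
  have K: "0 < K" using n[of 0] s by auto
  have "continuous_on {0..T} h"
    unfolding h_def using n by (intro continuous_on_divide cont) (auto simp: less_le)
  then have "uniformly_continuous_on {0..T} h" by (rule compact_uniformly_continuous) simp
  moreover have "e / (2 * K) > 0" using \<open>e > 0\<close> K by simp
  ultimately obtain \<delta> where \<delta>: "\<delta> > 0" "\<And>u v. u \<in> {0..T} \<Longrightarrow> v \<in> {0..T} \<Longrightarrow> dist v u < \<delta> \<Longrightarrow> dist (h v) (h u) < e / (2 * K)"
    unfolding uniformly_continuous_on_def by metis
  obtain m0 where m0: "\<And>m. m \<ge> m0 \<Longrightarrow> (c - s) / real (Suc m) < \<delta>"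
    using eventually_grid_step_less[OF \<delta>(1)] unfolding eventually_sequentially by metis
  show "\<exists>m0. \<forall>m\<ge>m0. norm ((\<Sum>i<Suc m. (r (grid T s c m i) / n (grid T s c m i) * n (grid T s c m (Suc i)) - r (grid T s c m (Suc i)))
      * (d (grid T s c m i) - d (grid T s c m (Suc i)))) - 0) < e"
  proof (intro exI[of _ m0] allI impI)
    fix m assume m: "m \<ge> m0"
    let ?g = "grid T s c m"
    have g: "?g i \<in> {0..T}" for i using grid_ge[of s T c m i] grid_le[of T s c m i] s by auto
    have mono: "?g i \<le> ?g (Suc i)" for i using grid_mono[of s c i "Suc i"] s by auto
    have "\<bar>\<Sum>i<Suc m. (r (?g i) / n (?g i) * n (?g (Suc i)) - r (?g (Suc i))) * (d (?g i) - d (?g (Suc i)))\<bar> \<le> e/2 * (d (?g 0) - d (?g (Suc m)))"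
    proof (rule abs_sum_decrements_le[of _ "\<lambda>i. d (?g i)"])
      show "d (?g (Suc i)) \<le> d (?g i)" for i using d(1) mono g by auto
      fix i
      have "dist (?g (Suc i)) (?g i) < \<delta>"
        using grid_step[of s c T m i] mono[of i] m0[OF m] s by (auto simp: dist_real_def)
      from \<delta>(2)[OF g g this] have 1: "\<bar>h (?g i) - h (?g (Suc i))\<bar> \<le> e / (2 * K)"
        by (simp add: dist_real_def abs_minus_commute)
      have np: "0 < n (?g (Suc i)) \<and> n (?g (Suc i)) \<le> K" using g[of "Suc i"] n by auto
      then have "r (?g i) / n (?g i) * n (?g (Suc i)) - r (?g (Suc i)) = (h (?g i) - h (?g (Suc i))) * n (?g (Suc i))"
        by (simp add: h_def left_diff_distrib)
      then have "\<bar>r (?g i) / n (?g i) * n (?g (Suc i)) - r (?g (Suc i))\<bar> \<le> e / (2 * K) * K"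
        using np mult_mono[OF 1, of "n (?g (Suc i))" K] \<open>e > 0\<close> K by (simp only: abs_mult) simp
      then show "\<bar>r (?g i) / n (?g i) * n (?g (Suc i)) - r (?g (Suc i))\<bar> \<le> e / 2"
        using K by simp
    qed
    also have "\<dots> \<le> e / 2 * 1"
      using d(2)[of "?g 0"] d(2)[of "?g (Suc m)"] g[of 0] g[of "Suc m"] \<open>e > 0\<close> by (intro mult_left_mono) auto
    finally show "norm ((\<Sum>i<Suc m. (r (?g i) / n (?g i) * n (?g (Suc i)) - r (?g (Suc i))) * (d (?g i) - d (?g (Suc i)))) - 0) < e"
      using \<open>e > 0\<close> by simp
  qed
qed

text \<open>If s < x \<le> T, the sum picks out \<open>h\<close> at the last grid point strictly
  before \<open>x\<close>, which tends to \<open>x\<close> with the mesh. If T < x, only the last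
  term survives; if x \<le> s, everything vanishes.\<close>

lemma tendsto_grid_stopped:
  fixes h :: "real \<Rightarrow> real" and x :: ennreal
  assumes s: "0 \<le> s" "s \<le> T" "T \<le> c"
    and cont: "continuous_on {0..T} h"
  shows "(\<lambda>m. (\<Sum>i<Suc m. h (grid T s c m i) * (of_bool (ennreal (grid T s c m i) < x) - of_bool (ennreal (grid T s c m (Suc i)) < x)))
     + h T * of_bool (ennreal T < x)) \<longlonglongrightarrow> of_bool (ennreal s < x) * h (enn2real (min x (ennreal T)))"
proof (rule LIMSEQ_I)
  fix e :: real assume "e > 0"
  have "uniformly_continuous_on {0..T} h" by (rule compact_uniformly_continuous[OF cont]) simp
  moreover have "e / 2 > 0" using \<open>e > 0\<close> by simp
  ultimately obtain \<delta> where \<delta>: "\<delta> > 0" "\<And>u v. u \<in> {0..T} \<Longrightarrow> v \<in> {0..T} \<Longrightarrow> dist v u < \<delta> \<Longrightarrow> dist (h v) (h u) < e / 2"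
    unfolding uniformly_continuous_on_def by metis
  obtain m0 where m0: "\<And>m. m \<ge> m0 \<Longrightarrow> (c - s) / real (Suc m) < \<delta>"
    using eventually_grid_step_less[OF \<delta>(1)] unfolding eventually_sequentially by metis
  define y where "y = enn2real (min x (ennreal T))"
  have y: "ennreal y = min x (ennreal T)" "0 \<le> y"
    by (auto simp: y_def min_def ennreal_enn2real_if top_unique)
  have yT: "y \<in> {0..T}"
    using y s by (metis atLeastAtMost_iff ennreal_le_iff min.cobounded2 order.trans)
  show "\<exists>m0. \<forall>m\<ge>m0. norm ((\<Sum>i<Suc m. h (grid T s c m i) * (of_bool (ennreal (grid T s c m i) < x) - of_bool (ennreal (grid T s c m (Suc i)) < x)))
     + h T * of_bool (ennreal T < x) - of_bool (ennreal s < x) * h (enn2real (min x (ennreal T)))) < e"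
    unfolding y_def[symmetric]
  proof (intro exI[of _ m0] allI impI)
    fix m assume m: "m \<ge> m0"
    let ?g = "grid T s c m"
    let ?w = "\<lambda>i. of_bool (ennreal (?g i) < x) :: real"
    have g: "?g i \<in> {0..T}" for i using grid_ge[of s T c m i] grid_le[of T s c m i] s by auto
    have mono: "?g i \<le> ?g (Suc i)" for i using grid_mono[of s c i "Suc i"] s by auto
    have w_mono: "?w (Suc i) \<le> ?w i" for i
      using ennreal_leI[OF mono[of i]] by (auto simp: of_bool_def)
    \<comment> \<open>If T < x then y = T, so the last term is a value at \<open>y\<close> as well,
      and the limit can be subtracted index by index.\<close>
    have fin: "h T * of_bool (ennreal T < x) = h y * ?w (Suc m)"
      using y s by (auto simp: grid_end of_bool_def y_def)
    have start: "?w 0 = of_bool (ennreal s < x)" using s by (simp add: grid_0)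
    have "(\<Sum>i<Suc m. h (?g i) * (?w i - ?w (Suc i))) + h T * of_bool (ennreal T < x) - of_bool (ennreal s < x) * h y
       = (\<Sum>i<Suc m. h (?g i) * (?w i - ?w (Suc i))) - (\<Sum>i<Suc m. h y * (?w i - ?w (Suc i)))"
    proof -
      have "(\<Sum>i<Suc m. ?w i - ?w (Suc i)) = ?w 0 - ?w (Suc m)" by (rule sum_lessThan_telescope')
      then have "(\<Sum>i<Suc m. h y * (?w i - ?w (Suc i))) = h y * (?w 0 - ?w (Suc m))"
        by (simp only: sum_distrib_left[symmetric])
      then show ?thesis
        unfolding fin start[symmetric] by (simp only: right_diff_distrib mult.commute)
    qed
    also have "\<dots> = (\<Sum>i<Suc m. (h (?g i) - h y) * (?w i - ?w (Suc i)))"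
      by (simp only: sum_subtractf[symmetric] left_diff_distrib)
    finally have eq: "(\<Sum>i<Suc m. h (?g i) * (?w i - ?w (Suc i))) + h T * of_bool (ennreal T < x) - of_bool (ennreal s < x) * h y
       = (\<Sum>i<Suc m. (h (?g i) - h y) * (?w i - ?w (Suc i)))" .
    have "\<bar>\<Sum>i<Suc m. (h (?g i) - h y) * (?w i - ?w (Suc i))\<bar> \<le> e / 2 * (?w 0 - ?w (Suc m))"
    proof (rule abs_sum_decrements_le[of _ ?w])
      \<comment> \<open>The indicator jumps only where \<open>x\<close> falls between two
        neighbouring grid points; then x \<le> T, so y = x.\<close>
      fix i assume "?w (Suc i) \<noteq> ?w i"
      with w_mono[of i] have x: "ennreal (?g i) < x" "x \<le> ennreal (?g (Suc i))"
        by (auto simp: of_bool_def not_less split: if_splits)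
      have "x \<le> ennreal T" using x(2) g[of "Suc i"] by (meson atLeastAtMost_iff ennreal_leI order.trans)
      then have "ennreal y = x" using y by simp
      with x y(2) have "?g i < y" "y \<le> ?g (Suc i)" using g
        by (auto simp: ennreal_less_iff)
      then have "dist (?g i) y < \<delta>"
        using grid_step[of s c T m i] m0[OF m] s by (auto simp: dist_real_def)
      from \<delta>(2)[OF yT g this] show "\<bar>h (?g i) - h y\<bar> \<le> e / 2"
        by (simp add: dist_real_def)
    qed (rule w_mono)
    also have "\<dots> \<le> e / 2 * 1" using \<open>e > 0\<close> by (intro mult_left_mono) (auto simp: of_bool_def)
    finally show "norm ((\<Sum>i<Suc m. h (?g i) * (?w i - ?w (Suc i))) + h T * of_bool (ennreal T < x) - of_bool (ennreal s < x) * h y) < e"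
      unfolding eq using \<open>e > 0\<close> by simp
  qed
qed

section \<open>The processes of the market\<close>

lemma continuous_at_right_of_continuous_on:
  fixes f :: "real \<Rightarrow> real"
  assumes "continuous_on {0..} f" "0 \<le> t"
  shows "continuous (at_right t) f"
proof -
  have "continuous (at t within {0..}) f"
    using assms by (auto simp: continuous_on_eq_continuous_within)
  then show ?thesis
    by (rule continuous_within_subset) (use assms(2) in auto)
qed

lemma enn2real_min_ennreal:
  "0 \<le> t \<Longrightarrow> enn2real (min (ennreal t) S) = (if S = \<top> then t else min t (enn2real S))"
  by (cases S) (auto simp: min_def)

lemma ennreal_enn2real_min: "ennreal (enn2real (min (ennreal t) S)) = min (ennreal t) S"
  by (auto simp: min_def ennreal_enn2real_if top_unique)

text \<open>On \<tau> \<le> t the time \<tau> may be replaced by its minimum with \<open>t\<close>,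
  which is measurable at time \<open>t\<close>; the lemma on bounded random times then works inside
  \<open>G t\<close>.\<close>

lemma (in real_filtered_prob_space) measurable_pre_sigma_at:
  fixes X :: "real \<Rightarrow> 'a \<Rightarrow> real"
  assumes \<tau>: "stopping_time G \<tau>" and \<tau>_range: "\<And>w. w \<in> space P \<Longrightarrow> 0 \<le> \<tau> w"
    and X: "\<And>t. 0 \<le> t \<Longrightarrow> X t \<in> borel_measurable (G t)"
    and rc: "\<And>w t. w \<in> space P \<Longrightarrow> 0 \<le> t \<Longrightarrow> continuous (at_right t) (\<lambda>s. X s w)"
  shows "(\<lambda>w. X (\<tau> w) w) \<in> borel_measurable (pre_sigma \<tau>)"
proof (rule measurableI)
  fix S :: "real set" assume S: "S \<in> sets borel"
  show "(\<lambda>w. X (\<tau> w) w) -` S \<inter> space (pre_sigma \<tau>) \<in> sets (pre_sigma \<tau>)"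
  proof (rule sets_pre_sigmaI[OF \<tau>])
    fix t
    show "{w \<in> (\<lambda>w. X (\<tau> w) w) -` S \<inter> space (pre_sigma \<tau>). \<tau> w \<le> t} \<in> sets (G t)"
    proof (cases "0 \<le> t")
      case False
      then have "{w \<in> (\<lambda>w. X (\<tau> w) w) -` S \<inter> space (pre_sigma \<tau>). \<tau> w \<le> t} = {}"
        using \<tau>_range by (force simp: space_pre_sigma)
      then show ?thesis by (simp only: sets.empty_sets)
    next
      case True
      have min_meas: "(\<lambda>w. min (\<tau> w) t) \<in> borel_measurable (G t)"
      proof (rule borel_measurableI_le)
        fix a
        have "Measurable.pred (G t) (\<lambda>w. min (\<tau> w) t \<le> a)"
        proof (cases "a < t")
          case True
          then show ?thesis using stopping_time_le_const[OF \<tau>, of a t] by (simp add: min_le_iff_disj not_le)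
        qed (simp add: min_le_iff_disj)
        then show "{w \<in> space (G t). min (\<tau> w) t \<le> a} \<in> sets (G t)" by (simp add: pred_def)
      qed
      have [measurable]: "(\<lambda>w. X (min (\<tau> w) t) w) \<in> borel_measurable (G t)"
        by (rule measurable_at_bounded_random_time[OF min_meas, where t=t])
          (use \<tau>_range True rc in \<open>auto simp: space_F intro: measurable_G_mono[OF _ X]\<close>)
      have [measurable]: "Measurable.pred (G t) (\<lambda>w. \<tau> w \<le> t)" by (rule stopping_timeD[OF \<tau>])
      note [measurable] = S
      have "{w \<in> space (G t). X (min (\<tau> w) t) w \<in> S \<and> \<tau> w \<le> t} \<in> sets (G t)" by measurable
      also have "{w \<in> space (G t). X (min (\<tau> w) t) w \<in> S \<and> \<tau> w \<le> t} =
          {w \<in> (\<lambda>w. X (\<tau> w) w) -` S \<inter> space (pre_sigma \<tau>). \<tau> w \<le> t}"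
        by (auto simp: space_pre_sigma space_F min_def)
      finally show ?thesis .
    qed
  qed
qed simp

text \<open>The null sets of the countably many times i / (m + 1) are united; any other time is a
  limit of such times from the right.\<close>

lemma AE_nonneg_all_times:
  fixes X :: "real \<Rightarrow> 'a \<Rightarrow> real"
  assumes nonneg: "\<And>t. 0 \<le> t \<Longrightarrow> AE w in P. 0 \<le> X t w"
    and rc: "\<And>w t. w \<in> space P \<Longrightarrow> 0 \<le> t \<Longrightarrow> continuous (at_right t) (\<lambda>s. X s w)"
  shows "AE w in P. \<forall>t\<ge>0. 0 \<le> X t w"
proof -
  have "AE w in P. \<forall>m i::nat. 0 \<le> X (real i / real (Suc m)) w"
    using nonneg by (simp add: AE_all_countable)
  then show ?thesis
    using AE_space
  proof eventually_elim
    case (elim w)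
    show ?case
    proof (intro allI impI)
      fix t :: real assume t: "0 \<le> t"
      have "(\<lambda>m. X (round_up m t) w) \<longlonglongrightarrow> X t w"
        by (rule tendsto_round_up[OF rc[OF elim(2) t] t])
      then show "0 \<le> X t w"
        by (rule LIMSEQ_le_const) (use elim in \<open>auto simp: round_up_def\<close>)
    qed
  qed
qed

context natural_filtered_prob_space
begin

lemma sets_F_subset: "sets (F t) \<subseteq> sets P"
  using sets_F_mono[of t \<top>] sets_F_top by simp

lemma subalgebra_F: "subalgebra P (F t)"
  using sets_F_subset by (simp add: subalgebra_def space_F)

lemma sigma_finite_subalgebra_F: "sigma_finite_subalgebra P (F t)"
  by (intro finite_measure_subalgebra_is_sigma_finite finite_measure_subalgebra.intro
      finite_measure_subalgebra_axioms.intro subalgebra_F) unfold_locales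

end

text \<open>
  \<open>R\<close> is the density process of the local martingale measure, and \<open>lam\<close> is a localising sequence for \<open>N\<close>.
\<close>

locale enlarged_market = natural_filtered_prob_space P F
  for P :: "'a measure" and F :: "ennreal \<Rightarrow> 'a measure" +
  fixes \<sigma> :: "'a \<Rightarrow> ennreal" and Z N D R :: "real \<Rightarrow> 'a \<Rightarrow> real" and \<rho> :: "'a \<Rightarrow> real"
    and lam :: "nat \<Rightarrow> 'a \<Rightarrow> ennreal"
  assumes sigma_measurable [measurable]: "\<sigma> \<in> borel_measurable P"
    and sigma_avoids: "avoids_stopping_times P F \<sigma>"
    and azema: "is_azema_supermartingale P F \<sigma> Z"
    and Z_eq_AE: "AE w in P. \<forall>t\<ge>0. Z t w = N t w * D t w"
    and N_adapted: "adapted F N" and N_paths: "continuous_paths P N"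
    and N_nonneg_AE: "AE w in P. \<forall>t\<ge>0. N t w \<ge> 0" and N_0_AE: "AE w in P. N 0 w = 1"
    and D_adapted: "adapted F D" and D_paths: "continuous_paths P D"
    and D_antimono_AE: "AE w in P. antimono_on {0..} (\<lambda>t. D t w)"
    and flat_AE: "AE w in P. \<forall>s\<ge>0. \<forall>t\<ge>0. Z s w = 0 \<longrightarrow> Z t w = 0 \<longrightarrow> N s w = N t w \<and> D s w = D t w"
    and R_adapted: "adapted F R" and R_paths: "cadlag_paths P R"
    and R_cond: "\<And>t. t \<ge> 0 \<Longrightarrow> AE w in P. R t w = real_cond_exp P (F (ennreal t)) \<rho> w"
    and R_continuous_AE: "AE w in P. continuous_on {0..} (\<lambda>t. R t w)"
    and rho_integrable: "integrable P \<rho>" and rho_pos_AE: "AE w in P. 0 < \<rho> w"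
    and lam_stopping: "\<And>k. stopping_time F (lam k)"
    and lam_lim: "AE w in P. incseq (\<lambda>k. lam k w) \<and> (\<lambda>k. lam k w) \<longlonglongrightarrow> \<top>"
    and lam_martingale: "\<And>k. martingale P F (\<lambda>t w. stopped N (lam k) t w - N 0 w)"
begin

sublocale G: real_filtered_prob_space P "\<lambda>t. F (ennreal t)"
proof unfold_locales
  show "space (F (ennreal t)) = space P" for t by (rule space_F)
  show "sets (F (ennreal s)) \<subseteq> sets (F (ennreal t))" if "s \<le> t" for s t
    using that by (intro sets_F_mono ennreal_leI)
  show "sets (F (ennreal t)) \<subseteq> sets P" for t by (rule sets_F_subset)
qed

abbreviation G where "G \<equiv> \<lambda>t::real. F (ennreal t)"

lemma adapted_measurable:
  "adapted F X \<Longrightarrow> 0 \<le> t \<Longrightarrow> X t \<in> borel_measurable (F (ennreal t))"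
  "adapted F X \<Longrightarrow> 0 \<le> t \<Longrightarrow> X t \<in> borel_measurable P"
  by (auto simp: adapted_def intro: G.measurable_G)

lemma continuous_paths_right:
  "continuous_paths P X \<Longrightarrow> w \<in> space P \<Longrightarrow> 0 \<le> t \<Longrightarrow> continuous (at_right t) (\<lambda>s. X s w)"
  by (auto simp: continuous_paths_def intro: continuous_at_right_of_continuous_on)

lemma R_right: "w \<in> space P \<Longrightarrow> 0 \<le> t \<Longrightarrow> continuous (at_right t) (\<lambda>s. R s w)"
  using R_paths by (auto simp: cadlag_paths_def)

lemma Z_adapted: "adapted F Z" and Z_paths: "continuous_paths P Z"
  using azema by (auto simp: is_azema_supermartingale_def)

lemma Z_cond: "0 \<le> t \<Longrightarrow> AE w in P. Z t w = real_cond_exp P (F (ennreal t)) (indicat_real {w \<in> space P. \<sigma> w > ennreal t}) w"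
  using azema by (auto simp: is_azema_supermartingale_def)

lemma stopping_time_F_measurable: "stopping_time F S \<Longrightarrow> S \<in> borel_measurable P"
  by (rule measurable_stopping_time[OF _ sets_F_subset]) (simp_all add: space_F)

text \<open>The way from times in [0, \<infinity>] to the bounded real times that optional sampling
  requires.\<close>

lemma stopping_time_truncate:
  assumes S: "stopping_time F S" and c: "0 \<le> c"
  shows "stopping_time G (\<lambda>w. enn2real (min (ennreal c) (S w)))"
proof (rule stopping_timeI)
  fix t :: real
  show "Measurable.pred (G t) (\<lambda>w. enn2real (min (ennreal c) (S w)) \<le> t)"
  proof (cases "0 \<le> t")
    case True
    have [measurable]: "Measurable.pred (G t) (\<lambda>w. S w \<le> ennreal t)" by (rule stopping_timeD[OF S])
    have "enn2real (min (ennreal c) (S w)) \<le> t \<longleftrightarrow> c \<le> t \<or> S w \<le> ennreal t" for w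
      by (subst ennreal_le_iff[OF True, symmetric], subst ennreal_enn2real_min)
        (auto simp: min_le_iff_disj True)
    then show ?thesis by simp
  next
    case False
    then have "enn2real (min (ennreal c) (S w)) \<le> t \<longleftrightarrow> False" for w
      using enn2real_nonneg[of "min (ennreal c) (S w)"] by (metis order.trans)
    then show ?thesis by simp
  qed
qed

lemma sigma_neq_stopping_time:
  assumes "stopping_time F S"
  shows "AE w in P. \<sigma> w \<noteq> S w"
proof -
  note [measurable] = stopping_time_F_measurable[OF assms]
  have "measure P {w \<in> space P. \<sigma> w = S w} = 0"
    using sigma_avoids assms by (simp add: avoids_stopping_times_def)
  then show ?thesis
    by (subst (asm) prob_eq_0) auto
qed

lemma sigma_positive_finite: "AE w in P. 0 < \<sigma> w \<and> \<sigma> w < \<top>"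
  using sigma_neq_stopping_time[OF stopping_time_const, of 0] sigma_neq_stopping_time[OF stopping_time_const, of \<top>]
  by eventually_elim (auto simp: less_top zero_less_iff_neq_zero)

lemma Z_nonneg_AE: "AE w in P. \<forall>t\<ge>0. 0 \<le> Z t w"
proof (rule AE_nonneg_all_times)
  fix t :: real assume t: "0 \<le> t"
  interpret S: sigma_finite_subalgebra P "F (ennreal t)" by (rule sigma_finite_subalgebra_F)
  have "AE w in P. 0 \<le> real_cond_exp P (F (ennreal t)) (indicat_real {w \<in> space P. \<sigma> w > ennreal t}) w"
    by (rule S.real_cond_exp_pos) auto
  with Z_cond[OF t] show "AE w in P. 0 \<le> Z t w" by eventually_elim simp
qed (rule continuous_paths_right[OF Z_paths])

lemma R_nonneg_AE: "AE w in P. \<forall>t\<ge>0. 0 \<le> R t w"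
proof (rule AE_nonneg_all_times)
  fix t :: real assume t: "0 \<le> t"
  interpret S: sigma_finite_subalgebra P "F (ennreal t)" by (rule sigma_finite_subalgebra_F)
  have "AE w in P. 0 \<le> real_cond_exp P (F (ennreal t)) \<rho> w"
    by (rule S.real_cond_exp_pos) (use rho_pos_AE rho_integrable in auto)
  with R_cond[OF t] show "AE w in P. 0 \<le> R t w" by eventually_elim simp
qed (rule R_right)

lemma Z_0_AE: "AE w in P. Z 0 w = 1"
proof -
  interpret S: sigma_finite_subalgebra P "F (ennreal 0)" by (rule sigma_finite_subalgebra_F)
  have "AE w in P. real_cond_exp P (F (ennreal 0)) (indicat_real {w \<in> space P. \<sigma> w > ennreal 0}) w
      = real_cond_exp P (F (ennreal 0)) (\<lambda>_. 1) w"
  proof (rule S.real_cond_exp_cong)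
    show "AE w in P. indicat_real {w \<in> space P. \<sigma> w > ennreal 0} w = 1"
      using sigma_positive_finite AE_space by eventually_elim auto
  qed auto
  moreover have "AE w in P. real_cond_exp P (F (ennreal 0)) (\<lambda>_. 1) w = 1"
    by (rule S.real_cond_exp_F_meas) auto
  ultimately show ?thesis using Z_cond[OF order_refl] by eventually_elim simp
qed

text \<open>All almost sure path properties in one predicate, so that later pathwise arguments
  discard a single null set. That \<open>D\<close> starts at 1 and stays in [0, 1] is derived: from
  Z 0 = N 0 = 1, monotonicity and flatness on the zeros of \<open>Z\<close>.\<close>

definition regular :: "'a \<Rightarrow> bool" where
  "regular w \<longleftrightarrow> w \<in> space P \<and> (\<forall>t\<ge>0. 0 \<le> N t w) \<and> N 0 w = 1 \<and> (\<forall>t\<ge>0. Z t w = N t w * D t w) \<and>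
     D 0 w = 1 \<and> (\<forall>s\<ge>0. \<forall>t\<ge>s. D t w \<le> D s w) \<and> (\<forall>t\<ge>0. 0 \<le> D t w \<and> D t w \<le> 1) \<and>
     (\<forall>s\<ge>0. \<forall>t\<ge>0. Z s w = 0 \<longrightarrow> Z t w = 0 \<longrightarrow> N s w = N t w \<and> D s w = D t w) \<and>
     (\<forall>t\<ge>0. 0 \<le> R t w) \<and> continuous_on {0..} (\<lambda>t. R t w) \<and> 0 < \<rho> w \<and> 0 < \<sigma> w \<and> \<sigma> w < \<top> \<and>
     incseq (\<lambda>k. lam k w) \<and> (\<lambda>k. lam k w) \<longlonglongrightarrow> \<top>"

lemma AE_regular: "AE w in P. regular w"
  using AE_space N_nonneg_AE N_0_AE Z_eq_AE Z_0_AE D_antimono_AE flat_AE R_nonneg_AE R_continuous_AE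
    rho_pos_AE sigma_positive_finite lam_lim Z_nonneg_AE
proof eventually_elim
  case (elim w)
  have D0: "D 0 w = 1" using elim(3,4,5) by simp
  have anti: "D t w \<le> D s w" if "0 \<le> s" "s \<le> t" for s t
    using elim(6) that by (auto simp: monotone_on_def)
  have le1: "D t w \<le> 1" if "0 \<le> t" for t
    using anti[OF order_refl that] D0 by simp
  \<comment> \<open>If \<open>D\<close> were negative at \<open>t\<close>, it would vanish at some
    earlier \<open>s\<close>. Then \<open>Z\<close> is 0 at \<open>s\<close>, and also at
    \<open>t\<close>, where it is nonnegative and equal to N t * D t \<le> 0. Flatness on the zeros
    of \<open>Z\<close> gives D s = D t, a contradiction.\<close>
  have "0 \<le> D t w" if t: "0 \<le> t" for t
  proof (rule ccontr)
    assume neg: "\<not> 0 \<le> D t w"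
    have "continuous_on {0..t} (\<lambda>u. D u w)"
      using D_paths elim(1) by (auto simp: continuous_paths_def intro: continuous_on_subset)
    then obtain s where s: "0 \<le> s" "s \<le> t" "D s w = 0"
      using IVT2'[of "\<lambda>u. D u w" t 0 0] neg D0 t by auto
    have "N t w * D t w \<le> 0" using elim(2) neg t by (intro mult_nonneg_nonpos) auto
    moreover have "0 \<le> Z t w" "Z t w = N t w * D t w" using elim(4,13) t by auto
    ultimately have "Z t w = 0" by linarith
    moreover have "Z s w = 0" using elim(4) s by simp
    ultimately have "D s w = D t w" using elim(7) s t by metis
    with s neg show False by simp
  qed
  then have bounds: "\<forall>t\<ge>0. 0 \<le> D t w \<and> D t w \<le> 1" using le1 by simp
  have anti': "\<forall>s\<ge>0. \<forall>t\<ge>s. D t w \<le> D s w" using anti by simp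
  show ?case
    unfolding regular_def using elim(1-4) D0 anti' bounds elim(7-12)
    by (elim conjE) (intro conjI; assumption)
qed

section \<open>Optional sampling of R, Z and N\<close>

lemma optional_sampling_R:
  assumes \<tau>: "stopping_time G \<tau>" and \<tau>_range: "\<And>w. w \<in> space P \<Longrightarrow> 0 \<le> \<tau> w \<and> \<tau> w \<le> c"
    and f: "f \<in> borel_measurable (G.pre_sigma \<tau>)" and fC: "AE w in P. \<bar>f w\<bar> \<le> C"
  shows "integrable P (\<lambda>w. R (\<tau> w) w)" "(LINT w|P. f w * R (\<tau> w) w) = (LINT w|P. f w * \<rho> w)"
proof -
  note * = G.optional_sampling[OF \<tau> \<tau>_range adapted_measurable(1)[OF R_adapted] R_right R_nonneg_AE
      _ _ _ rho_integrable R_cond f fC]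
  show "integrable P (\<lambda>w. R (\<tau> w) w)" "(LINT w|P. f w * R (\<tau> w) w) = (LINT w|P. f w * \<rho> w)"
    by (rule *; use rho_integrable rho_pos_AE in \<open>auto intro: less_imp_le\<close>)+
qed

text \<open>The strict inequality matters: a point of [0, x) has room to its right inside the
  interval, and a point beyond it stays outside when moved to the right.\<close>

lemma indicator_right_continuous:
  fixes x :: ennreal
  assumes "0 \<le> t"
  shows "continuous (at_right t) (\<lambda>s. of_bool (ennreal s < x) :: real)"
  unfolding continuous_within
proof (rule tendsto_eventually)
  show "\<forall>\<^sub>F s in at_right t. (of_bool (ennreal s < x) :: real) = of_bool (ennreal t < x)"
  proof (cases "ennreal t < x")
    case True
    then obtain y where y: "ennreal t < y" "y < x" using dense by blast
    then have "y < \<top>" using less_le_trans[OF y(2) top_greatest] by simp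
    then obtain r where r: "0 \<le> r" "y = ennreal r" by (cases y) auto
    with y(1) assms have *: "t < r" by (simp add: ennreal_less_iff)
    show ?thesis
      unfolding eventually_at_right[OF *]
    proof (intro exI[of _ r] conjI allI impI *)
      fix s assume s: "t < s" "s < r"
      then have "ennreal s < y" using assms unfolding r(2) by (intro ennreal_lessI) auto
      then show "(of_bool (ennreal s < x) :: real) = of_bool (ennreal t < x)"
        using y True by auto
    qed
  next
    case False
    show ?thesis
      using eventually_at_right_less[of t]
    proof eventually_elim
      case (elim s)
      then have "ennreal t \<le> ennreal s" by (intro ennreal_leI) simp
      with False show ?case by (auto simp: not_less)
    qed
  qed
qed

lemma optional_sampling_Z:
  assumes \<tau>: "stopping_time G \<tau>" and \<tau>_range: "\<And>w. w \<in> space P \<Longrightarrow> 0 \<le> \<tau> w \<and> \<tau> w \<le> c"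
    and f: "f \<in> borel_measurable (G.pre_sigma \<tau>)" and fC: "AE w in P. \<bar>f w\<bar> \<le> C"
  shows "integrable P (\<lambda>w. Z (\<tau> w) w)"
    "(LINT w|P. f w * Z (\<tau> w) w) = (LINT w|P. f w * of_bool (ennreal (\<tau> w) < \<sigma> w))"
proof -
  let ?Y = "\<lambda>t w. of_bool (ennreal t < \<sigma> w) :: real"
  have WY: "AE w in P. Z t w = real_cond_exp P (F (ennreal t)) (?Y t) w" if t: "0 \<le> t" for t
  proof -
    interpret S: sigma_finite_subalgebra P "F (ennreal t)" by (rule sigma_finite_subalgebra_F)
    have "AE w in P. real_cond_exp P (F (ennreal t)) (indicat_real {w \<in> space P. \<sigma> w > ennreal t}) w = real_cond_exp P (F (ennreal t)) (?Y t) w"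
      by (rule S.real_cond_exp_cong) auto
    with Z_cond[OF t] show ?thesis by eventually_elim simp
  qed
  note * = G.optional_sampling[OF \<tau> \<tau>_range adapted_measurable(1)[OF Z_adapted] continuous_paths_right[OF Z_paths]
      Z_nonneg_AE _ indicator_right_continuous _ _ WY f fC, where Yb="\<lambda>_. 1"]
  show "integrable P (\<lambda>w. Z (\<tau> w) w)"
    "(LINT w|P. f w * Z (\<tau> w) w) = (LINT w|P. f w * of_bool (ennreal (\<tau> w) < \<sigma> w))"
    by (rule *; simp)+
qed

lemma stopped_N_right:
  assumes w: "w \<in> space P" and t: "0 \<le> t" and c: "0 \<le> c"
  shows "continuous (at_right t) (\<lambda>s. stopped N S (min s c) w)"
proof (rule continuous_at_right_of_continuous_on[OF _ t])
  have N: "continuous_on {0..} (\<lambda>t. N t w)" using N_paths w by (auto simp: continuous_paths_def)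
  have "continuous_on {0..} (\<lambda>s. N (if S w = \<top> then min s c else min (min s c) (enn2real (S w))) w)"
    by (cases "S w = \<top>") (use c in \<open>auto intro!: continuous_on_compose2[OF N] continuous_intros\<close>)
  then show "continuous_on {0..} (\<lambda>s. stopped N S (min s c) w)"
    by (rule continuous_on_eq) (use c in \<open>simp add: stopped_def enn2real_min_ennreal\<close>)
qed

lemma optional_sampling_N:
  assumes \<tau>: "stopping_time G \<tau>" and \<tau>_range: "\<And>w. w \<in> space P \<Longrightarrow> 0 \<le> \<tau> w \<and> \<tau> w \<le> c"
    and \<tau>_lam: "\<And>w. w \<in> space P \<Longrightarrow> ennreal (\<tau> w) \<le> lam k w" and c: "0 \<le> c"
    and f: "f \<in> borel_measurable (G.pre_sigma \<tau>)" and fC: "AE w in P. \<bar>f w\<bar> \<le> C"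
  shows "integrable P (\<lambda>w. N (\<tau> w) w)"
    "(LINT w|P. f w * N (\<tau> w) w) = (LINT w|P. f w * stopped N (lam k) c w)"
proof -
  let ?n = "\<lambda>t. stopped N (lam k) t"
  have [measurable]: "N 0 \<in> borel_measurable P" by (rule adapted_measurable(2)[OF N_adapted]) simp
  have N0: "N 0 \<in> borel_measurable (F (ennreal t))" if "0 \<le> t" for t
    by (rule G.measurable_G_mono[OF that adapted_measurable(1)[OF N_adapted]]) simp
  have N0i: "integrable P (N 0)"
    by (rule integrable_cong_AE_imp[of P "\<lambda>_. 1"]) (use N_0_AE in auto)
  have n_meas: "?n t \<in> borel_measurable (F (ennreal t))" if t: "0 \<le> t" for t
  proof -
    have "(\<lambda>w. ?n t w - N 0 w) \<in> borel_measurable (F (ennreal t))"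
      using lam_martingale[of k] t by (auto simp: martingale_def adapted_def)
    from borel_measurable_add[OF this N0[OF t]] show ?thesis by simp
  qed
  have n_int: "integrable P (?n t)" if t: "0 \<le> t" for t
  proof -
    have "integrable P (\<lambda>w. ?n t w - N 0 w)"
      using lam_martingale[of k] t by (auto simp: martingale_def)
    from Bochner_Integration.integrable_add[OF this N0i] show ?thesis by simp
  qed
  have n_nonneg: "AE w in P. \<forall>t\<ge>0. 0 \<le> ?n t w"
    using N_nonneg_AE by eventually_elim (simp add: stopped_def)
  have WY: "AE w in P. ?n (min t c) w = real_cond_exp P (F (ennreal t)) (?n c) w" if t: "0 \<le> t" for t
  proof -
    interpret S: sigma_finite_subalgebra P "F (ennreal t)" by (rule sigma_finite_subalgebra_F)
    show ?thesis
    proof (cases "t \<le> c")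
      case True
      have "AE w in P. real_cond_exp P (F (ennreal t)) (\<lambda>w. ?n c w - N 0 w) w = ?n t w - N 0 w"
        using lam_martingale[of k] t True by (auto simp: martingale_def)
      moreover have "AE w in P. real_cond_exp P (F (ennreal t)) (\<lambda>w. ?n c w - N 0 w) w =
          real_cond_exp P (F (ennreal t)) (?n c) w - real_cond_exp P (F (ennreal t)) (N 0) w"
        by (rule S.real_cond_exp_diff) (use n_int c N0i in auto)
      moreover have "AE w in P. real_cond_exp P (F (ennreal t)) (N 0) w = N 0 w"
        by (rule S.real_cond_exp_F_meas[OF N0i N0[OF t]])
      ultimately show ?thesis by eventually_elim (use True in simp)
    next
      case False
      have "AE w in P. real_cond_exp P (F (ennreal t)) (?n c) w = ?n c w"
        by (rule S.real_cond_exp_F_meas[OF n_int[OF c]]) (rule G.measurable_G_mono[OF _ n_meas[OF c]], use False in simp)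
      then show ?thesis by eventually_elim (use False in simp)
    qed
  qed
  have W_meas: "?n (min t c) \<in> borel_measurable (F (ennreal t))" if "0 \<le> t" for t
    by (rule G.measurable_G_mono[OF _ n_meas]) (use that c in auto)
  have nn: "AE w in P. \<forall>t\<ge>0. 0 \<le> ?n (min t c) w"
    using n_nonneg by eventually_elim (use c in simp)
  have nb: "AE w in P. \<forall>t\<ge>0::real. 0 \<le> ?n c w \<and> ?n c w \<le> ?n c w"
    using n_nonneg by eventually_elim (use c in simp)
  note * = G.optional_sampling[OF \<tau> \<tau>_range W_meas stopped_N_right[OF _ _ c] nn _ _ nb n_int[OF c] WY f fC]
  have eq: "?n (min (\<tau> w) c) w = N (\<tau> w) w" if "w \<in> space P" for w
    using \<tau>_range[OF that] \<tau>_lam[OF that] by (simp add: stopped_def min_absorb1)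
  have "integrable P (\<lambda>w. ?n (min (\<tau> w) c) w)"
    by (rule *(1); use n_int[OF c] in auto)
  then show "integrable P (\<lambda>w. N (\<tau> w) w)"
    by (subst (asm) Bochner_Integration.integrable_cong[OF refl eq])
  have "(LINT w|P. f w * ?n (min (\<tau> w) c) w) = (LINT w|P. f w * ?n c w)"
    by (rule *(2); use n_int[OF c] in auto)
  then show "(LINT w|P. f w * N (\<tau> w) w) = (LINT w|P. f w * stopped N (lam k) c w)"
    by (subst (asm) Bochner_Integration.integral_cong[OF refl, of _ _ "\<lambda>w. f w * N (\<tau> w) w"]) (simp_all add: eq)
qed

end

section \<open>The localised identity\<close>

lemma integrable_bounded_mult:
  fixes f g :: "'a \<Rightarrow> real"
  assumes "integrable M g" "f \<in> borel_measurable M" "AE x in M. \<bar>f x\<bar> \<le> C"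
  shows "integrable M (\<lambda>x. f x * g x)"
proof (rule Bochner_Integration.integrable_bound[where f="\<lambda>x. C * g x"])
  show "integrable M (\<lambda>x. C * g x)" using assms(1) by simp
  show "(\<lambda>x. f x * g x) \<in> borel_measurable M" using assms(1,2) by measurable
  show "AE x in M. norm (f x * g x) \<le> norm (C * g x)"
    using assms(3) by eventually_elim (auto simp: abs_mult intro!: mult_right_mono)
qed

context enlarged_market
begin

lemma regularD:
  assumes "regular w"
  shows regular_space: "w \<in> space P"
    and regular_N_nonneg: "\<And>t. 0 \<le> t \<Longrightarrow> 0 \<le> N t w"
    and regular_N_0: "N 0 w = 1"
    and regular_Z: "\<And>t. 0 \<le> t \<Longrightarrow> Z t w = N t w * D t w"
    and regular_D_0: "D 0 w = 1"
    and regular_D_antimono: "\<And>s t. 0 \<le> s \<Longrightarrow> s \<le> t \<Longrightarrow> D t w \<le> D s w"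
    and regular_D_nonneg: "\<And>t. 0 \<le> t \<Longrightarrow> 0 \<le> D t w"
    and regular_D_le_1: "\<And>t. 0 \<le> t \<Longrightarrow> D t w \<le> 1"
    and regular_flat_N: "\<And>s t. 0 \<le> s \<Longrightarrow> 0 \<le> t \<Longrightarrow> Z s w = 0 \<Longrightarrow> Z t w = 0 \<Longrightarrow> N s w = N t w"
    and regular_flat_D: "\<And>s t. 0 \<le> s \<Longrightarrow> 0 \<le> t \<Longrightarrow> Z s w = 0 \<Longrightarrow> Z t w = 0 \<Longrightarrow> D s w = D t w"
    and regular_R_nonneg: "\<And>t. 0 \<le> t \<Longrightarrow> 0 \<le> R t w"
    and regular_R_continuous: "continuous_on {0..} (\<lambda>t. R t w)"
    and regular_rho: "0 < \<rho> w"
    and regular_sigma: "0 < \<sigma> w" "\<sigma> w < \<top>"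
    and regular_lam: "incseq (\<lambda>k. lam k w)" "(\<lambda>k. lam k w) \<longlonglongrightarrow> \<top>"
proof -
  have *: "w \<in> space P" "\<forall>t\<ge>0. 0 \<le> N t w" "N 0 w = 1" "\<forall>t\<ge>0. Z t w = N t w * D t w" "D 0 w = 1"
    "\<forall>s\<ge>0. \<forall>t\<ge>s. D t w \<le> D s w" "\<forall>t\<ge>0. 0 \<le> D t w \<and> D t w \<le> 1"
    "\<forall>s\<ge>0. \<forall>t\<ge>0. Z s w = 0 \<longrightarrow> Z t w = 0 \<longrightarrow> N s w = N t w \<and> D s w = D t w"
    "\<forall>t\<ge>0. 0 \<le> R t w" "continuous_on {0..} (\<lambda>t. R t w)" "0 < \<rho> w" "0 < \<sigma> w" "\<sigma> w < \<top>"
    "incseq (\<lambda>k. lam k w)" "(\<lambda>k. lam k w) \<longlonglongrightarrow> \<top>"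
    by (insert assms[unfolded regular_def]) (elim conjE, assumption)+
  show "w \<in> space P" "N 0 w = 1" "D 0 w = 1" "continuous_on {0..} (\<lambda>t. R t w)" "0 < \<rho> w" "0 < \<sigma> w" "\<sigma> w < \<top>"
    "incseq (\<lambda>k. lam k w)" "(\<lambda>k. lam k w) \<longlonglongrightarrow> \<top>"
    by (fact *)+
  show "0 \<le> N t w" "Z t w = N t w * D t w" "0 \<le> R t w" "0 \<le> D t w" "D t w \<le> 1" if "0 \<le> t" for t
    using that *(2,4,7,9) by blast+
  show "D t w \<le> D s w" if "0 \<le> s" "s \<le> t" for s t using that *(6) by blast
  show "N s w = N t w" "D s w = D t w" if "0 \<le> s" "0 \<le> t" "Z s w = 0" "Z t w = 0" for s t
    using that *(8) by blast+
qed

text \<open>Division by zero yields 0; up to time \<sigma> this almost surely does not occur,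
  because \<sigma> < T0 almost surely.\<close>

definition H :: "real \<Rightarrow> 'a \<Rightarrow> real" where "H t w = R t w / N t w"

lemma measurable_at:
  assumes "U \<in> borel_measurable P" "\<And>w. w \<in> space P \<Longrightarrow> 0 \<le> U w"
  shows "(\<lambda>w. N (U w) w) \<in> borel_measurable P" "(\<lambda>w. R (U w) w) \<in> borel_measurable P"
    "(\<lambda>w. D (U w) w) \<in> borel_measurable P" "(\<lambda>w. H (U w) w) \<in> borel_measurable P"
proof -
  note * = measurable_at_random_time[OF assms]
  show N: "(\<lambda>w. N (U w) w) \<in> borel_measurable P"
    by (rule *) (auto intro: adapted_measurable N_adapted continuous_paths_right N_paths)
  show R: "(\<lambda>w. R (U w) w) \<in> borel_measurable P"
    by (rule *) (auto intro: adapted_measurable R_adapted R_right)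
  show "(\<lambda>w. D (U w) w) \<in> borel_measurable P"
    by (rule *) (auto intro: adapted_measurable D_adapted continuous_paths_right D_paths)
  show "(\<lambda>w. H (U w) w) \<in> borel_measurable P"
    unfolding H_def using N R by measurable
qed

lemma measurable_pre_sigma:
  assumes "stopping_time G \<tau>" "\<And>w. w \<in> space P \<Longrightarrow> 0 \<le> \<tau> w"
  shows "(\<lambda>w. N (\<tau> w) w) \<in> borel_measurable (G.pre_sigma \<tau>)" "(\<lambda>w. R (\<tau> w) w) \<in> borel_measurable (G.pre_sigma \<tau>)"
    "(\<lambda>w. D (\<tau> w) w) \<in> borel_measurable (G.pre_sigma \<tau>)"
  by (rule G.measurable_pre_sigma_at[OF assms];
      auto intro: adapted_measurable N_adapted R_adapted D_adapted continuous_paths_right N_paths D_paths R_right)+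

text \<open>Let u \<le> v be neighbouring grid points and b the indicator of \<open>B\<close>. By
  projection, E(b H u 1(u < \<sigma>)) = E(b D u \<rho>). For v, E(b H u 1(v < \<sigma>)) = E(b H u
  N v D v), and with \<open>D u\<close> in place of \<open>D v\<close> this would again be E(b D u
  \<rho>), as \<open>N\<close> is a martingale up to \<tau> and H u * N u = R u. So the difference
  is E(b H u N v (D u - D v)). On the other hand, E(b R v (D u - D v)) telescopes over the grid to
  E(b (D s - D \<tau>) \<rho>), and the last term of the approximating sum supplies E(b D \<tau>
  \<rho>).\<close>

lemma localised_identity:
  assumes \<tau>: "stopping_time G \<tau>" and \<tau>_range: "\<And>w. w \<in> space P \<Longrightarrow> 0 \<le> \<tau> w \<and> \<tau> w \<le> c"
    and \<tau>_lam: "\<And>w. w \<in> space P \<Longrightarrow> ennreal (\<tau> w) \<le> lam k w" and s: "0 \<le> s" "s \<le> c"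
    and B: "B \<in> sets (F (ennreal s))" and B\<tau>: "\<And>w. w \<in> B \<Longrightarrow> s < \<tau> w"
    and K: "1 \<le> K"
    and bounds: "AE w in P. w \<in> B \<longrightarrow> (\<forall>u. 0 \<le> u \<longrightarrow> u \<le> \<tau> w \<longrightarrow> 1 / K \<le> N u w \<and> N u w \<le> K \<and> R u w \<le> K)"
  shows "integrable P (\<lambda>w. indicat_real B w * of_bool (ennreal s < \<sigma> w) * H (enn2real (min (\<sigma> w) (ennreal (\<tau> w)))) w)" (is "integrable P ?X")
    and "(LINT w|P. indicat_real B w * of_bool (ennreal s < \<sigma> w) * H (enn2real (min (\<sigma> w) (ennreal (\<tau> w)))) w)
      = (LINT w|P. indicat_real B w * D s w * \<rho> w)"
proof -
  have BP [measurable]: "B \<in> sets P" using B sets_F_subset by auto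
  have c: "0 \<le> c" using s by simp
  define q where "q m i w = grid (\<tau> w) s c m i" for m i w
  have q_stop: "stopping_time G (q m i)" for m i
    unfolding q_def grid_def by (intro stopping_time_min \<tau> stopping_time_const)
  have q_range: "0 \<le> q m i w \<and> q m i w \<le> c" if "w \<in> space P" for m i w
    using \<tau>_range[OF that] s unfolding q_def grid_def by (auto intro: min.coboundedI1)
  have q_le: "q m i w \<le> \<tau> w" for m i w by (simp add: q_def grid_le)
  have q_lam: "ennreal (q m i w) \<le> lam k w" if "w \<in> space P" for m i w
    using ennreal_leI[OF q_le] \<tau>_lam[OF that] by (rule order_trans)
  have q_mono: "q m i w \<le> q m (Suc i) w" for m i w using s by (simp add: q_def grid_mono)
  have [measurable]: "q m i \<in> borel_measurable P" for m i by (rule G.stopping_time_measurable[OF q_stop])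
  have q_nonneg: "0 \<le> q m i w" if "w \<in> space P" for m i w using q_range[OF that] by blast
  define r where "r m i w = R (q m i w) w" for m i w
  define n where "n m i w = N (q m i w) w" for m i w
  define d where "d m i w = D (q m i w) w" for m i w
  define z where "z m i w = Z (q m i w) w" for m i w
  define S where "S m i w = (of_bool (ennreal (q m i w) < \<sigma> w) :: real)" for m i w
  define b where "b w = indicat_real B w" for w
  define f where "f m i w = b w * (r m i w / n m i w)" for m i w
  define e where "e m i w = d m i w - d m (Suc i) w" for m i w
  have [measurable]: "r m i \<in> borel_measurable P" "n m i \<in> borel_measurable P" "d m i \<in> borel_measurable P" for m i
    unfolding r_def n_def d_def by (rule measurable_at; use q_nonneg in simp)+
  have [measurable]: "S m i \<in> borel_measurable P" "b \<in> borel_measurable P" for m i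
    unfolding S_def b_def by measurable
  have [measurable]: "f m i \<in> borel_measurable P" "e m i \<in> borel_measurable P" for m i
    unfolding f_def e_def by measurable
  note pre = measurable_pre_sigma[OF q_stop q_nonneg, folded r_def n_def d_def]
  \<comment> \<open>Off \<open>B\<close> the grid may be frozen before \<open>s\<close>; on
    \<open>B\<close> it starts at \<open>s\<close>, so \<open>B\<close> is known at every grid
    point.\<close>
  have B_pre: "B \<in> sets (G.pre_sigma (q m i))" for m i
  proof (rule G.sets_pre_sigma_after[OF q_stop B])
    fix w assume "w \<in> B"
    then show "s \<le> q m i w" using less_imp_le[OF B\<tau>] s unfolding q_def by (intro grid_ge) auto
  qed
  have b_pre: "b \<in> borel_measurable (G.pre_sigma (q m i))" for m i
    unfolding b_def using B_pre by (rule borel_measurable_indicator)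
  have f_pre: "f m i \<in> borel_measurable (G.pre_sigma (q m i))" for m i
    unfolding f_def by (intro borel_measurable_times borel_measurable_divide b_pre pre)
  have pre_mono: "h \<in> borel_measurable (G.pre_sigma (q m (Suc i)))"
    if "h \<in> borel_measurable (G.pre_sigma (q m i))" for h m i
    by (rule measurable_from_subalg[OF _ that])
      (use G.mono_pre_sigma[OF q_stop[of m i] q_stop[of m "Suc i"] q_mono] in \<open>simp add: subalgebra_def G.space_pre_sigma\<close>)
  have good: "AE w in P. regular w \<and> (w \<in> B \<longrightarrow> (\<forall>u. 0 \<le> u \<longrightarrow> u \<le> \<tau> w \<longrightarrow> 0 < N u w \<and> 1 / N u w \<le> K \<and> N u w \<le> K \<and> 0 \<le> R u w \<and> R u w \<le> K))"
    using AE_regular bounds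
  proof eventually_elim
    case (elim w)
    show ?case
    proof (intro conjI impI allI elim(1))
      fix u assume u: "w \<in> B" "0 \<le> u" "u \<le> \<tau> w"
      then have *: "1 / K \<le> N u w" "N u w \<le> K" "R u w \<le> K" using elim(2) by auto
      then show "N u w \<le> K" "R u w \<le> K" by auto
      show "0 < N u w" using *(1) K by (smt (verit) divide_pos_pos)
      then show "1 / N u w \<le> K" using *(1) K by (simp add: field_simps)
      show "0 \<le> R u w" using regular_R_nonneg[OF elim(1)] u(2) by simp
    qed
  qed
  \<comment> \<open>The bound K * K on the quotient combines R \<le> K with 1 / N \<le> K.\<close>
  have pt: "AE w in P. regular w \<and> (\<forall>m i. 0 \<le> d m i w \<and> d m i w \<le> 1 \<and> 0 \<le> e m i w \<and> z m i w = n m i w * d m i w) \<and>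
     (w \<in> B \<longrightarrow> (\<forall>m i. 0 < n m i w \<and> n m i w \<le> K \<and> 0 \<le> r m i w \<and> r m i w \<le> K \<and> \<bar>r m i w / n m i w\<bar> \<le> K * K))"
    using good
  proof eventually_elim
    case (elim w)
    then have reg: "regular w" by (rule conjunct1)
  note w = regular_space[OF reg]
    have 1: "0 \<le> d m i w \<and> d m i w \<le> 1 \<and> 0 \<le> e m i w \<and> z m i w = n m i w * d m i w" for m i
      using regular_D_nonneg[OF reg] regular_D_le_1[OF reg] regular_Z[OF reg] regular_D_antimono[OF reg]
        q_nonneg[OF w] q_mono[of m i w] unfolding d_def e_def z_def n_def by simp
    have 2: "0 < n m i w \<and> n m i w \<le> K \<and> 0 \<le> r m i w \<and> r m i w \<le> K \<and> \<bar>r m i w / n m i w\<bar> \<le> K * K" if "w \<in> B" for m i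
    proof -
      have *: "0 < n m i w" "1 / n m i w \<le> K" "n m i w \<le> K" "0 \<le> r m i w" "r m i w \<le> K"
        using elim that q_nonneg[OF w] q_le unfolding n_def r_def by blast+
      have "r m i w * (1 / n m i w) \<le> K * K" using * K by (intro mult_mono) auto
      with * show ?thesis by simp
    qed
    show ?case using reg 1 2 by blast
  qed
  have fb: "AE w in P. \<bar>f m i w\<bar> \<le> K * K" for m i
    using pt
  proof eventually_elim
    case (elim w)
    show ?case
    proof (cases "w \<in> B")
      case True
      then have "\<bar>r m i w / n m i w\<bar> \<le> K * K" using elim by blast
      with True show ?thesis by (simp add: f_def b_def del: abs_divide)
    qed (use K in \<open>simp add: f_def b_def\<close>)
  qed
  have db: "AE w in P. \<bar>d m i w\<bar> \<le> 1" for m i using pt by eventually_elim auto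
  have eb: "AE w in P. \<bar>e m i w\<bar> \<le> 1" for m i
    using pt
  proof eventually_elim
    case (elim w)
    then have "0 \<le> d m (Suc i) w" "d m i w \<le> 1" "0 \<le> e m i w" by blast+
    then show ?case by (simp add: e_def)
  qed
  have bd: "AE w in P. \<bar>b w * d m i w\<bar> \<le> 1" for m i
    using db[of m i] by eventually_elim (auto simp: b_def indicator_def)
  have fd: "AE w in P. \<bar>f m i w * d m i w\<bar> \<le> K * K" for m i
    using fb[of m i] db[of m i]
  proof eventually_elim
    case (elim w)
    then have "\<bar>f m i w\<bar> * \<bar>d m i w\<bar> \<le> K * K * 1" by (intro mult_mono) auto
    then show ?case by (simp add: abs_mult)
  qed
  have OR: "integrable P (\<lambda>w. r m i w)" "(LINT w|P. h w * r m i w) = (LINT w|P. h w * \<rho> w)"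
    if f: "h \<in> borel_measurable (G.pre_sigma (q m i))" "AE w in P. \<bar>h w\<bar> \<le> C" for h C m i
    unfolding r_def by (rule optional_sampling_R[OF q_stop q_range f], assumption)+
  have ON: "integrable P (\<lambda>w. n m i w)" "(LINT w|P. h w * n m i w) = (LINT w|P. h w * stopped N (lam k) c w)"
    if f: "h \<in> borel_measurable (G.pre_sigma (q m i))" "AE w in P. \<bar>h w\<bar> \<le> C" for h C m i
    unfolding n_def by (rule optional_sampling_N[OF q_stop q_range q_lam c f]; assumption)+
  have OZ: "integrable P (\<lambda>w. z m i w)" "(LINT w|P. h w * z m i w) = (LINT w|P. h w * S m i w)"
    if f: "h \<in> borel_measurable (G.pre_sigma (q m i))" "AE w in P. \<bar>h w\<bar> \<le> C" for h C m i
    unfolding z_def S_def by (rule optional_sampling_Z[OF q_stop q_range f], assumption)+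
  have bb: "AE w in P. \<bar>b w\<bar> \<le> 1" by (simp add: b_def)
  have r_int: "integrable P (r m i)" for m i by (rule OR(1)[OF b_pre bb])
  have n_int: "integrable P (n m i)" for m i by (rule ON(1)[OF b_pre bb])
  have z_int: "integrable P (z m i)" for m i by (rule OZ(1)[OF b_pre bb])
  \<comment> \<open>The weight \<open>b w * d m i w\<close> is known at grid point i, so sampling
    \<open>R\<close> at point i or at point i + 1 gives the same mean \<open>a m i\<close>.\<close>
  define a where "a m i = (LINT w|P. b w * d m i w * \<rho> w)" for m i
  have a_r: "(LINT w|P. b w * d m i w * r m i w) = a m i" for m i
    unfolding a_def by (rule OR(2)[OF _ bd]) (intro borel_measurable_times b_pre pre)
  have a_r': "(LINT w|P. b w * d m i w * r m (Suc i) w) = a m i" for m i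
    unfolding a_def by (rule OR(2)[OF _ bd]) (intro borel_measurable_times b_pre pre pre_mono)
  have a_n: "(LINT w|P. f m i w * d m i w * n m i w) = a m i" for m i
    unfolding a_r[symmetric]
  proof (rule integral_cong_AE)
    show "AE w in P. f m i w * d m i w * n m i w = b w * d m i w * r m i w"
      using pt
    proof eventually_elim
      case (elim w)
      then have "w \<in> B \<Longrightarrow> 0 < n m i w" by blast
      then show ?case by (cases "w \<in> B") (auto simp: f_def b_def)
    qed
  qed auto
  have a_n': "(LINT w|P. f m i w * d m i w * n m (Suc i) w) = a m i" for m i
  proof -
    have "(LINT w|P. f m i w * d m i w * n m (Suc i) w) = (LINT w|P. f m i w * d m i w * stopped N (lam k) c w)"
      by (rule ON(2)[OF _ fd]) (intro borel_measurable_times f_pre pre pre_mono)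
    also have "\<dots> = (LINT w|P. f m i w * d m i w * n m i w)"
      by (rule ON(2)[OF _ fd, symmetric]) (intro borel_measurable_times f_pre pre)
    finally show ?thesis by (simp add: a_n)
  qed
  have fS: "(LINT w|P. f m i w * S m i w) = a m i" for m i
  proof -
    have "(LINT w|P. f m i w * S m i w) = (LINT w|P. f m i w * z m i w)"
      by (rule OZ(2)[OF f_pre fb, symmetric])
    also have "\<dots> = (LINT w|P. f m i w * d m i w * n m i w)"
      by (rule integral_cong_AE) (use pt z_int in auto)
    finally show ?thesis by (simp add: a_n)
  qed
  have i_fne: "integrable P (\<lambda>w. f m i w * n m (Suc i) w * e m i w)" for m i
  proof -
    have 1: "integrable P (\<lambda>w. f m i w * n m (Suc i) w)"
      by (rule integrable_bounded_mult[OF n_int _ fb]) simp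
    have "integrable P (\<lambda>w. e m i w * (f m i w * n m (Suc i) w))"
      by (rule integrable_bounded_mult[OF 1 _ eb]) simp
    then show ?thesis by (simp add: mult_ac)
  qed
  have i_fdn: "integrable P (\<lambda>w. f m i w * d m i w * n m (Suc i) w)" for m i
    by (rule integrable_bounded_mult[OF n_int _ fd]) auto
  have i_bre: "integrable P (\<lambda>w. b w * r m (Suc i) w * e m i w)" for m i
  proof -
    have 1: "integrable P (\<lambda>w. b w * r m (Suc i) w)"
      by (rule integrable_bounded_mult[OF r_int _ bb]) simp
    have "integrable P (\<lambda>w. e m i w * (b w * r m (Suc i) w))"
      by (rule integrable_bounded_mult[OF 1 _ eb]) simp
    then show ?thesis by (simp add: mult_ac)
  qed
  have i_bdr: "integrable P (\<lambda>w. b w * d m i w * r m j w)" for m i j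
    by (rule integrable_bounded_mult[OF r_int _ bd]) auto
  have i_fS: "integrable P (\<lambda>w. f m i w * S m j w)" for m i j
    by (rule integrable_bounded_mult[OF _ _ fb], rule integrable_const_bound[where B=1]) (auto simp: S_def)
  \<comment> \<open>Here \<open>D\<close> is taken at the right end point, while \<open>f\<close>
    belongs to the left one; writing the right value as \<open>d m i w - e m i w\<close> isolates
    the part that does not cancel.\<close>
  have fS': "(LINT w|P. f m i w * S m (Suc i) w) = a m i - (LINT w|P. f m i w * n m (Suc i) w * e m i w)" for m i
  proof -
    have "(LINT w|P. f m i w * S m (Suc i) w) = (LINT w|P. f m i w * z m (Suc i) w)"
      by (rule OZ(2)[OF pre_mono[OF f_pre] fb, symmetric])
    also have "\<dots> = (LINT w|P. f m i w * d m i w * n m (Suc i) w - f m i w * n m (Suc i) w * e m i w)"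
    proof (rule integral_cong_AE)
      show "AE w in P. f m i w * z m (Suc i) w = f m i w * d m i w * n m (Suc i) w - f m i w * n m (Suc i) w * e m i w"
        using pt
      proof eventually_elim
        case (elim w)
        then have "z m (Suc i) w = n m (Suc i) w * d m (Suc i) w" by blast
        then show ?case by (simp add: e_def algebra_simps)
      qed
    qed (use z_int in auto)
    also have "\<dots> = a m i - (LINT w|P. f m i w * n m (Suc i) w * e m i w)"
      by (subst Bochner_Integration.integral_diff[OF i_fdn i_fne]) (simp add: a_n')
    finally show ?thesis .
  qed
  \<comment> \<open>This telescopes over the index; subtracting it inside \<open>rem\<close> turns
    the uncancelled terms into small ones.\<close>
  have bre: "(LINT w|P. b w * r m (Suc i) w * e m i w) = a m i - a m (Suc i)" for m i
  proof -
    have "(LINT w|P. b w * r m (Suc i) w * e m i w)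
      = (LINT w|P. b w * d m i w * r m (Suc i) w - b w * d m (Suc i) w * r m (Suc i) w)"
      by (rule Bochner_Integration.integral_cong) (auto simp: e_def algebra_simps)
    also have "\<dots> = a m i - a m (Suc i)"
      by (subst Bochner_Integration.integral_diff[OF i_bdr i_bdr]) (simp add: a_r a_r')
    finally show ?thesis .
  qed
  define X where "X m w = (\<Sum>i<Suc m. f m i w * (S m i w - S m (Suc i) w)) + f m (Suc m) w * S m (Suc m) w" for m w
  define rem where "rem m w = (\<Sum>i<Suc m. (f m i w * n m (Suc i) w - b w * r m (Suc i) w) * e m i w)" for m w
  have EX: "(LINT w|P. X m w) = (LINT w|P. rem m w) + a m 0" for m
  proof -
    have "(LINT w|P. X m w) = (\<Sum>i<Suc m. (LINT w|P. f m i w * S m i w) - (LINT w|P. f m i w * S m (Suc i) w)) + (LINT w|P. f m (Suc m) w * S m (Suc m) w)"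
      unfolding X_def right_diff_distrib
      by (subst Bochner_Integration.integral_add) (auto intro!: i_fS simp del: sum.lessThan_Suc simp: Bochner_Integration.integral_sum Bochner_Integration.integral_diff i_fS)
    also have "\<dots> = (\<Sum>i<Suc m. LINT w|P. f m i w * n m (Suc i) w * e m i w) + a m (Suc m)"
      by (simp add: fS fS' del: sum.lessThan_Suc)
    finally have 1: "(LINT w|P. X m w) = (\<Sum>i<Suc m. LINT w|P. f m i w * n m (Suc i) w * e m i w) + a m (Suc m)" .
    have "(LINT w|P. rem m w) = (\<Sum>i<Suc m. (LINT w|P. f m i w * n m (Suc i) w * e m i w) - (LINT w|P. b w * r m (Suc i) w * e m i w))"
      unfolding rem_def left_diff_distrib
      by (simp del: sum.lessThan_Suc add: Bochner_Integration.integral_sum Bochner_Integration.integral_diff i_fne i_bre)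
    also have "\<dots> = (\<Sum>i<Suc m. LINT w|P. f m i w * n m (Suc i) w * e m i w) - (a m 0 - a m (Suc m))"
      unfolding bre sum_subtractf[of _ "\<lambda>i. a m i - a m (Suc i)"] sum_lessThan_telescope' ..
    finally show ?thesis using 1 by simp
  qed
  have a0: "a m 0 = (LINT w|P. indicat_real B w * D s w * \<rho> w)" for m
    unfolding a_def
  proof (rule Bochner_Integration.integral_cong[OF refl])
    fix w assume "w \<in> space P"
    show "b w * d m 0 w * \<rho> w = indicat_real B w * D s w * \<rho> w"
      by (cases "w \<in> B") (use B\<tau>[of w] in \<open>auto simp: b_def d_def q_def grid_0\<close>)
  qed
  have rem_lim: "(\<lambda>m. LINT w|P. rem m w) \<longlonglongrightarrow> (LINT w|P. 0)"
  \<comment> \<open>The coefficients are bounded by K * K for the quotient times K for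
    \<open>N\<close>, plus K for \<open>R\<close>; the drops of \<open>d\<close> add up to at most
    1.\<close>
  proof (rule integral_dominated_convergence[where w="\<lambda>_. K * K * K + K"])
    show "AE w in P. (\<lambda>m. rem m w) \<longlonglongrightarrow> 0"
      using good
    proof eventually_elim
      case (elim w)
      then have reg: "regular w" by (rule conjunct1)
  note w = regular_space[OF reg]
      show ?case
      proof (cases "w \<in> B")
        case True
        have Nc: "continuous_on {0..\<tau> w} (\<lambda>t. N t w)"
          using N_paths w by (auto simp: continuous_paths_def intro: continuous_on_subset)
        have Rc: "continuous_on {0..\<tau> w} (\<lambda>t. R t w)"
          by (rule continuous_on_subset[OF regular_R_continuous[OF reg]]) auto
        have "rem m w = (\<Sum>i<Suc m. (R (grid (\<tau> w) s c m i) w / N (grid (\<tau> w) s c m i) w * N (grid (\<tau> w) s c m (Suc i)) w - R (grid (\<tau> w) s c m (Suc i)) w)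
            * (D (grid (\<tau> w) s c m i) w - D (grid (\<tau> w) s c m (Suc i)) w))" for m
          using True unfolding rem_def f_def b_def e_def d_def r_def n_def q_def by (simp del: sum.lessThan_Suc)
        then show ?thesis
          using tendsto_grid_remainder[where T="\<tau> w" and K=K, OF s(1) _ _ Rc Nc, of c "\<lambda>t. D t w"]
            B\<tau>[OF True] \<tau>_range[OF w] elim True regular_D_nonneg[OF reg] regular_D_le_1[OF reg] regular_D_antimono[OF reg]
          by (simp del: sum.lessThan_Suc)
      next
        case False
        then show ?thesis by (simp add: rem_def f_def b_def)
      qed
    qed
    show "AE w in P. norm (rem m w) \<le> K * K * K + K" for m
      using pt
    proof eventually_elim
      case (elim w)
      have *: "\<bar>\<Sum>i<Suc m. (f m i w * n m (Suc i) w - b w * r m (Suc i) w) * (d m i w - d m (Suc i) w)\<bar> \<le> (K * K * K + K) * (d m 0 w - d m (Suc m) w)"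
      proof (rule abs_sum_decrements_le)
        have "0 \<le> e m i w" for i using elim by blast
        then show "d m (Suc i) w \<le> d m i w" for i by (simp add: e_def)
        fix i
        show "\<bar>f m i w * n m (Suc i) w - b w * r m (Suc i) w\<bar> \<le> K * K * K + K"
        proof (cases "w \<in> B")
          case True
          then have 1: "\<bar>r m i w / n m i w\<bar> \<le> K * K" "0 < n m (Suc i) w" "n m (Suc i) w \<le> K" "0 \<le> r m (Suc i) w" "r m (Suc i) w \<le> K"
            using elim by blast+
          then have "\<bar>r m i w / n m i w\<bar> * \<bar>n m (Suc i) w\<bar> \<le> K * K * K"
            using K by (intro mult_mono) auto
          then have "\<bar>r m i w / n m i w * n m (Suc i) w\<bar> \<le> K * K * K" by (simp only: abs_mult)
          moreover have "f m i w * n m (Suc i) w - b w * r m (Suc i) w = r m i w / n m i w * n m (Suc i) w - r m (Suc i) w"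
            using True by (simp add: f_def b_def)
          ultimately show ?thesis using 1(4,5) by linarith
        next
          case False
          then show ?thesis using K by (simp add: f_def b_def)
        qed
      qed
      have "0 \<le> d m (Suc m) w" "d m 0 w \<le> 1" using elim by blast+
      then have "(K * K * K + K) * (d m 0 w - d m (Suc m) w) \<le> (K * K * K + K) * 1"
        using K by (intro mult_left_mono) auto
      with * show ?case unfolding rem_def e_def by simp
    qed
  qed (auto simp: rem_def)
  have X_lim: "AE w in P. (\<lambda>m. X m w) \<longlonglongrightarrow> ?X w"
    using good
  proof eventually_elim
    case (elim w)
    then have reg: "regular w" by (rule conjunct1)
  note w = regular_space[OF reg]
    show ?case
    proof (cases "w \<in> B")
      case True
      have Nc: "continuous_on {0..\<tau> w} (\<lambda>t. N t w)"
        using N_paths w by (auto simp: continuous_paths_def intro: continuous_on_subset)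
      have Rc: "continuous_on {0..\<tau> w} (\<lambda>t. R t w)"
        by (rule continuous_on_subset[OF regular_R_continuous[OF reg]]) auto
      have "N u w \<noteq> 0" if "u \<in> {0..\<tau> w}" for u
        using elim True that by (metis atLeastAtMost_iff less_irrefl)
      then have Hc: "continuous_on {0..\<tau> w} (\<lambda>t. H t w)"
        unfolding H_def by (intro continuous_on_divide Rc Nc) auto
      have s\<tau>: "s \<le> \<tau> w" "\<tau> w \<le> c" using B\<tau>[OF True] \<tau>_range[OF w] by auto
      have "X m w = (\<Sum>i<Suc m. H (grid (\<tau> w) s c m i) w * (of_bool (ennreal (grid (\<tau> w) s c m i) < \<sigma> w) - of_bool (ennreal (grid (\<tau> w) s c m (Suc i)) < \<sigma> w)))
         + H (\<tau> w) w * of_bool (ennreal (\<tau> w) < \<sigma> w)" for m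
        using True grid_end[OF s\<tau>(2), of s m] unfolding X_def f_def b_def r_def n_def q_def S_def H_def by (simp del: sum.lessThan_Suc)
      then show ?thesis
        using tendsto_grid_stopped[OF s(1) s\<tau> Hc, of "\<sigma> w"] True by (simp del: sum.lessThan_Suc)
    next
      case False
      then show ?thesis by (simp add: X_def f_def b_def)
    qed
  qed
  have "AE w in P. \<forall>m i. \<bar>f m i w\<bar> \<le> K * K" using fb by (simp add: AE_all_countable)
  \<comment> \<open>One K * K for the sum, since the drops of \<open>S\<close> add up to at most 1,
    and another for the last term.\<close>
  then have X_bound: "AE w in P. norm (X m w) \<le> 2 * (K * K)" for m
  proof eventually_elim
    case (elim w)
    then have fK: "\<bar>f m i w\<bar> \<le> K * K" for i by blast
    have "\<bar>\<Sum>i<Suc m. f m i w * (S m i w - S m (Suc i) w)\<bar> \<le> (K * K) * (S m 0 w - S m (Suc m) w)"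
    proof (rule abs_sum_decrements_le[OF _ fK])
      show "S m (Suc i) w \<le> S m i w" for i
        using ennreal_leI[OF q_mono[of m i w]] by (auto simp: S_def)
    qed
    also have "\<dots> \<le> K * K * 1" using K by (intro mult_left_mono) (auto simp: S_def)
    finally have 1: "\<bar>\<Sum>i<Suc m. f m i w * (S m i w - S m (Suc i) w)\<bar> \<le> K * K" by simp
    have "\<bar>f m (Suc m) w * S m (Suc m) w\<bar> \<le> K * K" using fK[of "Suc m"] K by (auto simp: S_def)
    with 1 show ?case unfolding X_def by simp
  qed
  have [measurable]: "?X \<in> borel_measurable P"
  proof -
    note [measurable] = G.stopping_time_measurable[OF \<tau>]
    have [measurable]: "(\<lambda>w. H (enn2real (min (\<sigma> w) (ennreal (\<tau> w)))) w) \<in> borel_measurable P"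
      by (rule measurable_at) auto
    show ?thesis by measurable
  qed
  have X_meas: "X m \<in> borel_measurable P" for m unfolding X_def by measurable
  show "integrable P ?X"
    by (rule integrable_dominated_convergence[OF _ X_meas _ X_lim X_bound]) auto
  have "(\<lambda>m. LINT w|P. X m w) \<longlonglongrightarrow> (LINT w|P. ?X w)"
    by (rule integral_dominated_convergence[OF _ X_meas _ X_lim X_bound]) auto
  moreover have "(\<lambda>m. LINT w|P. X m w) \<longlonglongrightarrow> (LINT w|P. indicat_real B w * D s w * \<rho> w)"
    unfolding EX a0 using tendsto_add[OF rem_lim tendsto_const] by simp
  ultimately show "(LINT w|P. ?X w) = (LINT w|P. indicat_real B w * D s w * \<rho> w)"
    by (rule LIMSEQ_unique)
qed

end

section \<open>The first zero of the local martingale\<close>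

lemma eventually_at_right_rational:
  fixes u t :: real
  assumes "eventually Q (at_right u)" "u < t"
  obtains q where "q \<in> \<rat>" "u < q" "q < t" "Q q"
proof -
  obtain b where b: "b > u" "\<And>y. u < y \<Longrightarrow> y < b \<Longrightarrow> Q y"
    using assms(1) unfolding eventually_at_right_field by blast
  obtain q where "q \<in> \<rat>" "u < q" "q < min b t"
    using Rats_dense_in_real[of u "min b t"] b(1) assms(2) by auto
  then show thesis using that b by auto
qed

lemma decreasing_limit_at_top:
  fixes f :: "real \<Rightarrow> real"
  assumes "\<And>s t. 0 \<le> s \<Longrightarrow> s \<le> t \<Longrightarrow> f t \<le> f s" "\<And>t. 0 \<le> t \<Longrightarrow> l \<le> f t"
  obtains L where "(f \<longlongrightarrow> L) at_top" "\<And>t. 0 \<le> t \<Longrightarrow> L \<le> f t"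
proof -
  define L where "L = Inf (f ` {0..})"
  have bdd: "bdd_below (f ` {0..})" using assms(2) by (intro bdd_belowI2[where m=l]) auto
  have le: "L \<le> f t" if "0 \<le> t" for t unfolding L_def using bdd that by (intro cInf_lower) auto
  have "(f \<longlongrightarrow> L) at_top"
  proof (rule decreasing_tendsto)
    show "\<forall>\<^sub>F t in at_top. L \<le> f t" using eventually_ge_at_top[of 0] by eventually_elim (rule le)
    fix x assume "L < x"
    then obtain s where s: "0 \<le> s" "f s < x"
      using cInf_lessD[of "f ` {0..}" x] unfolding L_def by auto
    show "\<forall>\<^sub>F t in at_top. f t < x"
      using eventually_ge_at_top[of s] by eventually_elim (use assms(1)[of s] s in force)
  qed
  with le show thesis by (rule that[rotated])
qed

context enlarged_market
begin

text \<open>Right-continuity of the filtration: the event S \<le> t is the intersection of the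
  events S < t + 1 / n, and for any s > t all but finitely many of them belong to
  \<open>F s\<close>.\<close>

lemma stopping_time_from_strict:
  assumes "\<And>t. 0 < t \<Longrightarrow> {w \<in> space P. S w < ennreal t} \<in> sets (F (ennreal t))"
  shows "stopping_time F S"
proof (rule stopping_timeI)
  fix t :: ennreal
  show "Measurable.pred (F t) (\<lambda>w. S w \<le> t)"
  proof (cases t)
    case top
    then show ?thesis by simp
  next
    case (real r)
    have "{w \<in> space P. S w \<le> t} \<in> sets (F s)" if s: "t < s" for s
    proof -
      obtain u where u: "r < u" "ennreal u \<le> s"
      proof (cases s)
        case top
        then show ?thesis using that[of "r + 1"] by simp
      next
        case (real v)
        then show ?thesis using that[of v] s \<open>t = ennreal r\<close> \<open>0 \<le> r\<close> by (auto simp: ennreal_less_iff)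
      qed
      have lim: "(\<lambda>n. r + 1 / real (Suc n)) \<longlonglongrightarrow> r"
        by (rule LIMSEQ_from_above) auto
      have "eventually (\<lambda>n. r + 1 / real (Suc n) < u) sequentially"
        using order_tendstoD(2)[OF lim u(1)] .
      then obtain m where m: "\<And>n. n \<ge> m \<Longrightarrow> r + 1 / real (Suc n) < u"
        unfolding eventually_sequentially by blast
      have lim': "(\<lambda>n. r + 1 / real (Suc (n + m))) \<longlonglongrightarrow> r"
        using LIMSEQ_ignore_initial_segment[OF lim, of m] .
      have in_Fs: "{w \<in> space P. S w < ennreal (r + 1 / real (Suc (n + m)))} \<in> sets (F s)" for n
      proof -
        have "ennreal (r + 1 / real (Suc (n + m))) \<le> s"
          using m[of "n + m"] u(2) by (meson ennreal_leI le_add2 less_imp_le order_trans)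
        moreover have "{w \<in> space P. S w < ennreal (r + 1 / real (Suc (n + m)))} \<in> sets (F (ennreal (r + 1 / real (Suc (n + m)))))"
          by (rule assms) (use real in \<open>simp add: add_nonneg_pos\<close>)
        ultimately show ?thesis using sets_F_mono by blast
      qed
      have "S w \<le> t \<longleftrightarrow> (\<forall>n. S w < ennreal (r + 1 / real (Suc (n + m))))" for w
      proof
        assume "S w \<le> t"
        moreover have "t < ennreal (r + 1 / real (Suc (n + m)))" for n
          using real by (simp add: ennreal_less_iff)
        ultimately show "\<forall>n. S w < ennreal (r + 1 / real (Suc (n + m)))" by (blast intro: le_less_trans)
      next
        assume *: "\<forall>n. S w < ennreal (r + 1 / real (Suc (n + m)))"
        have "(\<lambda>n. ennreal (r + 1 / real (Suc (n + m)))) \<longlonglongrightarrow> t"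
          unfolding real(2) by (rule tendsto_ennrealI[OF lim'])
        then show "S w \<le> t" by (rule LIMSEQ_le_const) (use * less_imp_le in blast)
      qed
      then have "{w \<in> space P. S w \<le> t} = (\<Inter>n. {w \<in> space P. S w < ennreal (r + 1 / real (Suc (n + m)))})"
        by auto
      also have "\<dots> \<in> sets (F s)" using in_Fs by (intro sets.countable_INT) auto
      finally show ?thesis .
    qed
    moreover have "t < \<top>" using real by simp
    ultimately have "{w \<in> space P. S w \<le> t} \<in> sets (F t)"
      using right_continuous[of t] by auto
    then show ?thesis by (simp add: pred_def space_F)
  qed
qed

text \<open>The entrance time into an open set, whence the strict inequalities. Time 0 is included,
  so the value 0 signals a crossing at the start or immediately after it; \<open>Suc k\<close>
  avoids the threshold 1 / 0.\<close>

definition hit :: "nat \<Rightarrow> 'a \<Rightarrow> ennreal" where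
  "hit k w = Inf {ennreal t | t. 0 \<le> t \<and> (N t w < 1 / real (Suc k) \<or> real (Suc k) < N t w \<or> real (Suc k) < R t w)}"

lemma measurable_N_R_rat:
  assumes "0 \<le> q" "q \<le> t"
  shows "N q \<in> borel_measurable (F (ennreal t))" "R q \<in> borel_measurable (F (ennreal t))"
  by (rule G.measurable_G_mono[OF assms(2)], use assms N_adapted R_adapted adapted_measurable in blast)+

text \<open>A threshold that is strictly crossed stays crossed for a short while, so a crossing
  before \<open>t\<close> entails one at a rational time before \<open>t\<close>. Only right limits
  are used, because \<open>R\<close> is known to be continuous almost surely but not for every
  outcome.\<close>

lemma stopping_time_hit: "stopping_time F (hit k)"
proof (rule stopping_time_from_strict)
  fix t :: real assume t: "0 < t"
  let ?K = "real (Suc k)"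
  let ?E = "\<lambda>u w. N u w < 1 / ?K \<or> ?K < N u w \<or> ?K < R u w"
  have iff: "hit k w < ennreal t \<longleftrightarrow> (\<exists>q\<in>{q\<in>\<rat>. 0 \<le> q \<and> q < t}. ?E q w)" if w: "w \<in> space P" for w
  proof
    assume "hit k w < ennreal t"
    then obtain u where u: "0 \<le> u" "u < t" "?E u w"
      unfolding hit_def Inf_less_iff by (auto simp: ennreal_less_iff)
    have N: "((\<lambda>s. N s w) \<longlongrightarrow> N u w) (at_right u)" and R: "((\<lambda>s. R s w) \<longlongrightarrow> R u w) (at_right u)"
      using continuous_paths_right[OF N_paths w u(1)] R_right[OF w u(1)] by (auto simp: continuous_within)
    have "eventually (\<lambda>s. ?E s w) (at_right u)"
      using u(3)
    proof (elim disjE)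
      assume "N u w < 1 / ?K"
      from order_tendstoD(2)[OF N this] show ?thesis by eventually_elim simp
    next
      assume "?K < N u w"
      from order_tendstoD(1)[OF N this] show ?thesis by eventually_elim simp
    next
      assume "?K < R u w"
      from order_tendstoD(1)[OF R this] show ?thesis by eventually_elim simp
    qed
    from eventually_at_right_rational[OF this u(2)] obtain q where "q \<in> \<rat>" "u < q" "q < t" "?E q w" .
    with u(1) show "\<exists>q\<in>{q\<in>\<rat>. 0 \<le> q \<and> q < t}. ?E q w" by force
  next
    assume "\<exists>q\<in>{q\<in>\<rat>. 0 \<le> q \<and> q < t}. ?E q w"
    then obtain q where q: "0 \<le> q" "q < t" "?E q w" by auto
    then have "hit k w \<le> ennreal q" unfolding hit_def by (intro Inf_lower) auto
    also have "\<dots> < ennreal t" using q by (simp add: ennreal_less_iff)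
    finally show "hit k w < ennreal t" .
  qed
  have "Measurable.pred (F (ennreal t)) (\<lambda>w. \<exists>q\<in>{q\<in>\<rat>. 0 \<le> q \<and> q < t}. ?E q w)"
  proof (rule measurable_pred_countable(2))
    show "countable {q\<in>\<rat>. 0 \<le> q \<and> q < t}" by (rule countable_Collect[OF countable_rat])
    fix q assume "q \<in> {q\<in>\<rat>. 0 \<le> q \<and> q < t}"
    then have [measurable]: "N q \<in> borel_measurable (F (ennreal t))" "R q \<in> borel_measurable (F (ennreal t))"
      by (auto intro: measurable_N_R_rat)
    show "Measurable.pred (F (ennreal t)) (?E q)" by measurable
  qed
  then have "{w \<in> space P. \<exists>q\<in>{q\<in>\<rat>. 0 \<le> q \<and> q < t}. ?E q w} \<in> sets (F (ennreal t))"
    by (simp add: pred_def space_F)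
  also have "{w \<in> space P. \<exists>q\<in>{q\<in>\<rat>. 0 \<le> q \<and> q < t}. ?E q w} = {w \<in> space P. hit k w < ennreal t}"
    using iff by blast
  finally show "{w \<in> space P. hit k w < ennreal t} \<in> sets (F (ennreal t))" .
qed

abbreviation T0 :: "'a \<Rightarrow> ennreal" where "T0 \<equiv> first_zero N"

text \<open>A zero need not occur at a rational time, so it is detected by values of |N| below every
  1 / (k + 1) within one compact interval, where continuity produces a zero. The margin 1 / (n + 1)
  at both ends is due to the strict inequality before \<open>t\<close> and to
  \<open>first_zero\<close> ignoring time 0. Absolute values are taken as \<open>N\<close> is
  nonnegative only almost surely.\<close>

lemma stopping_time_T0: "stopping_time F T0"
proof (rule stopping_time_from_strict)
  fix t :: real assume t: "0 < t"
  let ?I = "\<lambda>n. {q\<in>\<rat>. 1 / real (Suc n) \<le> q \<and> q \<le> t - 1 / real (Suc n)}"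
  have iff: "T0 w < ennreal t \<longleftrightarrow> (\<exists>n. \<forall>k. \<exists>q\<in>?I n. \<bar>N q w\<bar> < 1 / real (Suc k))" if w: "w \<in> space P" for w
  proof
    assume "T0 w < ennreal t"
    then obtain u where u: "0 < u" "u < t" "N u w = 0"
      unfolding first_zero_def Inf_less_iff by (auto simp: ennreal_less_iff)
    obtain n where n: "1 / real (Suc n) < min u (t - u)"
      using reals_Archimedean[of "min u (t - u)"] u by (auto simp: inverse_eq_divide)
    have N: "((\<lambda>s. N s w) \<longlongrightarrow> N u w) (at_right u)"
      using continuous_paths_right[OF N_paths w, of u] u by (auto simp: continuous_within)
    have "\<exists>q\<in>?I n. \<bar>N q w\<bar> < 1 / real (Suc k)" for k
    proof -
      have "eventually (\<lambda>s. \<bar>N s w\<bar> < 1 / real (Suc k)) (at_right u)"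
        using tendsto_rabs[OF N] u by (intro order_tendstoD(2)) auto
      from eventually_at_right_rational[OF this, of "t - 1 / real (Suc n)"] n
      obtain q where "q \<in> \<rat>" "u < q" "q < t - 1 / real (Suc n)" "\<bar>N q w\<bar> < 1 / real (Suc k)"
        by auto
      with n show ?thesis by (intro bexI[of _ q]) auto
    qed
    then show "\<exists>n. \<forall>k. \<exists>q\<in>?I n. \<bar>N q w\<bar> < 1 / real (Suc k)" by blast
  next
    assume "\<exists>n. \<forall>k. \<exists>q\<in>?I n. \<bar>N q w\<bar> < 1 / real (Suc k)"
    then obtain n where n: "\<And>k. \<exists>q\<in>?I n. \<bar>N q w\<bar> < 1 / real (Suc k)" by blast
    let ?J = "{1 / real (Suc n)..t - 1 / real (Suc n)}"
    have ne: "?J \<noteq> {}" using n[of 0] by auto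
    have J: "?J \<subseteq> {0..}"
    proof
      fix x assume "x \<in> ?J"
      then have "1 / real (Suc n) \<le> x" by simp
      then show "x \<in> {0..}" using order_trans[of 0 "1 / real (Suc n)" x] by simp
    qed
    have "continuous_on {0..} (\<lambda>s. N s w)" using N_paths w by (simp add: continuous_paths_def)
    from continuous_on_rabs[OF continuous_on_subset[OF this J]]
    have "continuous_on ?J (\<lambda>s. \<bar>N s w\<bar>)" .
    from continuous_attains_inf[OF _ ne this] obtain u where u: "u \<in> ?J" "\<And>v. v \<in> ?J \<Longrightarrow> \<bar>N u w\<bar> \<le> \<bar>N v w\<bar>"
      by auto
    have "N u w = 0"
    proof (rule ccontr)
      assume "N u w \<noteq> 0"
      then obtain k where "1 / real (Suc k) < \<bar>N u w\<bar>"
        using reals_Archimedean[of "\<bar>N u w\<bar>"] by (auto simp: inverse_eq_divide)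
      with n[of k] u(2) show False by force
    qed
    moreover have pos: "0 < 1 / real (Suc n)" by simp
    have "1 / real (Suc n) \<le> u" "u \<le> t - 1 / real (Suc n)" using u(1) by (simp_all only: atLeastAtMost_iff)
    with pos have "0 < u" "u < t" by linarith+
    ultimately have "T0 w \<le> ennreal u" "ennreal u < ennreal t"
      unfolding first_zero_def by (auto intro!: Inf_lower simp: ennreal_less_iff)
    then show "T0 w < ennreal t" by (rule le_less_trans)
  qed
  have "Measurable.pred (F (ennreal t)) (\<lambda>w. \<exists>n. \<forall>k. \<exists>q\<in>?I n. \<bar>N q w\<bar> < 1 / real (Suc k))"
  proof (intro pred_intros_countable measurable_pred_countable(2))
    fix n k :: nat
    show "countable (?I n)" by (rule countable_Collect[OF countable_rat])
    fix q assume q: "q \<in> ?I n"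
    have "0 < 1 / real (Suc n)" by simp
    moreover have "1 / real (Suc n) \<le> q" "q \<le> t - 1 / real (Suc n)" using q by blast+
    ultimately have "0 \<le> q" "q \<le> t" by linarith+
    then have [measurable]: "N q \<in> borel_measurable (F (ennreal t))"
      by (auto intro: measurable_N_R_rat)
    show "Measurable.pred (F (ennreal t)) (\<lambda>w. \<bar>N q w\<bar> < 1 / real (Suc k))" by measurable
  qed
  then have "{w \<in> space P. \<exists>n. \<forall>k. \<exists>q\<in>?I n. \<bar>N q w\<bar> < 1 / real (Suc k)} \<in> sets (F (ennreal t))"
    by (simp add: pred_def space_F)
  also have "{w \<in> space P. \<exists>n. \<forall>k. \<exists>q\<in>?I n. \<bar>N q w\<bar> < 1 / real (Suc k)} = {w \<in> space P. T0 w < ennreal t}"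
    using iff by blast
  finally show "{w \<in> space P. T0 w < ennreal t} \<in> sets (F (ennreal t))" .
qed

text \<open>Since N 0 = 1, leaving out time 0 loses no zero, and the closed zero set contains its
  infimum.\<close>

lemma T0_cases:
  assumes reg: "regular w"
  obtains (infinite) "T0 w = \<top>" "\<And>t. 0 \<le> t \<Longrightarrow> 0 < N t w"
  | (finite) u where "0 < u" "T0 w = ennreal u" "N u w = 0" "\<And>t. 0 \<le> t \<Longrightarrow> t < u \<Longrightarrow> 0 < N t w"
proof -
  let ?S = "{t \<in> {0..}. N t w = 0}"
  note w = regular_space[OF reg]
  have pos: "0 < t" if "t \<in> ?S" for t using that regular_N_0[OF reg] by (cases "t = 0") auto
  have nn: "0 < N t w" if "0 \<le> t" "t \<notin> ?S" for t
    using that regular_N_nonneg[OF reg that(1)] by (auto simp: less_le)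
  show thesis
  proof (cases "?S = {}")
    case True
    then have "{ennreal t |t. 0 < t \<and> N t w = 0} = {}" by (auto simp: less_imp_le)
    then have "T0 w = \<top>" by (simp only: first_zero_def Inf_empty)
    then show thesis using infinite nn True by blast
  next
    case False
    have "continuous_on {0..} (\<lambda>t. N t w)" using N_paths w by (auto simp: continuous_paths_def)
    then have "closed ?S"
      using continuous_closed_preimage_constant[of "{0..}" "\<lambda>t. N t w" 0] by simp
    moreover have bdd: "bdd_below ?S" by (intro bdd_belowI[where m=0]) auto
    ultimately have Inf: "Inf ?S \<in> ?S" using False by (intro closed_contains_Inf)
    have lower: "Inf ?S \<le> t" if "t \<in> ?S" for t using that bdd by (rule cInf_lower)
    have "T0 w = ennreal (Inf ?S)"
    proof (rule antisym)
      show "T0 w \<le> ennreal (Inf ?S)"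
        unfolding first_zero_def using Inf pos[OF Inf] by (intro Inf_lower) auto
      show "ennreal (Inf ?S) \<le> T0 w"
        unfolding first_zero_def using lower by (intro Inf_greatest) (auto intro!: ennreal_leI)
    qed
    moreover have "0 < N t w" if "0 \<le> t" "t < Inf ?S" for t
      using lower[of t] that nn[of t] by force
    ultimately show thesis using finite[OF pos[OF Inf]] Inf by blast
  qed
qed

lemma pre_sigma_const: "A \<in> sets (F (ennreal t)) \<Longrightarrow> A \<in> sets (G.pre_sigma (\<lambda>_. t))"
  by (rule G.sets_pre_sigma_after[OF stopping_time_const]) auto

text \<open>\<open>Z\<close> vanishes at a finite \<open>T0\<close>, and sampling it there gives
  probability 0 to T0 < \<sigma>. Equality is excluded because \<sigma> avoids stopping times; for
  infinite \<open>T0\<close> this exclusion alone gives the claim.\<close>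

lemma sigma_less_T0: "AE w in P. \<sigma> w < T0 w"
proof -
  have "AE w in P. T0 w < ennreal (real n) \<longrightarrow> \<sigma> w \<le> T0 w" for n
  proof -
    let ?\<tau> = "\<lambda>w. enn2real (min (ennreal (real n)) (T0 w))"
    \<comment> \<open>On this event the truncated time is \<open>T0\<close> itself.\<close>
    let ?f = "\<lambda>w. of_bool (?\<tau> w < real n) :: real"
    have \<tau>: "stopping_time G ?\<tau>" by (rule stopping_time_truncate[OF stopping_time_T0]) simp
    have range: "0 \<le> ?\<tau> w \<and> ?\<tau> w \<le> real n" for w
      by (simp add: enn2real_min_ennreal)
    have [measurable]: "?\<tau> \<in> borel_measurable (G.pre_sigma ?\<tau>)"
      by (rule G.measurable_stopping_time_pre_sigma[OF \<tau>])
    have f: "?f \<in> borel_measurable (G.pre_sigma ?\<tau>)" by measurable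
    have [measurable]: "?\<tau> \<in> borel_measurable P" by (rule G.stopping_time_measurable[OF \<tau>])
    have less: "?\<tau> w < real n \<longleftrightarrow> T0 w < ennreal (real n)" for w
      by (subst ennreal_less_iff[symmetric], simp, subst ennreal_enn2real_min) (auto simp: min_less_iff_disj)
    have "(LINT w|P. ?f w * of_bool (ennreal (?\<tau> w) < \<sigma> w)) = (LINT w|P. ?f w * Z (?\<tau> w) w)"
      by (rule optional_sampling_Z(2)[OF \<tau> range f, symmetric, where C=1]) simp
    also have "\<dots> = (LINT w|P. 0)"
    proof (rule integral_cong_AE)
      show "AE w in P. ?f w * Z (?\<tau> w) w = 0"
        using AE_regular
      proof eventually_elim
        case (elim w)
        from elim show ?case
        proof (cases rule: T0_cases)
          case infinite
          then show ?thesis by simp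
        next
          case (finite u)
          show ?thesis
          proof (cases "u < real n")
            case True
            then have "?\<tau> w = u" using finite by (simp add: enn2real_min_ennreal)
            then show ?thesis using regular_Z[OF elim, of u] finite by simp
          next
            case False
            then show ?thesis using finite less[of w] by (simp add: ennreal_less_iff)
          qed
        qed
      qed
      have "(\<lambda>w. Z (?\<tau> w) w) \<in> borel_measurable P"
        by (rule measurable_at_random_time) (auto intro: adapted_measurable Z_adapted continuous_paths_right Z_paths)
      then show "(\<lambda>w. ?f w * Z (?\<tau> w) w) \<in> borel_measurable P" by measurable
    qed simp
    finally have "(LINT w|P. ?f w * of_bool (ennreal (?\<tau> w) < \<sigma> w)) = 0" by simp
    moreover have "integrable P (\<lambda>w. ?f w * of_bool (ennreal (?\<tau> w) < \<sigma> w))"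
      by (rule integrable_const_bound[where B=1]) auto
    ultimately have "AE w in P. ?f w * of_bool (ennreal (?\<tau> w) < \<sigma> w) = 0"
      by (subst (asm) integral_nonneg_eq_0_iff_AE) auto
    then show ?thesis
    proof eventually_elim
      case (elim w)
      show ?case
      proof
        assume *: "T0 w < ennreal (real n)"
        then have "ennreal (?\<tau> w) = T0 w" by (simp only: ennreal_enn2real_min) (simp add: min_absorb2)
        with elim less[of w] * show "\<sigma> w \<le> T0 w" by (auto simp: not_less)
      qed
    qed
  qed
  then have "AE w in P. \<forall>n. T0 w < ennreal (real n) \<longrightarrow> \<sigma> w \<le> T0 w"
    by (subst AE_all_countable) blast
  then show ?thesis
    using sigma_neq_stopping_time[OF stopping_time_T0] sigma_positive_finite
  proof eventually_elim
    case (elim w)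
    have "\<sigma> w \<le> T0 w"
    proof (cases "T0 w")
      case (real r)
      obtain n where "r < real n" using reals_Archimedean2 by blast
      then have "T0 w < ennreal (real n)" using real by (simp add: ennreal_less_iff)
      with elim show ?thesis by blast
    qed simp
    with elim show ?case by simp
  qed
qed

text \<open>Because \<sigma> < T0, the mean of \<open>Z t\<close> over T0 \<le> t, which is the
  probability of t < \<sigma> on that event, is 0. For all times at once, the negated product, a
  right-continuous process, is shown to be nonnegative at fixed times.\<close>

lemma Z_after_T0: "AE w in P. \<forall>t\<ge>0. T0 w \<le> ennreal t \<longrightarrow> Z t w = 0"
proof -
  let ?f = "\<lambda>t w. 1 - of_bool (ennreal t < T0 w) :: real"
  have "AE w in P. \<forall>t\<ge>0. 0 \<le> - (?f t w * Z t w)"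
  proof (rule AE_nonneg_all_times)
    fix t :: real assume t: "0 \<le> t"
    have Zm [measurable]: "Z t \<in> borel_measurable P" by (rule adapted_measurable(2)[OF Z_adapted t])
    have A: "{w \<in> space P. T0 w \<le> ennreal t} \<in> sets (F (ennreal t))"
      using stopping_timeD[OF stopping_time_T0, of "ennreal t"] by (simp add: pred_def space_F)
    have [measurable]: "T0 \<in> borel_measurable P" by (rule stopping_time_F_measurable[OF stopping_time_T0])
    have f: "indicat_real {w \<in> space P. T0 w \<le> ennreal t} \<in> borel_measurable (G.pre_sigma (\<lambda>_. t))"
      by (rule borel_measurable_indicator[OF pre_sigma_const[OF A]])
    have OZ: "integrable P (Z t)" "(LINT w|P. indicat_real {w \<in> space P. T0 w \<le> ennreal t} w * Z t w)
       = (LINT w|P. indicat_real {w \<in> space P. T0 w \<le> ennreal t} w * of_bool (ennreal t < \<sigma> w))"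
      using optional_sampling_Z[OF stopping_time_const _ f, of t 1] t by auto
    have "(LINT w|P. indicat_real {w \<in> space P. T0 w \<le> ennreal t} w * of_bool (ennreal t < \<sigma> w)) = (LINT w|P. 0)"
      by (rule integral_cong_AE) (use sigma_less_T0 in \<open>auto simp: indicator_def\<close>)
    with OZ(2) have "(LINT w|P. indicat_real {w \<in> space P. T0 w \<le> ennreal t} w * Z t w) = 0" by simp
    moreover have "integrable P (\<lambda>w. indicat_real {w \<in> space P. T0 w \<le> ennreal t} w * Z t w)"
      by (rule integrable_bounded_mult[OF OZ(1), where C=1]) auto
    moreover have "AE w in P. 0 \<le> indicat_real {w \<in> space P. T0 w \<le> ennreal t} w * Z t w"
      using Z_nonneg_AE by eventually_elim (use t in simp)
    ultimately have "AE w in P. indicat_real {w \<in> space P. T0 w \<le> ennreal t} w * Z t w = 0"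
      by (subst (asm) integral_nonneg_eq_0_iff_AE) auto
    then show "AE w in P. 0 \<le> - (?f t w * Z t w)"
      using AE_space by eventually_elim (auto simp: indicator_def split: if_splits)
  next
    fix w and t :: real assume w: "w \<in> space P" and t: "0 \<le> t"
    show "continuous (at_right t) (\<lambda>s. - (?f s w * Z s w))"
      by (intro continuous_intros indicator_right_continuous continuous_paths_right[OF Z_paths] w t)
  qed
  then show ?thesis
    using Z_nonneg_AE
  proof eventually_elim
    case (elim w)
    show ?case
    proof (intro allI impI)
      fix t :: real assume t: "0 \<le> t" "T0 w \<le> ennreal t"
      with elim(1) have "Z t w \<le> 0" by (auto simp: not_less[symmetric])
      with elim(2) t(1) show "Z t w = 0" by force
    qed
  qed
qed

end

section \<open>The localising times and the limit of D\<close>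

context enlarged_market
begin

definition good :: "'a \<Rightarrow> bool" where
  "good w \<longleftrightarrow> regular w \<and> \<sigma> w < T0 w \<and> (\<forall>t\<ge>0. T0 w \<le> ennreal t \<longrightarrow> Z t w = 0)"

lemma AE_good: "AE w in P. good w"
  using AE_regular sigma_less_T0 Z_after_T0 by eventually_elim (simp add: good_def)

lemma goodD:
  assumes "good w"
  shows good_regular: "regular w" and good_sigma: "\<sigma> w < T0 w"
    and good_Z: "\<And>t. 0 \<le> t \<Longrightarrow> T0 w \<le> ennreal t \<Longrightarrow> Z t w = 0"
  using assms by (simp_all add: good_def)

text \<open>
  Up to \<open>kappa k\<close> the process \<open>N\<close> is a martingale and \<open>N\<close>, \<open>1 / N\<close> and \<open>R\<close> are bounded by \<open>k + 1\<close>. These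
  times increase to the first zero of \<open>N\<close>, which they do not reach.
\<close>

definition kappa :: "nat \<Rightarrow> 'a \<Rightarrow> real" where
  "kappa k w = enn2real (min (ennreal (real k)) (min (lam k w) (hit k w)))"

lemma ennreal_kappa: "ennreal (kappa k w) = min (ennreal (real k)) (min (lam k w) (hit k w))"
  unfolding kappa_def by (rule ennreal_enn2real_min)

lemma kappa_range: "0 \<le> kappa k w" "kappa k w \<le> real k"
  by (simp_all add: kappa_def enn2real_min_ennreal)

lemma stopping_time_kappa: "stopping_time G (kappa k)"
  unfolding kappa_def
  by (rule stopping_time_truncate[OF stopping_time_min[OF lam_stopping stopping_time_hit]]) simp

lemma incseq_kappa:
  assumes "regular w"
  shows "incseq (\<lambda>k. kappa k w)"
proof (rule incseq_SucI)
  fix k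
  have "hit k w \<le> hit (Suc k) w"
    unfolding hit_def
  proof (rule Inf_superset_mono, safe)
    fix t :: real assume t: "0 \<le> t"
    have *: "1 / real (Suc (Suc k)) \<le> 1 / real (Suc k)" by (simp add: frac_le)
    show "\<exists>t'. ennreal t = ennreal t' \<and> 0 \<le> t' \<and> (N t' w < 1 / real (Suc k) \<or> real (Suc k) < N t' w \<or> real (Suc k) < R t' w)"
      if "N t w < 1 / real (Suc (Suc k))"
      using t less_le_trans[OF that *] by blast
    show "\<exists>t'. ennreal t = ennreal t' \<and> 0 \<le> t' \<and> (N t' w < 1 / real (Suc k) \<or> real (Suc k) < N t' w \<or> real (Suc k) < R t' w)"
      if "real (Suc (Suc k)) < N t w"
      using t that by (intro exI[of _ t]) auto
    show "\<exists>t'. ennreal t = ennreal t' \<and> 0 \<le> t' \<and> (N t' w < 1 / real (Suc k) \<or> real (Suc k) < N t' w \<or> real (Suc k) < R t' w)"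
      if "real (Suc (Suc k)) < R t w"
      using t that by (intro exI[of _ t]) auto
  qed
  moreover have "lam k w \<le> lam (Suc k) w" using regular_lam(1)[OF assms] by (rule incseq_SucD)
  ultimately show "kappa k w \<le> kappa (Suc k) w"
    unfolding kappa_def by (intro enn2real_mono min.mono ennreal_leI) (auto simp: min_less_iff_disj)
qed

lemma tendsto_before:
  fixes f :: "real \<Rightarrow> real"
  assumes "continuous_on {0..} f" "0 < x"
  shows "(\<lambda>n. f (x * (1 - 1 / real (Suc (Suc n))))) \<longlonglongrightarrow> f x"
    and "0 \<le> x * (1 - 1 / real (Suc (Suc n)))" "x * (1 - 1 / real (Suc (Suc n))) < x"
proof -
  show nonneg: "0 \<le> x * (1 - 1 / real (Suc (Suc n)))" for n using assms(2) by simp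
  show "x * (1 - 1 / real (Suc (Suc n))) < x" using assms(2) by (simp add: algebra_simps)
  have "(\<lambda>n. x * (1 - 1 / real (Suc (Suc n)))) \<longlonglongrightarrow> x * (1 - 0)"
    using LIMSEQ_Suc[OF LIMSEQ_inverse_real_of_nat] by (intro tendsto_intros) (simp add: inverse_eq_divide)
  then show "(\<lambda>n. f (x * (1 - 1 / real (Suc (Suc n))))) \<longlonglongrightarrow> f x"
    by (intro continuous_on_tendsto_compose[OF assms(1)]) (use assms(2) nonneg in auto)
qed

lemma N_continuous: "w \<in> space P \<Longrightarrow> continuous_on {0..} (\<lambda>t. N t w)"
  using N_paths by (simp add: continuous_paths_def)

text \<open>Strictly before the hitting time the thresholds are respected by definition; at
  \<open>x\<close> itself the weak inequalities follow by continuity from the left. The assumption 0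
  < x provides the room to the left and excludes a crossing at the start.\<close>

lemma bounds_before_hit:
  assumes reg: "regular w" and x: "0 < x" "ennreal x \<le> hit k w" and u: "0 \<le> u" "u \<le> x"
  shows "1 / real (Suc k) \<le> N u w \<and> N u w \<le> real (Suc k) \<and> R u w \<le> real (Suc k)"
proof -
  have *: "1 / real (Suc k) \<le> N v w \<and> N v w \<le> real (Suc k) \<and> R v w \<le> real (Suc k)" if v: "0 \<le> v" "v < x" for v
  proof (rule ccontr)
    assume "\<not> ?thesis"
    then have "hit k w \<le> ennreal v" unfolding hit_def using v by (intro Inf_lower) auto
    also have "\<dots> < ennreal x" using v by (simp add: ennreal_less_iff)
    finally show False using x(2) by simp
  qed
  show ?thesis
  proof (cases "u < x")
    case False
    then have u: "u = x" using u by simp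
    note N = tendsto_before[OF N_continuous[OF regular_space[OF reg]] x(1)]
    note R = tendsto_before(1)[OF regular_R_continuous[OF reg] x(1)]
    show ?thesis
      unfolding u using LIMSEQ_le_const[OF N(1), of "1 / real (Suc k)"] LIMSEQ_le_const2[OF N(1), of "real (Suc k)"]
        LIMSEQ_le_const2[OF R, of "real (Suc k)"] *[OF N(2,3)] by blast
  qed (rule *[OF u(1)])
qed

text \<open>By continuity \<open>N\<close> falls below 1 / (k + 1) strictly before its first zero,
  so \<open>hit k\<close> is smaller than that zero.\<close>

lemma kappa_less_T0:
  assumes reg: "regular w"
  shows "ennreal (kappa k w) < T0 w"
  using reg
proof (cases rule: T0_cases)
  case infinite
  then show ?thesis by simp
next
  case (finite u)
  note N = tendsto_before[OF N_continuous[OF regular_space[OF reg]] finite(1)]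
  have "eventually (\<lambda>n. N (u * (1 - 1 / real (Suc (Suc n)))) w < 1 / real (Suc k)) sequentially"
    using finite(3) by (intro order_tendstoD(2)[OF N(1)]) simp
  then obtain n where n: "N (u * (1 - 1 / real (Suc (Suc n)))) w < 1 / real (Suc k)"
    using eventually_happens'[OF sequentially_bot] by blast
  have "ennreal (kappa k w) \<le> hit k w" by (simp add: ennreal_kappa min_le_iff_disj)
  also have "\<dots> \<le> ennreal (u * (1 - 1 / real (Suc (Suc n))))"
    unfolding hit_def using n N(2)[of n] by (intro Inf_lower) blast
  also have "\<dots> < ennreal u" using N(2,3)[of n] by (intro ennreal_lessI) auto
  finally show ?thesis using finite by simp
qed

text \<open>On a compact interval [0, t'] with t < t' < T0, \<open>N\<close> has a positive minimum
  and \<open>N\<close> and \<open>R\<close> are bounded, so for large \<open>k\<close> no threshold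
  is crossed up to t'.\<close>

lemma eventually_less_kappa:
  assumes reg: "regular w" and t: "0 \<le> t" "ennreal t < T0 w"
  shows "eventually (\<lambda>k. t < kappa k w) sequentially"
proof -
  obtain t' where t': "t < t'" "\<And>u. 0 \<le> u \<Longrightarrow> u \<le> t' \<Longrightarrow> 0 < N u w"
    using reg
  proof (cases rule: T0_cases)
    case infinite
    then show ?thesis using that[of "t + 1"] by auto
  next
    case (finite u)
    then have "t < u" using t by (simp add: ennreal_less_iff)
    then show ?thesis using that[of "(t + u) / 2"] finite(4) by auto
  qed
  have ne: "{0..t'} \<noteq> {}" and sub: "{0..t'} \<subseteq> {0..}" using t t' by auto
  note Nc = continuous_on_subset[OF N_continuous[OF regular_space[OF reg]] sub]
  note Rc = continuous_on_subset[OF regular_R_continuous[OF reg] sub]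
  obtain a where a: "a \<in> {0..t'}" "\<And>u. u \<in> {0..t'} \<Longrightarrow> N a w \<le> N u w"
    using continuous_attains_inf[OF _ ne Nc] by blast
  obtain b where b: "\<And>u. u \<in> {0..t'} \<Longrightarrow> N u w \<le> N b w"
    using continuous_attains_sup[OF _ ne Nc] by blast
  obtain c where c: "\<And>u. u \<in> {0..t'} \<Longrightarrow> R u w \<le> R c w"
    using continuous_attains_sup[OF _ ne Rc] by blast
  have "0 < N a w" using t'(2) a(1) by auto
  then obtain n where n: "1 / real (Suc n) < N a w"
    using reals_Archimedean[of "N a w"] by (auto simp: inverse_eq_divide)
  obtain m :: nat where m: "max t (max (N b w) (R c w)) < real m" using reals_Archimedean2 by blast
  have "eventually (\<lambda>k. ennreal t < lam k w) sequentially"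
    by (rule order_tendstoD(1)[OF regular_lam(2)[OF reg]]) simp
  then show ?thesis
    using eventually_ge_at_top[of "max n m"]
  proof eventually_elim
    case (elim k)
    have "1 / real (Suc k) \<le> 1 / real (Suc n)" using elim by (simp add: frac_le)
    with n have k1: "1 / real (Suc k) < N a w" by linarith
    have "real m \<le> real k" using elim by simp
    with m have k2: "t < real k" "N b w < real (Suc k)" "R c w < real (Suc k)" by auto
    have "ennreal t' \<le> hit k w"
      unfolding hit_def
    proof (rule Inf_greatest, safe)
      fix u :: real assume u: "0 \<le> u"
      have "t' < u" if "N u w < 1 / real (Suc k) \<or> real (Suc k) < N u w \<or> real (Suc k) < R u w"
      proof (rule ccontr)
        assume "\<not> t' < u"
        then have "u \<in> {0..t'}" using u by auto
        from a(2)[OF this] b[OF this] c[OF this] k1 k2 that show False by linarith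
      qed
      then show "N u w < 1 / real (Suc k) \<Longrightarrow> ennreal t' \<le> ennreal u"
        "real (Suc k) < N u w \<Longrightarrow> ennreal t' \<le> ennreal u" "real (Suc k) < R u w \<Longrightarrow> ennreal t' \<le> ennreal u"
        by (auto intro!: ennreal_leI)
    qed
    then have "ennreal t < hit k w" using t' t by (meson ennreal_less_iff less_le_trans)
    moreover have "ennreal t < ennreal (real k)" using k2(1) t by (simp add: ennreal_less_iff del: ennreal_of_nat_eq_real_of_nat)
    ultimately have "ennreal t < ennreal (kappa k w)" using elim(1) unfolding ennreal_kappa by simp
    then show "t < kappa k w" using t by (simp add: ennreal_less_iff)
  qed
qed

abbreviation Dinf :: "'a \<Rightarrow> real" where "Dinf \<equiv> limit_at_infinity D"

lemma Dinf_limit: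
  assumes "regular w"
  shows "((\<lambda>t. D t w) \<longlongrightarrow> Dinf w) at_top" "0 \<le> Dinf w" "\<And>t. 0 \<le> t \<Longrightarrow> Dinf w \<le> D t w"
proof -
  obtain L where L: "((\<lambda>t. D t w) \<longlongrightarrow> L) at_top" "\<And>t. 0 \<le> t \<Longrightarrow> L \<le> D t w"
    using decreasing_limit_at_top[of "\<lambda>t. D t w" 0] regular_D_antimono[OF assms] regular_D_nonneg[OF assms] by metis
  have eq: "Dinf w = L"
    unfolding limit_at_infinity_def by (rule tendsto_Lim[OF _ L(1)]) simp
  with L show "((\<lambda>t. D t w) \<longlongrightarrow> Dinf w) at_top" "\<And>t. 0 \<le> t \<Longrightarrow> Dinf w \<le> D t w" by simp_all
  show "0 \<le> Dinf w" unfolding eq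
    by (rule tendsto_lowerbound[OF L(1)])
      (auto intro!: eventually_mono[OF eventually_ge_at_top[of 0]] regular_D_nonneg[OF assms])
qed

text \<open>From \<open>T0\<close> on \<open>Z\<close> is 0, and flatness on the zeros of
  \<open>Z\<close> freezes both factors.\<close>

lemma D_after_T0:
  assumes good: "good w" and t: "0 \<le> t" "T0 w \<le> ennreal t"
  shows "D t w = Dinf w" "N t w = 0"
proof -
  note reg = good_regular[OF good]
  have Zt: "Z t w = 0" by (rule good_Z[OF good t])
  have "eventually (\<lambda>s. D s w = D t w) at_top"
    using eventually_ge_at_top[of t]
  proof eventually_elim
    case (elim s)
    then have s: "0 \<le> s" using t(1) by simp
    have "Z s w = 0" by (rule good_Z[OF good s order_trans[OF t(2) ennreal_leI[OF elim]]])
    then show ?case by (rule regular_flat_D[OF reg s t(1) _ Zt])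
  qed
  then have "((\<lambda>s. D s w) \<longlongrightarrow> D t w) at_top" by (rule tendsto_eventually)
  then show "D t w = Dinf w" using Dinf_limit(1)[OF reg] by (intro tendsto_unique[of at_top]) auto
  from reg show "N t w = 0"
  proof (cases rule: T0_cases)
    case infinite
    then show ?thesis using t by (simp add: top_unique)
  next
    case (finite u)
    then have "Z u w = 0" using regular_Z[OF reg, of u] by simp
    then show ?thesis using regular_flat_N[OF reg _ t(1) _ Zt, of u] finite by simp
  qed
qed

text \<open>If \<open>T0\<close> is infinite, \<open>kappa k\<close> tends to infinity; otherwise it
  tends to \<open>T0\<close>, where the continuous \<open>D\<close> has already reached its
  limit.\<close>

lemma D_kappa_limit:
  assumes good: "good w"
  shows "(\<lambda>k. D (kappa k w) w) \<longlonglongrightarrow> Dinf w"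
proof -
  note reg = good_regular[OF good]
  from reg show ?thesis
  proof (cases rule: T0_cases)
    case infinite
    have "filterlim (\<lambda>k. kappa k w) at_top sequentially"
      unfolding filterlim_at_top
    proof
      fix x
      have "eventually (\<lambda>k. max 0 x < kappa k w) sequentially"
        by (rule eventually_less_kappa[OF reg]) (use infinite in auto)
      then show "eventually (\<lambda>k. x \<le> kappa k w) sequentially" by eventually_elim simp
    qed
    with Dinf_limit(1)[OF reg] show ?thesis by (rule filterlim_compose)
  next
    case (finite u)
    have "(\<lambda>k. kappa k w) \<longlonglongrightarrow> u"
    proof (rule order_tendstoI)
      fix x assume "x < u"
      then have "eventually (\<lambda>k. max 0 x < kappa k w) sequentially"
        by (intro eventually_less_kappa[OF reg]) (use finite in \<open>auto intro!: ennreal_lessI\<close>)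
      then show "eventually (\<lambda>k. x < kappa k w) sequentially" by eventually_elim simp
    next
      fix x assume "u < x"
      moreover have "kappa k w < u" for k
        using kappa_less_T0[OF reg, of k] finite kappa_range by (simp add: ennreal_less_iff)
      ultimately show "eventually (\<lambda>k. kappa k w < x) sequentially" by (intro always_eventually) (meson less_trans)
    qed
    moreover have "continuous_on {0..} (\<lambda>t. D t w)" using D_paths regular_space[OF reg] by (simp add: continuous_paths_def)
    ultimately have "(\<lambda>k. D (kappa k w) w) \<longlonglongrightarrow> D u w"
      by (intro continuous_on_tendsto_compose[where f="\<lambda>t. D t w"]) (use finite kappa_range in auto)
    moreover have "D u w = Dinf w" by (rule D_after_T0[OF good]) (use finite in auto)
    ultimately show ?thesis by simp
  qed
qed

text \<open>The limit is a definite description, hence one fixed number on all paths without a limit.\<close>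

lemma Dinf_measurable [measurable]: "Dinf \<in> borel_measurable P"
proof -
  let ?Q = "\<lambda>n::nat. {q\<in>\<rat>. real n \<le> q}"
  \<comment> \<open>The Cauchy criterion restricted to rational times, a countable condition;
    right-continuity extends it to all times.\<close>
  let ?C = "\<lambda>w. \<forall>k. \<exists>n. \<forall>p\<in>?Q n. \<forall>q\<in>?Q n. \<bar>D p w - D q w\<bar> \<le> 1 / real (Suc k)"
  have Dm: "D q \<in> borel_measurable P" if "q \<in> ?Q n" for q n
    by (rule adapted_measurable(2)[OF D_adapted]) (use that of_nat_0_le_iff[of n] order_trans in blast)
  have iff: "(\<exists>l. ((\<lambda>t. D t w) \<longlongrightarrow> l) at_top) \<longleftrightarrow> ?C w" if w: "w \<in> space P" for w
  proof
    assume "\<exists>l. ((\<lambda>t. D t w) \<longlongrightarrow> l) at_top"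
    then obtain l where l: "((\<lambda>t. D t w) \<longlongrightarrow> l) at_top" by blast
    show "?C w"
    proof
      fix k
      have "eventually (\<lambda>t. dist (D t w) l < 1 / real (Suc k) / 2) at_top"
        using l by (rule tendstoD) simp
      then obtain x where x: "\<And>t. t \<ge> x \<Longrightarrow> dist (D t w) l < 1 / real (Suc k) / 2"
        unfolding eventually_at_top_linorder by blast
      obtain n where n: "x \<le> real n" using real_arch_simple by blast
      show "\<exists>n. \<forall>p\<in>?Q n. \<forall>q\<in>?Q n. \<bar>D p w - D q w\<bar> \<le> 1 / real (Suc k)"
      proof (intro exI[of _ n] ballI)
        fix p q assume "p \<in> ?Q n" "q \<in> ?Q n"
        then have "p \<ge> x" "q \<ge> x" using n by auto
        from x[OF this(1)] x[OF this(2)] show "\<bar>D p w - D q w\<bar> \<le> 1 / real (Suc k)"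
          unfolding dist_real_def abs_le_iff abs_less_iff by (auto simp: field_simps)
      qed
    qed
  next
    assume C: "?C w"
    have real_C: "\<exists>n. \<forall>s\<ge>real n. \<forall>t\<ge>real n. \<bar>D s w - D t w\<bar> \<le> 1 / real (Suc k)" for k
    proof -
      obtain n where n: "\<And>p q. p \<in> ?Q n \<Longrightarrow> q \<in> ?Q n \<Longrightarrow> \<bar>D p w - D q w\<bar> \<le> 1 / real (Suc k)"
        using C by blast
      have approx: "\<exists>v. (\<forall>m. v m \<in> ?Q n) \<and> (\<lambda>m. D (v m) w) \<longlonglongrightarrow> D s w" if s: "s \<ge> real n" for s
      proof -
        have "0 \<le> s" using s of_nat_0_le_iff[of n] order_trans by blast
        then have "(\<lambda>m. D (round_up m s) w) \<longlonglongrightarrow> D s w"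
          by (intro tendsto_round_up[where f="\<lambda>s. D s w"] continuous_paths_right[OF D_paths] w)
        moreover have "round_up m s \<in> ?Q n" for m using order_trans[OF s round_up_ge] by (simp add: round_up_def)
        ultimately show ?thesis by (intro exI[of _ "\<lambda>m. round_up m s"] conjI allI)
      qed
      show ?thesis
      proof (intro exI[of _ n] allI impI)
        fix s t assume st: "s \<ge> real n" "t \<ge> real n"
        obtain v v' where v: "\<And>m. v m \<in> ?Q n" "(\<lambda>m. D (v m) w) \<longlonglongrightarrow> D s w"
          and v': "\<And>m. v' m \<in> ?Q n" "(\<lambda>m. D (v' m) w) \<longlonglongrightarrow> D t w"
          using approx[OF st(1)] approx[OF st(2)] by blast
        have "(\<lambda>m. \<bar>D (v m) w - D (v' m) w\<bar>) \<longlonglongrightarrow> \<bar>D s w - D t w\<bar>"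
          by (intro tendsto_intros v v')
        then show "\<bar>D s w - D t w\<bar> \<le> 1 / real (Suc k)"
          by (rule LIMSEQ_le_const2) (use n v(1) v'(1) in blast)
      qed
    qed
    have "Cauchy (\<lambda>n. D (real n) w)"
      unfolding Cauchy_def
    proof (intro allI impI)
      fix e :: real assume "e > 0"
      then obtain k where k: "1 / real (Suc k) < e" using reals_Archimedean[of e] by (auto simp: inverse_eq_divide)
      obtain n where "\<forall>s\<ge>real n. \<forall>t\<ge>real n. \<bar>D s w - D t w\<bar> \<le> 1 / real (Suc k)" using real_C by blast
      with k show "\<exists>M. \<forall>m\<ge>M. \<forall>n\<ge>M. dist (D (real m) w) (D (real n) w) < e"
        unfolding dist_real_def by (intro exI[of _ n] allI impI le_less_trans[OF _ k]) simp
    qed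
    then obtain l where l: "(\<lambda>n. D (real n) w) \<longlonglongrightarrow> l"
      using Cauchy_convergent convergent_def by blast
    have "((\<lambda>t. D t w) \<longlongrightarrow> l) at_top"
    proof (rule tendstoI)
      fix e :: real assume "e > 0"
      then obtain k where k: "1 / real (Suc k) < e" using reals_Archimedean[of e] by (auto simp: inverse_eq_divide)
      obtain n where n: "\<forall>s\<ge>real n. \<forall>t\<ge>real n. \<bar>D s w - D t w\<bar> \<le> 1 / real (Suc k)" using real_C by blast
      show "eventually (\<lambda>t. dist (D t w) l < e) at_top"
        using eventually_ge_at_top[of "real n"]
      proof eventually_elim
        case (elim t)
        have "(\<lambda>m. \<bar>D t w - D (real m) w\<bar>) \<longlonglongrightarrow> \<bar>D t w - l\<bar>" by (intro tendsto_intros l)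
        then have "\<bar>D t w - l\<bar> \<le> 1 / real (Suc k)"
          by (rule LIMSEQ_le_const2) (use n elim in \<open>auto intro!: exI[of _ n]\<close>)
        with k show ?case by (simp add: dist_real_def)
      qed
    qed
    then show "\<exists>l. ((\<lambda>t. D t w) \<longlongrightarrow> l) at_top" by blast
  qed
  have "Measurable.pred P ?C"
  proof (intro pred_intros_countable measurable_pred_countable)
    show "countable (?Q n)" for n by (rule countable_Collect[OF countable_rat])
    then show "countable (?Q n)" for n .
    fix n k :: nat and p q assume "p \<in> ?Q n" "q \<in> ?Q n"
    note [measurable] = Dm[OF this(1)] Dm[OF this(2)]
    show "Measurable.pred P (\<lambda>w. \<bar>D p w - D q w\<bar> \<le> 1 / real (Suc k))" by measurable
  qed
  then have C: "{w \<in> space P. ?C w} \<in> sets P" by (simp only: pred_def)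
  have "D (real n) \<in> borel_measurable P" for n by (rule adapted_measurable(2)[OF D_adapted]) simp
  then have "(\<lambda>w. if ?C w then lim (\<lambda>n. D (real n) w) else (THE l::real. False)) \<in> borel_measurable P"
    by (intro measurable_If[OF _ _ C] borel_measurable_lim_metric) auto
  then show ?thesis
  proof (rule measurable_cong[THEN iffD1, rotated])
    fix w assume w: "w \<in> space P"
    show "(if ?C w then lim (\<lambda>n. D (real n) w) else (THE l. False)) = Dinf w"
    proof (cases "?C w")
      case True
      then obtain l where l: "((\<lambda>t. D t w) \<longlongrightarrow> l) at_top" using iff[OF w] by blast
      then have "Dinf w = l" unfolding limit_at_infinity_def by (intro tendsto_Lim) auto
      moreover have "(\<lambda>n. D (real n) w) \<longlonglongrightarrow> l"
        using l filterlim_real_sequentially by (rule filterlim_compose)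
      ultimately show ?thesis using True by (simp add: limI)
    next
      case False
      then have "\<not> ((\<lambda>t. D t w) \<longlongrightarrow> l) at_top" for l using iff[OF w] by blast
      then show ?thesis unfolding if_not_P[OF False] limit_at_infinity_def t2_space_class.Lim_def by simp
    qed
  qed
qed

end

context enlarged_market
begin

section \<open>Removing the localisation\<close>

lemma H_nonneg: "regular w \<Longrightarrow> 0 \<le> t \<Longrightarrow> 0 \<le> H t w"
  unfolding H_def by (intro divide_nonneg_nonneg regular_R_nonneg regular_N_nonneg)

lemma H_bound:
  assumes "regular w" "0 < x" "ennreal x \<le> hit k w" "0 \<le> u" "u \<le> x"
  shows "\<bar>H u w\<bar> \<le> real (Suc k) * real (Suc k)" "0 < N u w"
proof -
  let ?K = "real (Suc k)"
  have *: "1 / ?K \<le> N u w" "R u w \<le> ?K" using bounds_before_hit[OF assms] by auto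
  have "0 < 1 / ?K" by simp
  with * show N: "0 < N u w" by linarith
  have R: "0 \<le> R u w" by (rule regular_R_nonneg[OF assms(1,4)])
  have "1 \<le> N u w * ?K" using *(1) by (simp add: divide_le_eq del: of_nat_Suc)
  then have "R u w * 1 \<le> ?K * (N u w * ?K)" using *(2) R by (intro mult_mono) auto
  then have "H u w \<le> ?K * ?K" using N by (simp add: H_def pos_divide_le_eq mult_ac del: of_nat_Suc)
  with H_nonneg[OF assms(1,4)] show "\<bar>H u w\<bar> \<le> ?K * ?K" by simp
qed

lemma expectation_at_stopping_time:
  assumes \<tau>: "stopping_time G \<tau>" and range: "\<And>w. w \<in> space P \<Longrightarrow> 0 \<le> \<tau> w \<and> \<tau> w \<le> c"
    and a: "a \<in> borel_measurable (G.pre_sigma \<tau>)" "a \<in> borel_measurable P" "\<And>w. 0 \<le> a w \<and> a w \<le> 1"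
    and bound: "AE w in P. a w \<noteq> 0 \<longrightarrow> 0 < N (\<tau> w) w \<and> \<bar>H (\<tau> w) w\<bar> \<le> C" and C: "0 \<le> C"
  shows "integrable P (\<lambda>w. a w * H (\<tau> w) w * of_bool (ennreal (\<tau> w) < \<sigma> w))"
    and "(LINT w|P. a w * H (\<tau> w) w * of_bool (ennreal (\<tau> w) < \<sigma> w)) = (LINT w|P. a w * D (\<tau> w) w * \<rho> w)"
proof -
  have nonneg: "0 \<le> \<tau> w" if "w \<in> space P" for w using range[OF that] by simp
  have [measurable]: "\<tau> \<in> borel_measurable P" by (rule G.stopping_time_measurable[OF \<tau>])
  note [measurable] = a(2) measurable_at(2-4)[OF \<open>\<tau> \<in> borel_measurable P\<close> nonneg]
  have [measurable]: "(\<lambda>w. Z (\<tau> w) w) \<in> borel_measurable P"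
    by (rule measurable_at_random_time) (auto intro: adapted_measurable Z_adapted continuous_paths_right Z_paths nonneg)
  note pre = measurable_pre_sigma[OF \<tau> nonneg]
  have h: "(\<lambda>w. a w * H (\<tau> w) w) \<in> borel_measurable (G.pre_sigma \<tau>)"
    unfolding H_def by (intro borel_measurable_times borel_measurable_divide a pre)
  have d: "(\<lambda>w. a w * D (\<tau> w) w) \<in> borel_measurable (G.pre_sigma \<tau>)"
    by (intro borel_measurable_times a pre)
  have hb: "AE w in P. \<bar>a w * H (\<tau> w) w\<bar> \<le> C"
    using bound
  proof eventually_elim
    case (elim w)
    show ?case
    proof (cases "a w = 0")
      case False
      then have "\<bar>a w\<bar> * \<bar>H (\<tau> w) w\<bar> \<le> 1 * C" using elim a(3)[of w] by (intro mult_mono) auto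
      then show ?thesis by (simp add: abs_mult)
    qed (use C in simp)
  qed
  have db: "AE w in P. \<bar>a w * D (\<tau> w) w\<bar> \<le> 1"
    using AE_regular
  proof eventually_elim
    case (elim w)
    note t = nonneg[OF regular_space[OF elim]]
    have "\<bar>a w\<bar> * \<bar>D (\<tau> w) w\<bar> \<le> 1 * 1"
      using a(3)[of w] regular_D_nonneg[OF elim t] regular_D_le_1[OF elim t] by (intro mult_mono) auto
    then show ?case by (simp add: abs_mult)
  qed
  have "(LINT w|P. a w * H (\<tau> w) w * of_bool (ennreal (\<tau> w) < \<sigma> w)) = (LINT w|P. a w * H (\<tau> w) w * Z (\<tau> w) w)"
    by (rule optional_sampling_Z(2)[OF \<tau> range h hb, symmetric])
  also have "\<dots> = (LINT w|P. a w * D (\<tau> w) w * R (\<tau> w) w)"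
  proof (rule integral_cong_AE)
    show "AE w in P. a w * H (\<tau> w) w * Z (\<tau> w) w = a w * D (\<tau> w) w * R (\<tau> w) w"
      using bound AE_regular
    proof eventually_elim
      case (elim w)
      then show ?case
        using regular_Z[OF elim(2) nonneg[OF regular_space[OF elim(2)]]] by (cases "a w = 0") (auto simp: H_def)
    qed
  qed measurable
  also have "\<dots> = (LINT w|P. a w * D (\<tau> w) w * \<rho> w)"
    by (rule optional_sampling_R(2)[OF \<tau> range d db])
  finally show "(LINT w|P. a w * H (\<tau> w) w * of_bool (ennreal (\<tau> w) < \<sigma> w)) = (LINT w|P. a w * D (\<tau> w) w * \<rho> w)" .
  show "integrable P (\<lambda>w. a w * H (\<tau> w) w * of_bool (ennreal (\<tau> w) < \<sigma> w))"
    by (rule integrable_bounded_mult[OF _ _ hb], rule integrable_const_bound[where B=1]) auto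
qed

text \<open>The previous lemma is applied at the constant time \<open>s\<close>, on the events s <
  kappa k where \<open>H s\<close> is bounded. These increase to s < T0; on the left this
  restriction disappears since \<sigma> < T0.\<close>

lemma expectation_stopped_after_s:
  assumes s: "0 \<le> s" and B: "B \<in> sets (F (ennreal s))"
  shows "integrable P (\<lambda>w. indicat_real B w * of_bool (ennreal s < \<sigma> w) * H s w)"
    and "(LINT w|P. indicat_real B w * of_bool (ennreal s < \<sigma> w) * H s w) =
         (LINT w|P. indicat_real B w * of_bool (ennreal s < T0 w) * D s w * \<rho> w)"
proof -
  have BP [measurable]: "B \<in> sets P" using B sets_F_subset by auto
  have stop: "stopping_time G (\<lambda>_. s)" by (rule stopping_time_const)
  define Bk where "Bk k = {w \<in> B. s < kappa k w}" for k
  have [measurable]: "kappa k \<in> borel_measurable P" for k by (rule G.stopping_time_measurable[OF stopping_time_kappa])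
  have [measurable]: "T0 \<in> borel_measurable P" by (rule stopping_time_F_measurable[OF stopping_time_T0])
  have [measurable]: "H s \<in> borel_measurable P" "D s \<in> borel_measurable P" "R s \<in> borel_measurable P" "Z s \<in> borel_measurable P"
    using measurable_at[of "\<lambda>_. s"] s adapted_measurable(2)[OF Z_adapted s] by simp_all
  have [measurable]: "\<rho> \<in> borel_measurable P" using rho_integrable by auto
  have Bk: "Bk k \<in> sets (F (ennreal s))" for k
    unfolding Bk_def by (rule G.sets_before_stopping_time[OF stopping_time_kappa B])
  have [measurable]: "Bk k \<in> sets P" for k using Bk sets_F_subset by auto
  define f where "f k w = indicat_real (Bk k) w * of_bool (ennreal s < \<sigma> w) * H s w" for k w
  have f: "integrable P (f k) \<and> (LINT w|P. f k w) = (LINT w|P. indicat_real (Bk k) w * D s w * \<rho> w)" for k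
  proof -
    have bound: "AE w in P. indicat_real (Bk k) w \<noteq> 0 \<longrightarrow> 0 < N s w \<and> \<bar>H s w\<bar> \<le> real (Suc k) * real (Suc k)"
      using AE_regular
    proof eventually_elim
      case (elim w)
      show ?case
      proof
        assume "indicat_real (Bk k) w \<noteq> 0"
        then have x: "0 < kappa k w" "s \<le> kappa k w" using s by (auto simp: Bk_def indicator_def split: if_splits)
        have "ennreal (kappa k w) \<le> hit k w" by (simp add: ennreal_kappa min_le_iff_disj)
        from H_bound[OF elim x(1) this s x(2)] show "0 < N s w \<and> \<bar>H s w\<bar> \<le> real (Suc k) * real (Suc k)" by blast
      qed
    qed
    have f_eq: "f k = (\<lambda>w. indicat_real (Bk k) w * H s w * of_bool (ennreal s < \<sigma> w))"
      by (simp add: f_def fun_eq_iff mult_ac)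
    note * = expectation_at_stopping_time[OF stop _ borel_measurable_indicator[OF pre_sigma_const[OF Bk]] _ _ bound, of s]
    show ?thesis unfolding f_eq by (intro conjI *) (use s in auto)
  qed
  have lim: "AE w in P. mono (\<lambda>k. f k w) \<and> (\<lambda>k. f k w) \<longlonglongrightarrow> indicat_real B w * of_bool (ennreal s < \<sigma> w) * H s w \<and>
      (\<lambda>k. indicat_real (Bk k) w * D s w * \<rho> w) \<longlonglongrightarrow> indicat_real B w * of_bool (ennreal s < T0 w) * D s w * \<rho> w"
    using AE_good
  proof eventually_elim
    case (elim w)
    note reg = good_regular[OF elim]
    have mono: "indicat_real (Bk k) w \<le> indicat_real (Bk k') w" if "k \<le> k'" for k k'
      using incseqD[OF incseq_kappa[OF reg] that] by (auto simp: Bk_def indicator_def)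
    have ind: "(\<lambda>k. indicat_real (Bk k) w) \<longlonglongrightarrow> indicat_real B w * of_bool (ennreal s < T0 w)"
    proof (rule tendsto_eventually)
      show "eventually (\<lambda>k. indicat_real (Bk k) w = indicat_real B w * of_bool (ennreal s < T0 w)) sequentially"
      proof (cases "ennreal s < T0 w")
        case True
        show ?thesis
          using eventually_less_kappa[OF reg s True] by eventually_elim (use True in \<open>simp add: Bk_def indicator_def\<close>)
      next
        case False
        have "\<not> s < kappa k w" for k
          using kappa_less_T0[OF reg, of k] False s by (metis ennreal_leI less_imp_le not_le order_less_le_trans order_le_less_trans)
        then show ?thesis using False by (simp add: Bk_def indicator_def)
      qed
    qed
    have "(\<lambda>k. f k w) \<longlonglongrightarrow> indicat_real B w * of_bool (ennreal s < T0 w) * of_bool (ennreal s < \<sigma> w) * H s w"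
      unfolding f_def by (intro tendsto_intros ind)
    moreover have "of_bool (ennreal s < T0 w) * of_bool (ennreal s < \<sigma> w) = (of_bool (ennreal s < \<sigma> w) :: real)"
      using good_sigma[OF elim] by auto
    moreover have "mono (\<lambda>k. f k w)"
      unfolding f_def using H_nonneg[OF reg s] by (intro monoI mult_right_mono mono) auto
    moreover have "(\<lambda>k. indicat_real (Bk k) w * D s w * \<rho> w) \<longlonglongrightarrow> indicat_real B w * of_bool (ennreal s < T0 w) * D s w * \<rho> w"
      by (intro tendsto_intros ind)
    ultimately show ?case by (simp add: mult.assoc)
  qed
  have conv: "(\<lambda>k. LINT w|P. f k w) \<longlonglongrightarrow> (LINT w|P. indicat_real B w * of_bool (ennreal s < T0 w) * D s w * \<rho> w)"
    unfolding f[THEN conjunct2]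
  proof (rule integral_dominated_convergence[where w="\<rho>"])
    show "AE w in P. (\<lambda>k. indicat_real (Bk k) w * D s w * \<rho> w) \<longlonglongrightarrow> indicat_real B w * of_bool (ennreal s < T0 w) * D s w * \<rho> w"
      using lim by eventually_elim blast
    show "AE w in P. norm (indicat_real (Bk k) w * D s w * \<rho> w) \<le> \<rho> w" for k
      using AE_regular
    proof eventually_elim
      case (elim w)
      then show ?case
        using regular_D_nonneg[OF elim s] regular_D_le_1[OF elim s] regular_rho[OF elim]
        by (auto simp: indicator_def mult_left_le_one_le)
    qed
  qed (use rho_integrable in auto)
  show "integrable P (\<lambda>w. indicat_real B w * of_bool (ennreal s < \<sigma> w) * H s w)"
    by (rule integrable_monotone_convergence[OF _ _ _ conv]) (use f lim in auto)
  show "(LINT w|P. indicat_real B w * of_bool (ennreal s < \<sigma> w) * H s w) =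
         (LINT w|P. indicat_real B w * of_bool (ennreal s < T0 w) * D s w * \<rho> w)"
    by (rule integral_monotone_convergence[OF _ _ _ conv]) (use f lim in auto)
qed

text \<open>In the localised identity, the paths on which \<open>kappa k\<close> precedes both
  \<sigma> and \<open>T\<close> contribute \<open>H\<close> at \<open>kappa k\<close>. The term with
  \<open>h\<close> removes them, at the price of \<open>d\<close> on the other side. What is left is
  \<open>H\<close> at the minimum of \<sigma> and \<open>T\<close> on growing events, hence
  increasing in \<open>k\<close>. In the limit the \<open>D\<close> value inside \<open>d\<close>
  becomes \<open>Dinf\<close> where T0 \<le> T and disappears elsewhere, since
  \<open>kappa k\<close> stays below \<open>T\<close> for all \<open>k\<close> exactly when T0 \<le>
  T.\<close>

lemma expectation_terminal_after_s:
  assumes T: "stopping_time F T" and s: "0 \<le> s" and B: "B \<in> sets (F (ennreal s))"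
  shows "integrable P (\<lambda>w. indicat_real B w * of_bool (ennreal s < \<sigma> w \<and> ennreal s < T w) * H (enn2real (min (\<sigma> w) (T w))) w)" (is "integrable P ?u")
    and "(LINT w|P. indicat_real B w * of_bool (ennreal s < \<sigma> w \<and> ennreal s < T w) * H (enn2real (min (\<sigma> w) (T w))) w) =
         (LINT w|P. indicat_real B w * of_bool (ennreal s < T w \<and> ennreal s < T0 w) * (D s w - of_bool (T0 w \<le> T w) * Dinf w) * \<rho> w)" (is "_ = (LINT w|P. ?v w)")
proof -
  have BP [measurable]: "B \<in> sets P" using B sets_F_subset by auto
  define \<tau> where "\<tau> k w = enn2real (min (ennreal (real k)) (min (min (lam k w) (hit k w)) (T w)))" for k w
  have \<tau>_stop: "stopping_time G (\<tau> k)" for k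
    unfolding \<tau>_def
    by (rule stopping_time_truncate[OF stopping_time_min[OF stopping_time_min[OF lam_stopping stopping_time_hit] T]]) simp
  have \<tau>_enn: "ennreal (\<tau> k w) = min (ennreal (kappa k w)) (T w)" for k w
    unfolding \<tau>_def ennreal_enn2real_min ennreal_kappa by (simp only: min.assoc)
  have \<tau>0: "0 \<le> \<tau> k w" for k w by (simp add: \<tau>_def)
  have \<tau>_kappa: "\<tau> k w \<le> kappa k w" for k w
    using \<tau>_enn[of k w] kappa_range(1)[of k w] by (metis ennreal_le_iff min.cobounded1)
  have \<tau>k: "\<tau> k w \<le> real k" for k w using \<tau>_kappa kappa_range(2) by (rule order_trans)
  have \<tau>_hit: "ennreal (\<tau> k w) \<le> hit k w" and \<tau>_lam: "ennreal (\<tau> k w) \<le> lam k w" for k w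
    unfolding \<tau>_enn ennreal_kappa by (simp_all add: min_le_iff_disj)
  have [measurable]: "T \<in> borel_measurable P" "T0 \<in> borel_measurable P"
    using stopping_time_F_measurable[OF T] stopping_time_F_measurable[OF stopping_time_T0] by auto
  have [measurable]: "kappa k \<in> borel_measurable P" "\<tau> k \<in> borel_measurable P" for k
    using G.stopping_time_measurable[OF stopping_time_kappa] G.stopping_time_measurable[OF \<tau>_stop] by auto
  have [measurable]: "\<rho> \<in> borel_measurable P" using rho_integrable by auto
  have [measurable]: "D s \<in> borel_measurable P" using measurable_at[of "\<lambda>_. s"] s by simp
  have [measurable]: "(\<lambda>w. H (enn2real (min (\<sigma> w) (T w))) w) \<in> borel_measurable P"
    by (rule measurable_at) auto
  have [measurable]: "(\<lambda>w. D (\<tau> k w) w) \<in> borel_measurable P" "(\<lambda>w. H (\<tau> k w) w) \<in> borel_measurable P" for k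
    by (rule measurable_at; simp add: \<tau>0)+
  define Bk where "Bk k = {w \<in> B. s < \<tau> k w}" for k
  have Bk: "Bk k \<in> sets (F (ennreal s))" for k
    unfolding Bk_def by (rule G.sets_before_stopping_time[OF \<tau>_stop B])
  have [measurable]: "Bk k \<in> sets P" for k using Bk sets_F_subset by auto
  have Bk_tau: "s < \<tau> k w" if "w \<in> Bk k" for k w using that by (simp add: Bk_def)
  have loc: "integrable P (\<lambda>w. indicat_real (Bk k) w * of_bool (ennreal s < \<sigma> w) * H (enn2real (min (\<sigma> w) (ennreal (\<tau> k w)))) w)"
    "(LINT w|P. indicat_real (Bk k) w * of_bool (ennreal s < \<sigma> w) * H (enn2real (min (\<sigma> w) (ennreal (\<tau> k w)))) w)
      = (LINT w|P. indicat_real (Bk k) w * D s w * \<rho> w)" for k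
  proof -
    have b: "AE w in P. w \<in> Bk k \<longrightarrow> (\<forall>u. 0 \<le> u \<longrightarrow> u \<le> \<tau> k w \<longrightarrow> 1 / real (Suc k) \<le> N u w \<and> N u w \<le> real (Suc k) \<and> R u w \<le> real (Suc k))"
      using AE_regular
    proof eventually_elim
      case (elim w)
      show ?case
      proof (intro impI allI)
        fix u assume "w \<in> Bk k" "0 \<le> u" "u \<le> \<tau> k w"
        then show "1 / real (Suc k) \<le> N u w \<and> N u w \<le> real (Suc k) \<and> R u w \<le> real (Suc k)"
          using Bk_tau[of w k] s by (intro bounds_before_hit[OF elim _ \<tau>_hit]) auto
      qed
    qed
    \<comment> \<open>The horizon is the maximum of s and k because the localised identity asks for
      s \<le> c.\<close>
    have r: "0 \<le> \<tau> k w \<and> \<tau> k w \<le> max s (real k)" for w using \<tau>0 \<tau>k by (simp add: max.coboundedI2)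
    note L = localised_identity[OF \<tau>_stop r \<tau>_lam s _ Bk Bk_tau _ b]
    show "integrable P (\<lambda>w. indicat_real (Bk k) w * of_bool (ennreal s < \<sigma> w) * H (enn2real (min (\<sigma> w) (ennreal (\<tau> k w)))) w)"
      by (rule L(1)) auto
    show "(LINT w|P. indicat_real (Bk k) w * of_bool (ennreal s < \<sigma> w) * H (enn2real (min (\<sigma> w) (ennreal (\<tau> k w)))) w)
      = (LINT w|P. indicat_real (Bk k) w * D s w * \<rho> w)"
      by (rule L(2)) auto
  qed
  define h where "h k w = indicat_real (Bk k) w * of_bool (ennreal (kappa k w) < T w) * H (\<tau> k w) w" for k w
  define d where "d k w = indicat_real (Bk k) w * of_bool (ennreal (kappa k w) < T w) * D (\<tau> k w) w" for k w
  have [measurable]: "h k \<in> borel_measurable P" "d k \<in> borel_measurable P" for k unfolding h_def d_def by measurable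
  have d_bound: "AE w in P. 0 \<le> d k w \<and> d k w \<le> 1" for k
    using AE_regular
  proof eventually_elim
    case (elim w)
    then show ?case using regular_D_nonneg[OF elim \<tau>0] regular_D_le_1[OF elim \<tau>0] by (auto simp: d_def indicator_def)
  qed
  have g: "integrable P (\<lambda>w. h k w * of_bool (ennreal (\<tau> k w) < \<sigma> w)) \<and>
      (LINT w|P. h k w * of_bool (ennreal (\<tau> k w) < \<sigma> w)) = (LINT w|P. d k w * \<rho> w)" for k
  proof -
    \<comment> \<open>\<open>T\<close> is truncated at k + 1, strictly above \<open>kappa k\<close>,
      so that the event that \<open>kappa k\<close> precedes \<open>T\<close> is unchanged and
      becomes a comparison of two real stopping times, known at the earlier one.\<close>
    define \<theta> where "\<theta> w = enn2real (min (ennreal (real k + 1)) (T w))" for w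
    have \<theta>: "stopping_time G \<theta>" unfolding \<theta>_def by (rule stopping_time_truncate[OF T]) simp
    have less: "\<tau> k w < \<theta> w \<longleftrightarrow> ennreal (kappa k w) < T w" for w
    proof -
      have "\<tau> k w < \<theta> w \<longleftrightarrow> ennreal (\<tau> k w) < ennreal (\<theta> w)" by (simp add: ennreal_less_iff \<tau>0)
      also have "\<dots> \<longleftrightarrow> min (ennreal (kappa k w)) (T w) < min (ennreal (real k + 1)) (T w)"
        unfolding \<tau>_enn \<theta>_def ennreal_enn2real_min ..
      also have "\<dots> \<longleftrightarrow> ennreal (kappa k w) < T w"
      proof -
        have "ennreal (kappa k w) < ennreal (real k + 1)"
          using kappa_range[of k w] by (intro ennreal_lessI) auto
        then show ?thesis by (auto simp: min_less_iff_disj)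
      qed
      finally show ?thesis .
    qed
    have "Measurable.pred (G.pre_sigma (\<tau> k)) (\<lambda>w. \<tau> k w < \<theta> w)"
      by (rule G.stopping_time_less[OF \<tau>_stop \<theta>])
    then have [measurable]: "Measurable.pred (G.pre_sigma (\<tau> k)) (\<lambda>w. ennreal (kappa k w) < T w)"
      by (simp add: less)
    have [measurable]: "Bk k \<in> sets (G.pre_sigma (\<tau> k))"
      by (rule G.sets_pre_sigma_after[OF \<tau>_stop Bk]) (auto dest: Bk_tau)
    let ?a = "\<lambda>w. indicat_real (Bk k) w * of_bool (ennreal (kappa k w) < T w)"
    have a: "?a \<in> borel_measurable (G.pre_sigma (\<tau> k))" by measurable
    have bound: "AE w in P. ?a w \<noteq> 0 \<longrightarrow> 0 < N (\<tau> k w) w \<and> \<bar>H (\<tau> k w) w\<bar> \<le> real (Suc k) * real (Suc k)"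
      using AE_regular
    proof eventually_elim
      case (elim w)
      show ?case
      proof
        assume "?a w \<noteq> 0"
        then have x: "0 < \<tau> k w" using s Bk_tau[of w k] by (auto simp: indicator_def split: if_splits)
        from H_bound[OF elim x \<tau>_hit \<tau>0 order_refl]
        show "0 < N (\<tau> k w) w \<and> \<bar>H (\<tau> k w) w\<bar> \<le> real (Suc k) * real (Suc k)" by blast
      qed
    qed
    have r: "0 \<le> \<tau> k w \<and> \<tau> k w \<le> real k" for w using \<tau>0 \<tau>k by simp
    note * = expectation_at_stopping_time[OF \<tau>_stop r a _ _ bound]
    show ?thesis unfolding h_def d_def by (intro conjI *) (auto simp: indicator_def)
  qed
  define f where "f k w = indicat_real (Bk k) w * of_bool (ennreal s < \<sigma> w) * H (enn2real (min (\<sigma> w) (ennreal (\<tau> k w)))) w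
      - h k w * of_bool (ennreal (\<tau> k w) < \<sigma> w)" for k w
  define v where "v k w = (indicat_real (Bk k) w * D s w - d k w) * \<rho> w" for k w
  have f_int: "integrable P (f k)" for k unfolding f_def by (intro Bochner_Integration.integrable_diff loc) (use g in blast)
  have i1: "integrable P (\<lambda>w. indicat_real (Bk k) w * D s w * \<rho> w)" for k
  proof (rule integrable_bounded_mult[OF rho_integrable, where C=1])
    show "AE w in P. \<bar>indicat_real (Bk k) w * D s w\<bar> \<le> 1"
      using AE_regular by eventually_elim (use s regular_D_nonneg regular_D_le_1 in \<open>auto simp: indicator_def\<close>)
  qed simp
  have i2: "integrable P (\<lambda>w. d k w * \<rho> w)" for k
  proof (rule integrable_bounded_mult[OF rho_integrable, where C=1])
    show "AE w in P. \<bar>d k w\<bar> \<le> 1" using d_bound[of k] by eventually_elim simp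
  qed simp
  have f_eq: "(LINT w|P. f k w) = (LINT w|P. v k w)" for k
  proof -
    have gi: "integrable P (\<lambda>w. h k w * of_bool (ennreal (\<tau> k w) < \<sigma> w))"
      and ge: "(LINT w|P. h k w * of_bool (ennreal (\<tau> k w) < \<sigma> w)) = (LINT w|P. d k w * \<rho> w)"
      using g by blast+
    show ?thesis
      unfolding f_def v_def left_diff_distrib Bochner_Integration.integral_diff[OF loc(1) gi]
        Bochner_Integration.integral_diff[OF i1 i2] loc(2) ge ..
  qed
  \<comment> \<open>This closed form exhibits the monotonicity in \<open>k\<close>. Only in the
    first case, \<open>kappa k\<close> before \<sigma> and \<open>T\<close>, is something
    subtracted.\<close>
  have f_form: "f k w = indicat_real (Bk k) w * of_bool (ennreal s < \<sigma> w \<and> min (\<sigma> w) (T w) \<le> ennreal (kappa k w)) * H (enn2real (min (\<sigma> w) (T w))) w" for k w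
  proof (cases "w \<in> Bk k")
    case True
    have s\<tau>: "ennreal s < ennreal (\<tau> k w)" using Bk_tau[OF True] s by (simp add: ennreal_less_iff)
    consider "ennreal (kappa k w) < T w" "ennreal (kappa k w) < \<sigma> w" | "T w \<le> ennreal (kappa k w)"
      | "ennreal (kappa k w) < T w" "\<sigma> w \<le> ennreal (kappa k w)" by (meson not_le)
    then show ?thesis
    proof cases
      case 1
      then have t: "ennreal (\<tau> k w) = ennreal (kappa k w)" by (simp add: \<tau>_enn min_absorb1 less_imp_le)
      then have "min (\<sigma> w) (ennreal (\<tau> k w)) = ennreal (\<tau> k w)" using 1 by (simp add: min_absorb2 less_imp_le)
      moreover have "ennreal s < \<sigma> w" using s\<tau> t 1 by (metis less_trans)
      moreover have "\<not> min (\<sigma> w) (T w) \<le> ennreal (kappa k w)" using 1 by (simp add: min_le_iff_disj not_le)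
      moreover have "\<tau> k w = kappa k w" using t by (simp add: \<tau>0 kappa_range)
      ultimately show ?thesis using 1 True by (simp add: f_def h_def kappa_range)
    next
      case 2
      then have t: "ennreal (\<tau> k w) = T w" by (simp add: \<tau>_enn min_absorb2)
      have "min (\<sigma> w) (T w) \<le> ennreal (kappa k w)" using 2 by (simp add: min_le_iff_disj)
      then show ?thesis using 2 unfolding f_def h_def t by (simp add: not_less[symmetric])
    next
      case 3
      then have t: "ennreal (\<tau> k w) = ennreal (kappa k w)" by (simp add: \<tau>_enn min_absorb1 less_imp_le)
      then have "min (\<sigma> w) (ennreal (\<tau> k w)) = \<sigma> w" using 3 by (simp add: min_absorb1)
      moreover have "min (\<sigma> w) (T w) = \<sigma> w" using 3 by (simp add: min_absorb1)
      ultimately show ?thesis using 3 t by (simp add: f_def h_def not_less[symmetric])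
    qed
  next
    case False
    then show ?thesis by (simp add: f_def h_def)
  qed
  have lim: "AE w in P. mono (\<lambda>k. f k w) \<and> (\<lambda>k. f k w) \<longlonglongrightarrow> ?u w \<and> (\<lambda>k. v k w) \<longlonglongrightarrow> ?v w"
    using AE_good
  proof eventually_elim
    case (elim w)
    note reg = good_regular[OF elim]
    have kmono: "kappa k w \<le> kappa k' w" if "k \<le> k'" for k k'
      using incseqD[OF incseq_kappa[OF reg] that] .
    have tmono: "\<tau> k w \<le> \<tau> k' w" if "k \<le> k'" for k k'
    proof -
      have "ennreal (\<tau> k w) \<le> ennreal (\<tau> k' w)" unfolding \<tau>_enn using kmono[OF that] by (intro min.mono ennreal_leI) auto
      then show ?thesis using \<tau>0 by simp
    qed
    have Bmono: "indicat_real (Bk k) w \<le> indicat_real (Bk k') w" if "k \<le> k'" for k k'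
      using tmono[OF that] by (auto simp: Bk_def indicator_def)
    have mono: "mono (\<lambda>k. f k w)"
    proof (rule monoI)
      fix k k' :: nat assume kk: "k \<le> k'"
      show "f k w \<le> f k' w"
        unfolding f_form
      proof (intro mult_right_mono mult_mono Bmono kk H_nonneg reg)
        show "of_bool (ennreal s < \<sigma> w \<and> min (\<sigma> w) (T w) \<le> ennreal (kappa k w)) \<le> (of_bool (ennreal s < \<sigma> w \<and> min (\<sigma> w) (T w) \<le> ennreal (kappa k' w)) :: real)"
          using order_trans[OF _ ennreal_leI[OF kmono[OF kk]]] by auto
      qed auto
    qed
    have ind: "eventually (\<lambda>k. indicat_real (Bk k) w = indicat_real B w * of_bool (ennreal s < T w \<and> ennreal s < T0 w)) sequentially"
    proof (cases "ennreal s < T w \<and> ennreal s < T0 w")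
      case True
      from eventually_less_kappa[OF reg s conjunct2[OF True]] show ?thesis
      proof eventually_elim
        case (elim k)
        then have "ennreal s < ennreal (\<tau> k w)" unfolding \<tau>_enn using True s by (simp add: ennreal_less_iff)
        then have "s < \<tau> k w" using s by (simp add: ennreal_less_iff)
        then show "indicat_real (Bk k) w = indicat_real B w * of_bool (ennreal s < T w \<and> ennreal s < T0 w)"
          using True by (simp add: Bk_def indicator_def)
      qed
    next
      case False
      have "\<not> s < \<tau> k w" for k
      proof
        assume "s < \<tau> k w"
        then have "ennreal s < ennreal (\<tau> k w)" using s by (simp add: ennreal_less_iff)
        then have "ennreal s < T w" "ennreal s < ennreal (kappa k w)" unfolding \<tau>_enn by simp_all
        with False kappa_less_T0[OF reg, of k] show False by (meson less_trans)
      qed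
      then show ?thesis using False by (auto simp: Bk_def indicator_def)
    qed
    have \<sigma>0: "\<sigma> w < T0 w" by (rule good_sigma[OF elim])
    have min_ev: "eventually (\<lambda>k. min (\<sigma> w) (T w) \<le> ennreal (kappa k w)) sequentially"
    proof -
      define x where "x = enn2real (min (\<sigma> w) (T w))"
      have "min (\<sigma> w) (T w) < \<top>" using regular_sigma(2)[OF reg] by (simp add: min_less_iff_disj)
      then have x: "ennreal x = min (\<sigma> w) (T w)" "0 \<le> x" by (simp_all add: x_def)
      have "ennreal x < T0 w" unfolding x using \<sigma>0 by (simp add: min_less_iff_disj)
      from eventually_less_kappa[OF reg x(2) this] show ?thesis
        by eventually_elim (auto simp: x(1)[symmetric] intro!: ennreal_leI)
    qed
    have "(\<lambda>k. f k w) \<longlonglongrightarrow> ?u w"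
    proof (rule tendsto_eventually)
      show "eventually (\<lambda>k. f k w = ?u w) sequentially"
        using ind min_ev
      proof eventually_elim
        case (elim k)
        have "ennreal s < \<sigma> w \<Longrightarrow> ennreal s < T0 w" using \<sigma>0 less_trans by blast
        then show ?case unfolding f_form elim(1) using elim(2) by auto
      qed
    qed
    moreover have "(\<lambda>k. v k w) \<longlonglongrightarrow> ?v w"
    proof -
      have dlim: "(\<lambda>k. of_bool (ennreal (kappa k w) < T w) * D (\<tau> k w) w) \<longlonglongrightarrow> of_bool (T0 w \<le> T w) * Dinf w"
      proof (cases "T0 w \<le> T w")
        case True
        then have less: "ennreal (kappa k w) < T w" for k using kappa_less_T0[OF reg, of k] by (meson less_le_trans)
        have "\<tau> k w = kappa k w" for k
          using \<tau>_enn[of k w] less[of k] \<tau>0[of k w] kappa_range(1)[of k w] by (simp add: min_absorb1 less_imp_le)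
        then show ?thesis using D_kappa_limit[OF elim] True less by simp
      next
        case False
        then have "T w < T0 w" by simp
        then have "T w < \<top>" using less_le_trans top_greatest by blast
        then have "ennreal (enn2real (T w)) = T w" by simp
        with eventually_less_kappa[OF reg, of "enn2real (T w)"] \<open>T w < T0 w\<close>
        have "eventually (\<lambda>k. enn2real (T w) < kappa k w) sequentially" by simp
        then have "eventually (\<lambda>k. \<not> ennreal (kappa k w) < T w) sequentially"
        proof eventually_elim
          case (elim k)
          then have "ennreal (enn2real (T w)) \<le> ennreal (kappa k w)" by (intro ennreal_leI) simp
          with \<open>ennreal (enn2real (T w)) = T w\<close> show ?case by (simp add: not_less)
        qed
        then have "eventually (\<lambda>k. of_bool (ennreal (kappa k w) < T w) * D (\<tau> k w) w = of_bool (T0 w \<le> T w) * Dinf w) sequentially"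
          by eventually_elim (use False in simp)
        then show ?thesis by (rule tendsto_eventually)
      qed
      have "v k w = indicat_real (Bk k) w * (D s w - of_bool (ennreal (kappa k w) < T w) * D (\<tau> k w) w) * \<rho> w" for k
        by (simp add: v_def d_def algebra_simps)
      then show ?thesis
        by (simp only:) (intro tendsto_mult tendsto_diff tendsto_const dlim tendsto_eventually[OF ind])
    qed
    ultimately show ?case using mono by blast
  qed
  have v_meas: "v k \<in> borel_measurable P" for k unfolding v_def by measurable
  have conv: "(\<lambda>k. LINT w|P. f k w) \<longlonglongrightarrow> (LINT w|P. ?v w)"
    unfolding f_eq
  proof (rule integral_dominated_convergence[where w="\<rho>"])
    show "AE w in P. (\<lambda>k. v k w) \<longlonglongrightarrow> ?v w"
      using lim by eventually_elim blast
    show "AE w in P. norm (v k w) \<le> \<rho> w" for k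
      using AE_regular
    proof eventually_elim
      case (elim w)
      have "0 \<le> D s w" "D s w \<le> 1" "0 \<le> D (\<tau> k w) w" "0 < \<rho> w"
        using regular_D_nonneg[OF elim] regular_D_le_1[OF elim] s \<tau>0 regular_rho[OF elim] by auto
      moreover have "D (\<tau> k w) w \<le> D s w" if "w \<in> Bk k" using Bk_tau[OF that] regular_D_antimono[OF elim s] by auto
      ultimately have "\<bar>indicat_real (Bk k) w * D s w - d k w\<bar> \<le> 1"
        by (cases "w \<in> Bk k") (auto simp: d_def)
      then show ?case using \<open>0 < \<rho> w\<close> by (simp add: v_def abs_mult mult_left_le_one_le)
    qed
  qed (use rho_integrable v_meas in auto)
  show "integrable P ?u"
    by (rule integrable_monotone_convergence[OF f_int _ _ conv]) (use lim in auto)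
  show "(LINT w|P. ?u w) = (LINT w|P. ?v w)"
    by (rule integral_monotone_convergence[OF f_int _ _ conv]) (use lim in auto)
qed

end

section \<open>The enlarged filtration\<close>

lemma indicator_Collect_of_bool: "indicat_real {x. Q x} y = of_bool (Q y)"
  by (simp add: indicator_def)

context enlarged_market
begin

abbreviation E :: "ennreal \<Rightarrow> 'a measure" where "E \<equiv> progressive_enlargement P F \<sigma>"

definition enlargement_generator :: "ennreal \<Rightarrow> 'a set set" where
  "enlargement_generator s = sets (F s) \<union> {{w \<in> space P. \<sigma> w > r} | r. r \<le> s}"

lemma generator_subset: "enlargement_generator s \<subseteq> sets P"
  unfolding enlargement_generator_def using sets_F_subset by auto

lemma sigma_sets_generator_subset: "sigma_sets (space P) (enlargement_generator s) \<subseteq> sets P"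
  by (rule sets.sigma_sets_subset[OF generator_subset])

lemma space_E: "space (E t) = space P"
  unfolding progressive_enlargement_def by (simp add: space_measure_of_conv)

text \<open>An intersection of sigma-algebras is already one, so the outer \<open>sigma\<close> adds
  nothing.\<close>

lemma sets_E: "sets (E t) = (\<Inter>s\<in>insert \<top> {t<..}. sigma_sets (space P) (enlargement_generator s))" (is "_ = ?I")
proof
  have sub: "?I \<subseteq> Pow (space P)"
    using sigma_sets_generator_subset[of \<top>] sets.space_closed[of P] by blast
  have eq: "sets (E t) = sigma_sets (space P) ?I"
    unfolding progressive_enlargement_def enlargement_generator_def[symmetric] using sub by (rule sets_measure_of)
  show "?I \<subseteq> sets (E t)" unfolding eq by (rule sigma_sets_superset_generator)
  show "sets (E t) \<subseteq> ?I"
  proof (rule INT_greatest)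
    fix s assume "s \<in> insert \<top> {t<..}"
    then have "?I \<subseteq> sigma_sets (space P) (enlargement_generator s)" by blast
    then show "sets (E t) \<subseteq> sigma_sets (space P) (enlargement_generator s)"
      unfolding eq by (rule sigma_sets_mono)
  qed
qed

lemma sets_E_subset: "sets (E t) \<subseteq> sets P"
  unfolding sets_E using sigma_sets_generator_subset[of \<top>] by blast

lemma sets_E_mono: "s \<le> t \<Longrightarrow> sets (E s) \<subseteq> sets (E t)"
  unfolding sets_E by (intro INT_anti_mono) auto

lemma sets_F_E: "sets (F t) \<subseteq> sets (E t)"
  unfolding sets_E
proof (rule INT_greatest)
  fix s assume "s \<in> insert \<top> {t<..}"
  then have "t \<le> s" by auto
  then have "sets (F t) \<subseteq> enlargement_generator s"
    using sets_F_mono[of t s] by (auto simp: enlargement_generator_def)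
  then show "sets (F t) \<subseteq> sigma_sets (space P) (enlargement_generator s)" by blast
qed

lemma sigma_greater_E: "r \<le> t \<Longrightarrow> {w \<in> space P. r < \<sigma> w} \<in> sets (E t)"
  unfolding sets_E
proof
  fix s assume "r \<le> t" "s \<in> insert \<top> {t<..}"
  then have "r \<le> s" by (auto intro: order_trans less_imp_le)
  then have "{w \<in> space P. r < \<sigma> w} \<in> enlargement_generator s"
    unfolding enlargement_generator_def by blast
  then show "{w \<in> space P. r < \<sigma> w} \<in> sigma_sets (space P) (enlargement_generator s)" by (rule sigma_sets.Basic)
qed

lemma subalgebra_E: "subalgebra P (E t)"
  using sets_E_subset space_E by (simp add: subalgebra_def)

lemma sigma_finite_subalgebra_E: "sigma_finite_subalgebra P (E t)"
  by (intro finite_measure_subalgebra_is_sigma_finite finite_measure_subalgebra.intro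
      finite_measure_subalgebra_axioms.intro subalgebra_E) unfold_locales

text \<open>A generator r < \<sigma> with r \<le> u contains all of u < \<sigma>, so on that event
  only the sets of \<open>F u\<close> are seen; this survives complements and countable
  unions.\<close>

lemma generator_trace:
  assumes "A \<in> sigma_sets (space P) (enlargement_generator u)"
  shows "\<exists>B\<in>sets (F u). \<forall>w\<in>space P. u < \<sigma> w \<longrightarrow> (w \<in> A \<longleftrightarrow> w \<in> B)"
  using assms
proof induction
  case (Basic A)
  then consider "A \<in> sets (F u)" | r where "r \<le> u" "A = {w \<in> space P. r < \<sigma> w}"
    unfolding enlargement_generator_def by blast
  then show ?case
  proof cases
    case 2
    then show ?thesis
      using sets.top[of "F u"] by (intro bexI[of _ "space P"]) (auto simp: space_F)
  qed blast
next
  case Empty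
  then show ?case by blast
next
  case (Compl A)
  then obtain B where B: "B \<in> sets (F u)" "\<forall>w\<in>space P. u < \<sigma> w \<longrightarrow> (w \<in> A \<longleftrightarrow> w \<in> B)" by blast
  have "space P - B \<in> sets (F u)" using sets.compl_sets[OF B(1)] by (simp add: space_F)
  with B(2) show ?case by (intro bexI[of _ "space P - B"]) auto
next
  case (Union A)
  then obtain B where B: "\<And>i::nat. B i \<in> sets (F u)" "\<And>i. \<forall>w\<in>space P. u < \<sigma> w \<longrightarrow> (w \<in> A i \<longleftrightarrow> w \<in> B i)" by metis
  have "(\<Union>i. B i) \<in> sets (F u)" using B(1) by auto
  with B(2) show ?case by (intro bexI[of _ "\<Union>i. B i"]) auto
qed

text \<open>Traces \<open>B n\<close> are available only at times \<open>u n\<close> slightly later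
  than \<open>s\<close>. Their limes inferior depends only on late indices, hence lies in
  \<open>F v\<close> for every v > s and, by right-continuity, in \<open>F s\<close>. Where s <
  \<sigma>, eventually u n < \<sigma>, so the late \<open>B n\<close> agree with
  \<open>A\<close>.\<close>

lemma enlargement_trace:
  assumes s: "0 \<le> s" and A: "A \<in> sets (E (ennreal s))"
  shows "\<exists>B\<in>sets (F (ennreal s)). \<forall>w\<in>space P. ennreal s < \<sigma> w \<longrightarrow> (w \<in> A \<longleftrightarrow> w \<in> B)"
proof -
  define u where "u n = ennreal (s + 1 / real (Suc n))" for n
  have u_greater: "ennreal s < u n" for n using s by (simp add: u_def ennreal_less_iff)
  have u_lim: "u \<longlonglongrightarrow> ennreal s"
    unfolding u_def by (intro tendsto_ennrealI LIMSEQ_from_above) auto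
  have "\<exists>B\<in>sets (F (u n)). \<forall>w\<in>space P. u n < \<sigma> w \<longrightarrow> (w \<in> A \<longleftrightarrow> w \<in> B)" for n
    by (rule generator_trace) (use A u_greater[of n] in \<open>auto simp: sets_E\<close>)
  then obtain B where B: "\<And>n. B n \<in> sets (F (u n))" "\<And>n w. w \<in> space P \<Longrightarrow> u n < \<sigma> w \<Longrightarrow> (w \<in> A \<longleftrightarrow> w \<in> B n)"
    by metis
  define C where "C = (\<Union>m. \<Inter>n\<in>{m..}. B n)"
  have "C \<in> sets (F v)" if v: "ennreal s < v" for v
  proof -
    from order_tendstoD(2)[OF u_lim v] obtain m0 where m0: "\<And>n. n \<ge> m0 \<Longrightarrow> u n < v"
      unfolding eventually_sequentially by blast
    have Bv: "B n \<in> sets (F v)" if "n \<ge> m0" for n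
      using subsetD[OF sets_F_mono[OF less_imp_le[OF m0[OF that]]] B(1)] .
    have "(\<Union>m. \<Inter>n\<in>{max m m0..}. B n) \<in> sets (F v)"
      by (intro sets.countable_UN image_subsetI sets.countable_INT') (auto intro: Bv)
    also have "(\<Union>m. \<Inter>n\<in>{max m m0..}. B n) = C"
      unfolding C_def
    proof (rule antisym)
      show "(\<Union>m. \<Inter>n\<in>{max m m0..}. B n) \<subseteq> (\<Union>m. \<Inter>n\<in>{m..}. B n)" by blast
      show "(\<Union>m. \<Inter>n\<in>{m..}. B n) \<subseteq> (\<Union>m. \<Inter>n\<in>{max m m0..}. B n)" by (intro UN_mono) auto
    qed
    finally show ?thesis .
  qed
  then have "C \<in> sets (F (ennreal s))"
    using right_continuous[of "ennreal s"] by auto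
  moreover have "w \<in> A \<longleftrightarrow> w \<in> C" if w: "w \<in> space P" "ennreal s < \<sigma> w" for w
  proof -
    from order_tendstoD(2)[OF u_lim w(2)] obtain m0 where m0: "\<And>n. n \<ge> m0 \<Longrightarrow> u n < \<sigma> w"
      unfolding eventually_sequentially by blast
    have eq: "w \<in> A \<longleftrightarrow> w \<in> B n" if "n \<ge> m0" for n by (rule B(2)[OF w(1) m0[OF that]])
    show ?thesis
    proof
      assume "w \<in> A"
      then have "w \<in> (\<Inter>n\<in>{m0..}. B n)" using eq by auto
      then show "w \<in> C" unfolding C_def by blast
    next
      assume "w \<in> C"
      then obtain m where "\<And>n. n \<ge> m \<Longrightarrow> w \<in> B n" unfolding C_def by auto
      then have "w \<in> B (max m m0)" by simp
      then show "w \<in> A" using eq[of "max m m0"] by simp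
    qed
  qed
  ultimately show ?thesis by blast
qed

section \<open>The equivalence for the stopped quotient\<close>

lemma expectation_R:
  assumes s: "0 \<le> s" and B: "B \<in> sets (F (ennreal s))"
  shows "integrable P (R s)" "(LINT w|P. indicat_real B w * R s w) = (LINT w|P. indicat_real B w * \<rho> w)"
proof -
  note * = optional_sampling_R[OF stopping_time_const _ borel_measurable_indicator[OF pre_sigma_const[OF B]], of s 1]
  show "integrable P (R s)" "(LINT w|P. indicat_real B w * R s w) = (LINT w|P. indicat_real B w * \<rho> w)"
    by (rule *; use s in simp)+
qed

theorem ui_martingale_iff:
  assumes T: "stopping_time F T"
  shows "ui_martingale P E
           (\<lambda>t w. stopped R (\<lambda>w. min (\<sigma> w) (T w)) t w / stopped N (\<lambda>w. min (\<sigma> w) (T w)) t w)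
     \<longleftrightarrow> (LINT w|P. Dinf w * indicat_real {w. T0 w \<le> T w} w) = 0"
proof -
  define X where "X t w = H (enn2real (min (ennreal t) (min (\<sigma> w) (T w)))) w" for t w
  define Xinf where "Xinf w = H (enn2real (min (\<sigma> w) (T w))) w" for w
  have X_eq: "(\<lambda>t w. stopped R (\<lambda>w. min (\<sigma> w) (T w)) t w / stopped N (\<lambda>w. min (\<sigma> w) (T w)) t w) = X"
    by (simp add: fun_eq_iff X_def stopped_def H_def)
  have [measurable]: "T \<in> borel_measurable P" "T0 \<in> borel_measurable P"
    using stopping_time_F_measurable[OF T] stopping_time_F_measurable[OF stopping_time_T0] by auto
  have [measurable]: "\<rho> \<in> borel_measurable P" using rho_integrable by auto
  have [measurable]: "X t \<in> borel_measurable P" for t unfolding X_def by (rule measurable_at) auto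
  have [measurable]: "Xinf \<in> borel_measurable P" unfolding Xinf_def by (rule measurable_at) auto
  have [measurable]: "R 0 \<in> borel_measurable P" by (rule adapted_measurable(2)[OF R_adapted]) simp
  have [measurable]: "D s \<in> borel_measurable P" "H s \<in> borel_measurable P" if "0 \<le> s" for s
    using measurable_at[of "\<lambda>_. s"] that by auto
  have X_nonneg: "AE w in P. (\<forall>t. 0 \<le> X t w) \<and> 0 \<le> Xinf w"
    using AE_regular by eventually_elim (simp add: X_def Xinf_def H_nonneg)
  define I where "I w = (of_bool (T0 w \<le> T w) * Dinf w)" for w
  have [measurable]: "I \<in> borel_measurable P" unfolding I_def by measurable
  have I_bounds: "AE w in P. 0 \<le> I w \<and> I w \<le> 1"
    using AE_regular
  proof eventually_elim
    case (elim w)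
    have "Dinf w \<le> 1" using Dinf_limit(3)[OF elim order_refl] regular_D_0[OF elim] by simp
    then show ?case using Dinf_limit(2)[OF elim] by (simp add: I_def)
  qed
  have I\<rho>: "integrable P (\<lambda>w. I w * \<rho> w)"
    by (rule integrable_bounded_mult[OF rho_integrable, where C=1]) (use I_bounds in auto)
  have LINT_I: "(LINT w|P. Dinf w * indicat_real {w. T0 w \<le> T w} w) = (LINT w|P. I w)"
    by (rule Bochner_Integration.integral_cong) (auto simp: I_def indicator_def)
  have T_0: "{w \<in> space P. T w \<le> 0} \<in> sets (F (ennreal 0))"
    using stopping_timeD[OF T, of 0] by (simp add: pred_def space_F)
  have top: "space P \<in> sets (F t)" for t using sets.top[of "F t"] by (simp add: space_F)
  \<comment> \<open>The expectation identity at s = 0 covers only T > 0. Where T = 0 the stopped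
    value is \<open>R 0\<close>, because N 0 = 1, and is treated separately.\<close>
  let ?Z0 = "\<lambda>w. indicat_real {w \<in> space P. T w \<le> 0} w"
  let ?u0 = "\<lambda>w. indicat_real (space P) w * of_bool (ennreal 0 < \<sigma> w \<and> ennreal 0 < T w) * H (enn2real (min (\<sigma> w) (T w))) w"
  note u0 = expectation_terminal_after_s[OF T order_refl top]
  note R0 = expectation_R[OF order_refl T_0]
  have R0i: "integrable P (\<lambda>w. ?Z0 w * R 0 w)"
    by (rule integrable_bounded_mult[OF R0(1), where C=1]) auto
  have Z\<rho>i: "integrable P (\<lambda>w. ?Z0 w * \<rho> w)"
    by (rule integrable_bounded_mult[OF rho_integrable, where C=1]) auto
  have Xinf_AE: "AE w in P. Xinf w = ?u0 w + ?Z0 w * R 0 w"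
    using AE_regular
  proof eventually_elim
    case (elim w)
    show ?case
    proof (cases "T w \<le> 0")
      case True
      then have "T w = 0" by simp
      then show ?thesis
        using regular_space[OF elim] regular_N_0[OF elim] by (simp add: Xinf_def H_def)
    next
      case False
      then have "0 < T w" "T w \<noteq> 0" by (auto simp: zero_less_iff_neq_zero)
      then show ?thesis
        using regular_space[OF elim] regular_sigma(1)[OF elim] by (simp add: Xinf_def)
    qed
  qed
  have Xinf_int: "integrable P Xinf"
    by (rule integrable_cong_AE_imp[OF Bochner_Integration.integrable_add[OF u0(1) R0i]]) (use Xinf_AE in auto)
  have E_Xinf: "(LINT w|P. Xinf w) = (LINT w|P. \<rho> w) - (LINT w|P. I w * \<rho> w)"
  proof -
    let ?v0 = "\<lambda>w. indicat_real (space P) w * of_bool (ennreal 0 < T w \<and> ennreal 0 < T0 w) * (D 0 w - of_bool (T0 w \<le> T w) * Dinf w) * \<rho> w"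
    have v0_AE: "AE w in P. ?v0 w = \<rho> w - I w * \<rho> w - ?Z0 w * \<rho> w"
      using AE_good
    proof eventually_elim
      case (elim w)
      note reg = good_regular[OF elim]
      have T0: "0 < T0 w" using good_sigma[OF elim] by (meson le_less_trans zero_le)
      show ?case
      proof (cases "T w \<le> 0")
        case True
        then have "\<not> T0 w \<le> T w" "T w = 0" using T0 by auto
        then show ?thesis using regular_space[OF reg] by (simp add: I_def)
      next
        case False
        then have "0 < T w" "T w \<noteq> 0" by (auto simp: zero_less_iff_neq_zero)
        then show ?thesis
          using T0 regular_space[OF reg] regular_D_0[OF reg] by (simp add: I_def algebra_simps)
      qed
    qed
    have "(LINT w|P. Xinf w) = (LINT w|P. ?u0 w + ?Z0 w * R 0 w)"
      by (rule integral_cong_AE) (use Xinf_AE u0(1) R0i in auto)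
    also have "\<dots> = (LINT w|P. ?u0 w) + (LINT w|P. ?Z0 w * R 0 w)"
      by (rule Bochner_Integration.integral_add[OF u0(1) R0i])
    also have "\<dots> = (LINT w|P. ?v0 w) + (LINT w|P. ?Z0 w * \<rho> w)"
      by (simp only: u0(2) R0(2))
    also have "(LINT w|P. ?v0 w) = (LINT w|P. \<rho> w - I w * \<rho> w - ?Z0 w * \<rho> w)"
      by (rule integral_cong_AE) (use v0_AE in auto)
    also have "\<dots> = (LINT w|P. \<rho> w) - (LINT w|P. I w * \<rho> w) - (LINT w|P. ?Z0 w * \<rho> w)"
      using rho_integrable I\<rho> Z\<rho>i by (simp add: Bochner_Integration.integral_diff)
    finally show ?thesis by simp
  qed
  show ?thesis
    unfolding X_eq LINT_I
  proof
    assume ui: "ui_martingale P E X"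
    then have mart: "martingale P E X" and UI: "uniformly_integrable_process P X" by (auto simp: ui_martingale_def)
    have X_int: "integrable P (X t)" if "0 \<le> t" for t using mart that by (simp add: martingale_def)
    have E_X: "(LINT w|P. X t w) = (LINT w|P. \<rho> w)" if t: "0 \<le> t" for t
    proof -
      interpret S: sigma_finite_subalgebra P "E (ennreal 0)" by (rule sigma_finite_subalgebra_E)
      have ae: "AE w in P. real_cond_exp P (E (ennreal 0)) (X t) w = X 0 w"
        using mart t by (simp add: martingale_def del: ennreal_0)
      have "(LINT w|P. X t w) = (LINT w|P. real_cond_exp P (E (ennreal 0)) (X t) w)"
        using S.real_cond_exp_int(2)[OF X_int[OF t]] by simp
      also have "\<dots> = (LINT w|P. X 0 w)"
        by (rule integral_cong_AE) (use ae in auto)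
      also have "\<dots> = (LINT w|P. indicat_real (space P) w * R 0 w)"
      proof (rule integral_cong_AE)
        show "AE w in P. X 0 w = indicat_real (space P) w * R 0 w"
          using AE_regular by eventually_elim (simp add: X_def H_def regular_space regular_N_0)
      qed auto
      also have "\<dots> = (LINT w|P. \<rho> w)"
        unfolding expectation_R(2)[OF order_refl top] by (rule Bochner_Integration.integral_cong) auto
      finally show ?thesis .
    qed
    have Xlim: "AE w in P. (\<lambda>n. X (real n) w) \<longlonglongrightarrow> Xinf w"
      using AE_regular
    proof eventually_elim
      case (elim w)
      have "min (\<sigma> w) (T w) < \<top>" using regular_sigma(2)[OF elim] by (simp add: min_less_iff_disj)
      then obtain x where x: "0 \<le> x" "min (\<sigma> w) (T w) = ennreal x" by (cases "min (\<sigma> w) (T w)") auto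
      obtain m where m: "x \<le> real m" using real_arch_simple by blast
      have "eventually (\<lambda>n. X (real n) w = Xinf w) sequentially"
        using eventually_ge_at_top[of m]
      proof eventually_elim
        case (elim n)
        then have "x \<le> real n" using m by linarith
        then have "min (ennreal (real n)) (ennreal x) = ennreal x" by (intro min_absorb2 ennreal_leI)
        then show ?case unfolding X_def Xinf_def x by simp
      qed
      then show ?case by (rule tendsto_eventually)
    qed
    \<comment> \<open>Uniform integrability allows truncation at one level for all times. The
      truncated variables converge boundedly, so no mass escapes in the limit.\<close>
    have "(LINT w|P. \<rho> w) \<le> (LINT w|P. Xinf w) + e" if e: "e > 0" for e
    proof -
      obtain K where K: "\<And>t. t \<ge> 0 \<Longrightarrow> (LINT w|P. \<bar>X t w\<bar> * indicat_real {w. \<bar>X t w\<bar> > K} w) \<le> e"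
        using UI e unfolding uniformly_integrable_process_def by blast
      \<comment> \<open>The level from uniform integrability may be negative, but K' also serves as
        a bound for the truncated nonnegative variables.\<close>
      define K' where "K' = max K 0"
      have bound: "(LINT w|P. \<rho> w) \<le> (LINT w|P. min (X (real n) w) K') + e" for n
      proof -
        have Xn: "integrable P (X (real n))" by (rule X_int) simp
        have i1: "integrable P (\<lambda>w. min (X (real n) w) K')" using Xn by auto
        have i2: "integrable P (\<lambda>w. \<bar>X (real n) w\<bar> * of_bool (\<bar>X (real n) w\<bar> > K))"
          using integrable_bounded_mult[OF integrable_abs[OF Xn], of "\<lambda>w. of_bool (\<bar>X (real n) w\<bar> > K)" 1]
          by (simp add: mult.commute)
        have "(LINT w|P. \<rho> w) = (LINT w|P. X (real n) w)" using E_X by simp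
        also have "\<dots> \<le> (LINT w|P. min (X (real n) w) K' + \<bar>X (real n) w\<bar> * of_bool (\<bar>X (real n) w\<bar> > K))"
        proof (rule integral_mono[OF Xn Bochner_Integration.integrable_add[OF i1 i2]])
          fix w
          show "X (real n) w \<le> min (X (real n) w) K' + \<bar>X (real n) w\<bar> * of_bool (\<bar>X (real n) w\<bar> > K)"
            by (auto simp: K'_def min_def max_def)
        qed
        also have "\<dots> = (LINT w|P. min (X (real n) w) K') + (LINT w|P. \<bar>X (real n) w\<bar> * of_bool (\<bar>X (real n) w\<bar> > K))"
          by (rule Bochner_Integration.integral_add[OF i1 i2])
        also have "\<dots> \<le> (LINT w|P. min (X (real n) w) K') + e"
          using K[of "real n"] unfolding indicator_Collect_of_bool by simp
        finally show ?thesis .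
      qed
      have "(\<lambda>n. (LINT w|P. min (X (real n) w) K') + e) \<longlonglongrightarrow> (LINT w|P. min (Xinf w) K') + e"
      proof (intro tendsto_add tendsto_const integral_dominated_convergence[where w="\<lambda>_. K'"])
        show "AE w in P. (\<lambda>n. min (X (real n) w) K') \<longlonglongrightarrow> min (Xinf w) K'"
          using Xlim by eventually_elim (intro tendsto_intros)
        show "AE w in P. norm (min (X (real n) w) K') \<le> K'" for n
          using X_nonneg by eventually_elim (simp add: K'_def)
      qed auto
      then have "(LINT w|P. \<rho> w) \<le> (LINT w|P. min (Xinf w) K') + e"
        by (rule LIMSEQ_le_const) (use bound in blast)
      also have "(LINT w|P. min (Xinf w) K') \<le> (LINT w|P. Xinf w)"
        by (rule integral_mono) (use Xinf_int in auto)
      finally show ?thesis by simp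
    qed
    then have "(LINT w|P. \<rho> w) \<le> (LINT w|P. Xinf w)" by (rule field_le_epsilon)
    then have le: "(LINT w|P. I w * \<rho> w) \<le> 0" using E_Xinf by simp
    have nn: "AE w in P. 0 \<le> I w * \<rho> w"
      using I_bounds rho_pos_AE by eventually_elim simp
    have "(LINT w|P. I w * \<rho> w) = 0" using le integral_nonneg_AE[OF nn] by simp
    then have "AE w in P. I w * \<rho> w = 0"
      using integral_nonneg_eq_0_iff_AE[OF I\<rho> nn] by simp
    \<comment> \<open>Strict positivity of \<rho> removes the weight.\<close>
    then have "AE w in P. I w = 0"
      using rho_pos_AE by eventually_elim simp
    then show "(LINT w|P. I w) = 0" by (rule integral_eq_zero_AE)
  next
    assume I0: "(LINT w|P. I w) = 0"
    have "integrable P I" by (rule integrable_const_bound[where B=1]) (use I_bounds in auto)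
    then have I_AE: "AE w in P. I w = 0"
      using I0 I_bounds by (subst (asm) integral_nonneg_eq_0_iff_AE) auto
    \<comment> \<open>\<open>Xinf\<close> closes the process. As \<open>X s\<close> and
      \<open>Xinf\<close> differ only where s < \<sigma> and s < T, it is enough to compare them
      there, and there \<open>A\<close> can be replaced by an event of \<open>F s\<close>.\<close>
    have key: "integrable P (X s) \<and> (\<forall>A\<in>sets (E (ennreal s)). (LINT w|P. indicat_real A w * Xinf w) = (LINT w|P. indicat_real A w * X s w))"
      if s: "0 \<le> s" for s
    proof -
      note [measurable] = \<open>0 \<le> s \<Longrightarrow> D s \<in> borel_measurable P\<close>[OF s] \<open>0 \<le> s \<Longrightarrow> H s \<in> borel_measurable P\<close>[OF s]
      have T_s: "{w \<in> space P. ennreal s < T w} \<in> sets (F (ennreal s))"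
        using stopping_timeD2[OF T, of "ennreal s"] by (simp add: pred_def space_F)
      have parts: "integrable P (\<lambda>w. indicat_real B w * of_bool (ennreal s < \<sigma> w \<and> ennreal s < T w) * Xinf w)" (is "integrable P ?a")
        "integrable P (\<lambda>w. indicat_real B w * of_bool (ennreal s < \<sigma> w \<and> ennreal s < T w) * H s w)" (is "integrable P ?b")
        "(LINT w|P. indicat_real B w * of_bool (ennreal s < \<sigma> w \<and> ennreal s < T w) * Xinf w) =
         (LINT w|P. indicat_real B w * of_bool (ennreal s < \<sigma> w \<and> ennreal s < T w) * H s w)"
        if B: "B \<in> sets (F (ennreal s))" for B
      proof -
        have [measurable]: "B \<in> sets P" using B sets_F_subset by auto
        let ?B = "B \<inter> {w \<in> space P. ennreal s < T w}"
        have B2: "?B \<in> sets (F (ennreal s))" using B T_s by (rule sets.Int)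
        note 1 = expectation_terminal_after_s[OF T s B, folded Xinf_def]
        note 2 = expectation_stopped_after_s[OF s B2]
        have eq: "indicat_real ?B w * of_bool (ennreal s < \<sigma> w) * H s w = ?b w" if "w \<in> space P" for w
          using that by (auto simp: indicator_def)
        show "integrable P ?a" by (rule 1(1))
        show "integrable P ?b" using 2(1) by (subst (asm) Bochner_Integration.integrable_cong[OF refl eq])
        \<comment> \<open>With the \<open>Dinf\<close> term gone, the two expectation formulas have
          the same right-hand side.\<close>
        have "(LINT w|P. ?a w) = (LINT w|P. indicat_real ?B w * of_bool (ennreal s < T0 w) * D s w * \<rho> w)"
          unfolding 1(2)
        proof (rule integral_cong_AE)
          show "AE w in P. indicat_real B w * of_bool (ennreal s < T w \<and> ennreal s < T0 w) * (D s w - of_bool (T0 w \<le> T w) * Dinf w) * \<rho> w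
            = indicat_real ?B w * of_bool (ennreal s < T0 w) * D s w * \<rho> w"
            using I_AE AE_space
          proof eventually_elim
            case (elim w)
            have "D s w - of_bool (T0 w \<le> T w) * Dinf w = D s w" using elim(1) by (simp add: I_def)
            then show ?case using elim(2) by (auto simp: indicator_def)
          qed
        qed measurable
        also have "\<dots> = (LINT w|P. ?b w)"
          unfolding 2(2)[symmetric] by (rule Bochner_Integration.integral_cong[OF refl eq])
        finally show "(LINT w|P. ?a w) = (LINT w|P. ?b w)" .
      qed
      have Xs: "X s w = (if ennreal s < \<sigma> w \<and> ennreal s < T w then H s w else Xinf w)" for w
      proof (cases "ennreal s < \<sigma> w \<and> ennreal s < T w")
        case True
        then have "min (ennreal s) (min (\<sigma> w) (T w)) = ennreal s" by (simp add: min_absorb1 less_imp_le)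
        then show ?thesis using True s by (simp add: X_def)
      next
        case False
        then have "min (ennreal s) (min (\<sigma> w) (T w)) = min (\<sigma> w) (T w)"
          by (intro min_absorb2) (auto simp: min_le_iff_disj not_less)
        then show ?thesis unfolding if_not_P[OF False] X_def Xinf_def by (simp only:)
      qed
      have Xs_int: "integrable P (X s)"
      proof -
        note 1 = parts(1,2)[OF top]
        have "integrable P (\<lambda>w. Xinf w - indicat_real (space P) w * of_bool (ennreal s < \<sigma> w \<and> ennreal s < T w) * Xinf w
            + indicat_real (space P) w * of_bool (ennreal s < \<sigma> w \<and> ennreal s < T w) * H s w)"
          by (intro Bochner_Integration.integrable_add Bochner_Integration.integrable_diff Xinf_int 1)
        then show ?thesis
          by (rule Bochner_Integration.integrable_cong[THEN iffD1, rotated -1]) (auto simp: Xs)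
      qed
      moreover have "(LINT w|P. indicat_real A w * Xinf w) = (LINT w|P. indicat_real A w * X s w)"
        if A: "A \<in> sets (E (ennreal s))" for A
      proof -
        have [measurable]: "A \<in> sets P" using A sets_E_subset by auto
        obtain B where B: "B \<in> sets (F (ennreal s))" "\<And>w. w \<in> space P \<Longrightarrow> ennreal s < \<sigma> w \<Longrightarrow> (w \<in> A \<longleftrightarrow> w \<in> B)"
          using enlargement_trace[OF s A] by blast
        note 1 = parts[OF B(1)]
        have iA: "integrable P (\<lambda>w. indicat_real A w * Xinf w)" "integrable P (\<lambda>w. indicat_real A w * X s w)"
          using integrable_bounded_mult[OF Xinf_int, of "indicat_real A" 1] integrable_bounded_mult[OF Xs_int, of "indicat_real A" 1] by auto
        have "(LINT w|P. indicat_real A w * Xinf w) - (LINT w|P. indicat_real A w * X s w)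
          = (LINT w|P. indicat_real A w * Xinf w - indicat_real A w * X s w)"
          by (rule Bochner_Integration.integral_diff[OF iA, symmetric])
        also have "\<dots> = (LINT w|P. indicat_real B w * of_bool (ennreal s < \<sigma> w \<and> ennreal s < T w) * Xinf w
            - indicat_real B w * of_bool (ennreal s < \<sigma> w \<and> ennreal s < T w) * H s w)"
          by (rule Bochner_Integration.integral_cong) (use B(2) in \<open>auto simp: Xs indicator_def\<close>)
        also have "\<dots> = 0" unfolding Bochner_Integration.integral_diff[OF 1(1,2)] 1(3) by simp
        finally show ?thesis by simp
      qed
      ultimately show ?thesis by blast
    qed
    have X_int: "integrable P (X s)" if "0 \<le> s" for s using key[OF that] by blast
    have X_avg: "(LINT w|P. indicat_real A w * Xinf w) = (LINT w|P. indicat_real A w * X s w)"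
      if "0 \<le> s" "A \<in> sets (E (ennreal s))" for s A using key[OF that(1)] that(2) by blast
    have X_adapted: "X t \<in> borel_measurable (E (ennreal t))" if t: "0 \<le> t" for t
    proof -
      let ?U = "\<lambda>w. enn2real (min (ennreal t) (min (\<sigma> w) (T w)))"
      have "(\<lambda>w. min (ennreal t) (min (\<sigma> w) (T w))) \<in> borel_measurable (E (ennreal t))"
      proof (rule borel_measurableI_greater)
        fix a
        show "{w \<in> space (E (ennreal t)). a < min (ennreal t) (min (\<sigma> w) (T w))} \<in> sets (E (ennreal t))"
        proof (cases "a < ennreal t")
          case True
          have "{w \<in> space P. a < T w} \<in> sets (F a)"
            using stopping_timeD2[OF T, of a] by (simp add: pred_def space_F)
          then have "{w \<in> space P. a < T w} \<in> sets (E (ennreal t))"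
            by (rule subsetD[OF order_trans[OF sets_F_mono[OF less_imp_le[OF True]] sets_F_E]])
          moreover have "{w \<in> space P. a < \<sigma> w} \<in> sets (E (ennreal t))"
            by (rule sigma_greater_E) (use True in simp)
          ultimately have "{w \<in> space P. a < \<sigma> w} \<inter> {w \<in> space P. a < T w} \<in> sets (E (ennreal t))" by (rule sets.Int[rotated])
          also have "{w \<in> space P. a < \<sigma> w} \<inter> {w \<in> space P. a < T w} = {w \<in> space (E (ennreal t)). a < min (ennreal t) (min (\<sigma> w) (T w))}"
            using True by (auto simp: space_E)
          finally show ?thesis .
        qed simp
      qed
      then have U: "?U \<in> borel_measurable (E (ennreal t))" by measurable
      have range: "0 \<le> ?U w \<and> ?U w \<le> t" for w
        using t by (simp add: enn2real_min_ennreal)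
      have F_E: "f \<in> borel_measurable (E (ennreal t))" if "f \<in> borel_measurable (F (ennreal t))" for f
        by (rule measurable_from_subalg[OF _ that]) (simp add: subalgebra_def space_E space_F sets_F_E)
      have "(\<lambda>w. R (?U w) w) \<in> borel_measurable (E (ennreal t))"
        by (rule measurable_at_bounded_random_time[OF U, where t=t])
          (use range in \<open>auto simp: space_E intro!: F_E measurable_N_R_rat R_right\<close>)
      moreover have "(\<lambda>w. N (?U w) w) \<in> borel_measurable (E (ennreal t))"
        by (rule measurable_at_bounded_random_time[OF U, where t=t])
          (use range in \<open>auto simp: space_E intro!: F_E measurable_N_R_rat continuous_paths_right[OF N_paths]\<close>)
      ultimately show ?thesis unfolding X_def H_def by (rule borel_measurable_divide)
    qed
    have "martingale P E X"
      unfolding martingale_def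
    proof (intro conjI allI impI)
      show "adapted E X" using X_adapted by (simp add: adapted_def)
      show "integrable P (X t)" if "0 \<le> t" for t by (rule X_int[OF that])
      fix s t :: real assume st: "0 \<le> s" "s \<le> t"
      interpret S: sigma_finite_subalgebra P "E (ennreal s)" by (rule sigma_finite_subalgebra_E)
      show "AE w in P. real_cond_exp P (E (ennreal s)) (X t) w = X s w"
      \<comment> \<open>An event of time \<open>s\<close> is also one of time \<open>t\<close>, so
        over it both \<open>X s\<close> and \<open>X t\<close> have the integral of
        \<open>Xinf\<close>.\<close>
      proof (rule S.real_cond_exp_charact)
        fix A assume A: "A \<in> sets (E (ennreal s))"
        then have A': "A \<in> sets (E (ennreal t))" using sets_E_mono[OF ennreal_leI[OF st(2)]] by blast
        show "(LINT w:A|P. X t w) = (LINT w:A|P. X s w)"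
          unfolding set_lebesgue_integral_def
          using X_avg[OF st(1) A] X_avg[OF _ A'] st by simp
      qed (use st X_int X_adapted in auto)
    qed
    moreover have "uniformly_integrable_process P X"
      unfolding uniformly_integrable_process_def
    proof (intro conjI allI impI)
      show "integrable P (X t)" if "0 \<le> t" for t by (rule X_int[OF that])
      fix e :: real assume e: "e > 0"
      have Xinf0: "AE w in P. 0 \<le> Xinf w" using X_nonneg by eventually_elim simp
      obtain K0 where K0: "\<And>g K. integrable P g \<Longrightarrow> AE x in P. 0 \<le> g x \<Longrightarrow> K \<ge> K0 \<Longrightarrow>
          tail_dominated P Xinf g \<Longrightarrow> (LINT x|P. g x * indicat_real {x\<in>space P. g x > K} x) \<le> e"
        using uniformly_dominated_tail[OF Xinf_int Xinf0 e] by blast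
      show "\<exists>K. \<forall>t\<ge>0. (LINT w|P. \<bar>X t w\<bar> * indicat_real {w. \<bar>X t w\<bar> > K} w) \<le> e"
      proof (intro exI[of _ K0] allI impI)
        fix t :: real assume t: "0 \<le> t"
        have X0: "AE w in P. 0 \<le> X t w" using X_nonneg by eventually_elim simp
        have "(LINT w|P. \<bar>X t w\<bar> * indicat_real {w. \<bar>X t w\<bar> > K0} w) = (LINT w|P. X t w * indicat_real {w\<in>space P. X t w > K0} w)"
          unfolding indicator_Collect_of_bool
        proof (rule integral_cong_AE)
          show "AE w in P. \<bar>X t w\<bar> * of_bool (\<bar>X t w\<bar> > K0) = X t w * of_bool (w \<in> space P \<and> X t w > K0)"
            using X0 AE_space by eventually_elim simp
        qed measurable
        also have "\<dots> \<le> e"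
        \<comment> \<open>The superlevel sets of \<open>X t\<close> are events of time
          \<open>t\<close>, so integrating \<open>Xinf\<close> over them gives the tail condition,
          with equality.\<close>
        proof (rule K0[OF X_int[OF t] X0 order_refl], unfold tail_dominated_def, intro allI impI)
          fix K' :: real
          have "{w\<in>space (E (ennreal t)). X t w > K'} \<in> sets (E (ennreal t))"
            using X_adapted[OF t] by measurable
          then have "{w\<in>space P. X t w > K'} \<in> sets (E (ennreal t))" by (simp add: space_E)
          from X_avg[OF t this]
          show "(LINT w|P. X t w * indicat_real {w\<in>space P. X t w > K'} w) \<le> (LINT w|P. Xinf w * indicat_real {w\<in>space P. X t w > K'} w)"
            by (simp add: mult.commute)
        qed
        finally show "(LINT w|P. \<bar>X t w\<bar> * indicat_real {w. \<bar>X t w\<bar> > K0} w) \<le> e" .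
      qed
    qed
    ultimately show "ui_martingale P E X" by (simp add: ui_martingale_def)
  qed
qed

end

section \<open>The density of the local martingale measure\<close>

context natural_filtered_prob_space
begin

text \<open>\<rho> is given only as a density of \<open>Q\<close>; uniqueness of densities
  identifies it with the limit of the positive martingale \<open>L\<close>, whose integrability
  follows from Fatou's lemma and the constant mean 1 of \<open>L\<close>.\<close>

lemma equiv_local_martingale_measure_density:
  assumes Q: "equiv_local_martingale_measure P F S Q" "Q = density P (\<lambda>w. ennreal (\<rho> w))"
    and [measurable]: "\<rho> \<in> borel_measurable P"
  shows "integrable P \<rho>" "AE w in P. 0 < \<rho> w"
proof -
  obtain L Linf where L: "ui_martingale P F L" "AE w in P. \<forall>t\<ge>0. L t w > 0" "AE w in P. L 0 w = 1"
    and [measurable]: "Linf \<in> borel_measurable P" and lim: "AE w in P. ((\<lambda>t. L t w) \<longlongrightarrow> Linf w) at_top"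
    and pos: "AE w in P. Linf w > 0" and Q': "Q = density P (\<lambda>w. ennreal (Linf w))"
    using Q(1) unfolding equiv_local_martingale_measure_def by blast
  have L_int: "integrable P (L t)" if "0 \<le> t" for t
    using L(1) that by (simp add: ui_martingale_def martingale_def)
  then have [measurable]: "L (real n) \<in> borel_measurable P" for n by auto
  have EL: "(LINT w|P. L t w) = 1" if t: "0 \<le> t" for t
  proof -
    interpret S: sigma_finite_subalgebra P "F (ennreal 0)" by (rule sigma_finite_subalgebra_F)
    have ae: "AE w in P. real_cond_exp P (F (ennreal 0)) (L t) w = 1"
    proof -
      have "AE w in P. real_cond_exp P (F (ennreal 0)) (L t) w = L 0 w"
        using L(1) t by (simp add: ui_martingale_def martingale_def del: ennreal_0)
      with L(3) show ?thesis by eventually_elim simp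
    qed
    have "(LINT w|P. L t w) = (LINT w|P. real_cond_exp P (F (ennreal 0)) (L t) w)"
      using S.real_cond_exp_int(2)[OF L_int[OF t]] by simp
    also have "\<dots> = (LINT w|P. 1)" by (rule integral_cong_AE) (use ae in auto)
    finally show ?thesis by (simp add: prob_space)
  qed
  have "(\<integral>\<^sup>+w. ennreal (Linf w) \<partial>P) = (\<integral>\<^sup>+w. liminf (\<lambda>n. ennreal (L (real n) w)) \<partial>P)"
  proof (rule nn_integral_cong_AE)
    show "AE w in P. ennreal (Linf w) = liminf (\<lambda>n. ennreal (L (real n) w))"
      using lim
    proof eventually_elim
      case (elim w)
      have "(\<lambda>n. L (real n) w) \<longlonglongrightarrow> Linf w"
        by (rule filterlim_compose[OF elim filterlim_real_sequentially])
      then show ?case by (intro lim_imp_Liminf[symmetric] tendsto_ennrealI) auto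
    qed
  qed
  also have "\<dots> \<le> liminf (\<lambda>n. \<integral>\<^sup>+w. ennreal (L (real n) w) \<partial>P)"
    by (rule nn_integral_liminf) simp
  also have "\<dots> = liminf (\<lambda>n. 1)"
  proof -
    have "(\<integral>\<^sup>+w. ennreal (L (real n) w) \<partial>P) = 1" for n
    proof -
      have "AE w in P. 0 \<le> L (real n) w" using L(2) by eventually_elim (simp add: less_imp_le)
      then show ?thesis using nn_integral_eq_integral[OF L_int] EL by simp
    qed
    then show ?thesis by simp
  qed
  finally have "(\<integral>\<^sup>+w. ennreal (Linf w) \<partial>P) \<le> 1" by (simp add: Liminf_const)
  then have Linf_int: "integrable P Linf"
    using pos by (intro integrableI_nonneg) (auto intro: le_less_trans)
  have "AE w in P. ennreal (\<rho> w) = ennreal (Linf w)"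
    using Q(2) Q' by (intro density_unique) auto
  \<comment> \<open>\<open>ennreal\<close> sends negative numbers to 0, so equality of the real
    values rests on the positivity of \<open>Linf\<close>.\<close>
  then have eq: "AE w in P. \<rho> w = Linf w"
    using pos by eventually_elim (metis ennreal_eq_0_iff ennreal_inj less_imp_le linorder_not_le order_less_irrefl)
  show "integrable P \<rho>"
    by (rule integrable_cong_AE_imp[OF Linf_int]) (use eq in auto)
  show "AE w in P. 0 < \<rho> w" using eq pos by eventually_elim simp
qed

text \<open>The tower property. It makes the assumption that all martingales are continuous
  applicable to \<open>R\<close>.\<close>

lemma martingale_of_density:
  assumes \<rho>: "integrable P \<rho>" and R: "adapted F R"
    and R_cond: "\<forall>t\<ge>0. AE w in P. R t w = real_cond_exp P (F (ennreal t)) \<rho> w"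
  shows "martingale P F R"
  unfolding martingale_def
proof (intro conjI allI impI R)
  have Rm [measurable]: "R t \<in> borel_measurable P" if "0 \<le> t" for t
    using R that by (intro measurable_from_subalg[OF subalgebra_F[of "ennreal t"]]) (simp add: adapted_def)
  show "integrable P (R t)" if t: "0 \<le> t" for t
  proof -
    interpret S: sigma_finite_subalgebra P "F (ennreal t)" by (rule sigma_finite_subalgebra_F)
    show ?thesis
      by (rule integrable_cong_AE_imp[OF S.real_cond_exp_int(1)[OF \<rho>] Rm[OF t]]) (use R_cond t in auto)
  qed
  fix s t :: real assume st: "0 \<le> s" "s \<le> t"
  then have t: "0 \<le> t" by simp
  interpret S: sigma_finite_subalgebra P "F (ennreal s)" by (rule sigma_finite_subalgebra_F)
  have "AE w in P. real_cond_exp P (F (ennreal s)) (R t) w = real_cond_exp P (F (ennreal s)) (real_cond_exp P (F (ennreal t)) \<rho>) w"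
    by (rule S.real_cond_exp_cong) (use R_cond t Rm in auto)
  moreover have "AE w in P. real_cond_exp P (F (ennreal s)) (real_cond_exp P (F (ennreal t)) \<rho>) w = real_cond_exp P (F (ennreal s)) \<rho> w"
    by (rule S.real_cond_exp_nested_subalg[OF subalgebra_F _ \<rho>])
      (use sets_F_mono[OF ennreal_leI[OF st(2)]] in \<open>simp add: subalgebra_def space_F\<close>)
  moreover have "AE w in P. R s w = real_cond_exp P (F (ennreal s)) \<rho> w" using R_cond st by simp
  ultimately show "AE w in P. real_cond_exp P (F (ennreal s)) (R t) w = R s w"
    by eventually_elim simp
qed

end

theorem theorem7p9:
  fixes P Q :: "'a measure" and F :: "ennreal \<Rightarrow> 'a measure"
    and \<sigma> T :: "'a \<Rightarrow> ennreal" and \<rho> :: "'a \<Rightarrow> real"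
    and S Z N D R :: "real \<Rightarrow> 'a \<Rightarrow> real"
  assumes "natural_filtered_prob_space P F"
    and "\<sigma> \<in> borel_measurable P"
    and "avoids_stopping_times P F \<sigma>"
    and "all_martingales_continuous P F"
    and "is_azema_supermartingale P F \<sigma> Z"
    and "ito_watanabe_decomposition P F Z N D"
    and "continuous_semimartingale P F S"
    and "NFLVR P F S"
    and "\<rho> \<in> borel_measurable P"
    and "Q = density P (\<lambda>\<omega>. ennreal (\<rho> \<omega>))"
    and "equiv_local_martingale_measure P F S Q"
    and "adapted F R" and "cadlag_paths P R"
    and "\<forall>t\<ge>0. AE \<omega> in P. R t \<omega> = real_cond_exp P (F (ennreal t)) \<rho> \<omega>"
    and "stopping_time F T"
  shows "ui_martingale P (progressive_enlargement P F \<sigma>)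
           (\<lambda>t \<omega>. stopped R (\<lambda>\<omega>. min (\<sigma> \<omega>) (T \<omega>)) t \<omega> / stopped N (\<lambda>\<omega>. min (\<sigma> \<omega>) (T \<omega>)) t \<omega>)
     \<longleftrightarrow> (LINT \<omega>|P. limit_at_infinity D \<omega> * indicat_real {\<omega>. first_zero N \<omega> \<le> T \<omega>} \<omega>) = 0"
proof -
  interpret natural_filtered_prob_space P F by (rule assms)
  note density = equiv_local_martingale_measure_density[OF assms(11,10,9)]
  have "martingale P F R" by (rule martingale_of_density[OF density(1) assms(12,14)])
  then have R_cont: "AE w in P. continuous_on {0..} (\<lambda>t. R t w)"
    using assms(4,13) by (simp add: all_martingales_continuous_def)
  note iw = assms(6)[unfolded ito_watanabe_decomposition_def]
  from iw obtain lam :: "nat \<Rightarrow> 'a \<Rightarrow> ennreal" where lam: "\<forall>n. stopping_time F (lam n)"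
    "AE w in P. incseq (\<lambda>n. lam n w) \<and> (\<lambda>n. lam n w) \<longlonglongrightarrow> \<top>"
    "\<forall>n. martingale P F (\<lambda>t w. stopped N (lam n) t w - N 0 w)"
    unfolding cont_local_martingale_def local_martingale_def by blast
  interpret enlarged_market P F \<sigma> Z N D R \<rho> lam
    using iw lam R_cont density assms(2,3,5,12-14)
    by unfold_locales (auto simp: cont_local_martingale_def local_martingale_def)
  show ?thesis by (rule ui_martingale_iff[OF assms(15)])
qed

end
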